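(* Let $d>3$ be an integer and let $\mathcal{F}_d=V(x^d+y^d+z^d)\subset\mathbb{P}^2$ be the Fermat curve of degree $d$ over $\mathbb{C}$. Let $s_1,\dots,s_d$ be any $d$ distinct sextactic points of $\mathcal{F}_d$ that are co-linear (all lie on one line in $\mathbb{P}^2$). Let $T_{s_i}$ be the tangent line to $\mathcal{F}_d$ at $s_i$ and let $O_{s_i}$ be the hyperosculating conic to $\mathcal{F}_d$ at $s_i$. Then: (1) $\bigcap_{i=1}^d T_{s_i}$ consists of exactly one point, which is a $d$-fold point of the union $\bigcup_i T_{s_i}$; (2) $\bigcap_{i=1}^d O_{s_i}$ consists of exactly two points, so that the union $\bigcup_i O_{s_i}$ contains two $d$-fold points (points through which all $d$ conics pass).
   Context: We work in the projective plane $\mathbb{P}^2$ over $\mathbb{C}$. For a smooth point $p$ of a plane curve $\mathcal{C}$, $(\mathcal{C}.\Sigma)_p$ denotes the intersection multiplicity at $p$. The osculating conic $O_p$ to $\mathcal{F}_d$ at $p\in\mathcal{F}_d$ is the unique conic with $(O_p.\mathcal{F}_d)_p\geq 5$; it is called hyperosculating if $(O_p.\mathcal{F}_d)_p\geq 6$. An inflection point of $\mathcal{F}_d$ is a point $p$ whose tangent line $T_p$ satisfies $(T_p.\mathcal{F}_d)_p\geq 3$. A sextactic point of $\mathcal{F}_d$ is a point that is not an inflection point and at which the osculating conic is hyperosculating. *)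

theory Defs
  imports
    "HOL-Analysis.Analysis"
    "HOL-Computational_Algebra.Fraction_Field"
    "HOL-Computational_Algebra.Polynomial"
    "HOL-Library.Extended_Nat"
begin

definition proj_rel :: "complex ^ 3 \<Rightarrow> complex ^ 3 \<Rightarrow> bool" where
  "proj_rel u v \<longleftrightarrow> u \<noteq> 0 \<and> v \<noteq> 0 \<and> (\<exists>c. c \<noteq> 0 \<and> v = c *s u)"

lemma part_equivp_proj_rel: "part_equivp proj_rel"
proof (rule part_equivpI)
  have "(1 :: complex ^ 3) \<noteq> 0"
    by (simp add: vec_eq_iff)
  then have "proj_rel 1 1"
    unfolding proj_rel_def by (intro conjI exI[of _ 1]) auto
  then show "\<exists>x. proj_rel x x" by blast
next
  show "symp proj_rel"
  proof (rule sympI)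
    fix u v assume uv: "proj_rel u v"
    then obtain c where c: "c \<noteq> 0" "v = c *s u" by (auto simp: proj_rel_def)
    then have "u = inverse c *s v" by (simp add: vector_smult_assoc)
    with uv c(1) show "proj_rel v u"
      unfolding proj_rel_def by (intro conjI exI[of _ "inverse c"]) auto
  qed
next
  show "transp proj_rel"
  proof (rule transpI)
    fix u v w assume uv: "proj_rel u v" and vw: "proj_rel v w"
    then obtain c e where "c \<noteq> 0" "v = c *s u" "e \<noteq> 0" "w = e *s v"
      by (auto simp: proj_rel_def)
    then have "e * c \<noteq> 0" "w = (e * c) *s u" by (simp_all add: vector_smult_assoc)
    with uv vw show "proj_rel u w"
      unfolding proj_rel_def by (intro conjI exI[of _ "e * c"]) auto
  qed
qed

text \<open>The projective plane over the complex numbers.\<close>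

quotient_type p2 = "complex ^ 3" / partial: proj_rel
  by (rule part_equivp_proj_rel)

text \<open>
  Polynomials in \<open>x\<close>, \<open>y\<close>, \<open>z\<close> are nested univariate polynomials; the outermost
  variable is \<open>z\<close> and the innermost is \<open>x\<close>, so the coefficient of
  \<open>x^i y^j z^k\<close> in \<open>P\<close> is \<open>coeff (coeff (coeff P k) j) i\<close>.
\<close>

type_synonym tpoly = "complex poly poly poly"

definition tconst :: "complex \<Rightarrow> tpoly" where "tconst c = [:[:[:c:]:]:]"
definition varX :: tpoly where "varX = [:[:[:0, 1:]:]:]"
definition varY :: tpoly where "varY = [:[:0, 1:]:]"
definition varZ :: tpoly where "varZ = [:0, 1:]"

definition dX :: "tpoly \<Rightarrow> tpoly" where "dX = map_poly (map_poly pderiv)"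
definition dY :: "tpoly \<Rightarrow> tpoly" where "dY = map_poly pderiv"
definition dZ :: "tpoly \<Rightarrow> tpoly" where "dZ = pderiv"

definition homogeneous :: "nat \<Rightarrow> tpoly \<Rightarrow> bool" where
  "homogeneous n P \<longleftrightarrow>
     (\<forall>i j k. coeff (coeff (coeff P k) j) i \<noteq> 0 \<longrightarrow> i + j + k = n)"

definition eval3 :: "tpoly \<Rightarrow> complex ^ 3 \<Rightarrow> complex" where
  "eval3 P v = poly (poly (poly P [:[:v $ 3:]:]) [:v $ 2:]) (v $ 1)"

text \<open>
  Value at an arbitrary representative of the point. This is used for homogeneous
  polynomials only, whose vanishing does not depend on the representative.
\<close>

definition eval_at :: "tpoly \<Rightarrow> p2 \<Rightarrow> complex" where
  "eval_at P p = eval3 P (rep_p2 p)"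

definition zero_locus :: "tpoly \<Rightarrow> p2 set" where
  "zero_locus P = {p. eval_at P p = 0}"

definition is_line :: "tpoly \<Rightarrow> bool" where
  "is_line L \<longleftrightarrow> L \<noteq> 0 \<and> homogeneous 1 L"

definition is_conic :: "tpoly \<Rightarrow> bool" where
  "is_conic Q \<longleftrightarrow> Q \<noteq> 0 \<and> homogeneous 2 Q"

definition fermat :: "nat \<Rightarrow> tpoly" where
  "fermat d = varX ^ d + varY ^ d + varZ ^ d"

text \<open>
  The local ring of the plane at \<open>p\<close>, inside the fraction field of the polynomial ring:
  fractions of forms of equal degree whose denominator does not vanish at \<open>p\<close>.
\<close>

definition local_ring :: "p2 \<Rightarrow> tpoly fract set" where
  "local_ring p =
     {Fract A D | A D n. homogeneous n A \<and> homogeneous n D \<and> eval_at D p \<noteq> 0}"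

text \<open>The ideal of the curve \<open>F = 0\<close> in the local ring at \<open>p\<close>.\<close>

definition local_ideal :: "tpoly \<Rightarrow> p2 \<Rightarrow> tpoly fract set" where
  "local_ideal F p =
     {Fract (F * A) D | A D n. homogeneous n (F * A) \<and> homogeneous n D \<and> eval_at D p \<noteq> 0}"

text \<open>
  Dimension of the quotient \<open>V / W\<close> of complex vector spaces: the supremum of the
  sizes of finite subsets of \<open>V\<close> that are linearly independent modulo \<open>W\<close>.
\<close>

definition quotient_dim :: "tpoly fract set \<Rightarrow> tpoly fract set \<Rightarrow> enat" where
  "quotient_dim V W =
     (SUP B \<in> {B. finite B \<and> B \<subseteq> V \<and>
        (\<forall>c. (\<Sum>b\<in>B. Fract (tconst (c b)) 1 * b) \<in> W \<longrightarrow> (\<forall>b\<in>B. c b = 0))}.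
      enat (card B))"

text \<open>
  The intersection multiplicity at \<open>p\<close> is the complex dimension of the local ring at \<open>p\<close>
  modulo the ideal generated by both curves. It is infinite if they share a component
  through \<open>p\<close>.
\<close>

definition intersection_mult :: "tpoly \<Rightarrow> tpoly \<Rightarrow> p2 \<Rightarrow> enat" where
  "intersection_mult F G p =
     quotient_dim (local_ring p) {f + g | f g. f \<in> local_ideal F p \<and> g \<in> local_ideal G p}"

text \<open>An equation of the tangent line at a smooth point \<open>p\<close> of \<open>F = 0\<close>.\<close>

definition tangent_line :: "tpoly \<Rightarrow> p2 \<Rightarrow> tpoly" where
  "tangent_line F p =
     tconst (eval_at (dX F) p) * varX + tconst (eval_at (dY F) p) * varY
     + tconst (eval_at (dZ F) p) * varZ"

definition inflection_point :: "tpoly \<Rightarrow> p2 \<Rightarrow> bool" where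
  "inflection_point F p \<longleftrightarrow>
     p \<in> zero_locus F \<and> intersection_mult (tangent_line F p) F p \<ge> 3"

text \<open>
  Uniqueness of the osculating conic (up to a scalar) is not part of the definition; it
  holds at smooth points that are not inflection points.
\<close>

definition osculating_conic :: "tpoly \<Rightarrow> p2 \<Rightarrow> tpoly \<Rightarrow> bool" where
  "osculating_conic F p Q \<longleftrightarrow> is_conic Q \<and> intersection_mult Q F p \<ge> 5"

definition hyperosculating_conic :: "tpoly \<Rightarrow> p2 \<Rightarrow> tpoly \<Rightarrow> bool" where
  "hyperosculating_conic F p Q \<longleftrightarrow> osculating_conic F p Q \<and> intersection_mult Q F p \<ge> 6"

definition sextactic_point :: "tpoly \<Rightarrow> p2 \<Rightarrow> bool" where
  "sextactic_point F p \<longleftrightarrow>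
     p \<in> zero_locus F \<and> \<not> inflection_point F p \<and> (\<exists>Q. hyperosculating_conic F p Q)"

text \<open>
  Multiplicity of \<open>p\<close> on the curve \<open>G = 0\<close>: the least order of a partial derivative of
  the form \<open>G\<close> that does not vanish at \<open>p\<close>.
\<close>

definition point_mult :: "tpoly \<Rightarrow> p2 \<Rightarrow> nat" where
  "point_mult G p =
     (LEAST m. \<exists>i j k. i + j + k = m \<and>
        eval_at ((dX ^^ i) ((dY ^^ j) ((dZ ^^ k) G))) p \<noteq> 0)"

text \<open>
  \<open>p\<close> is an \<open>m\<close>-fold point of the union of the curves \<open>C i = 0\<close>, \<open>i \<in> I\<close>. The product
  of the \<open>C i\<close> counts repeated curves repeatedly, so the curves are required to be
  pairwise distinct as point sets.
\<close>

definition fold_point_of_union :: "nat \<Rightarrow> nat set \<Rightarrow> (nat \<Rightarrow> tpoly) \<Rightarrow> p2 \<Rightarrow> bool" where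
  "fold_point_of_union m I C p \<longleftrightarrow>
     inj_on (\<lambda>i. zero_locus (C i)) I \<and> point_mult (\<Prod>i\<in>I. C i) p = m"

end

theory Submission
  imports Defs "HOL-Computational_Algebra.Formal_Power_Series"
begin

text \<open>
  Points of \<open>x\<^sup>d + y\<^sup>d + z\<^sup>d = 0\<close> with a zero coordinate are inflection points. At every other point \<open>(v\<^sub>1, v\<^sub>2, v\<^sub>3)\<close>
  the curve is parametrised by \<open>d\<close>-th roots of power series, and a conic with sixfold contact satisfies six linear
  equations in its coefficients. These are solvable only if two of the \<open>v\<^sub>a\<^sup>d\<close> agree, and then the conic is
  determined. A line through \<open>d\<close> sextactic points contains a vertex of the coordinate triangle: otherwise it meets each
  of the three types of sextactic points at most twice, so \<open>d \<le> 6\<close>, and the small cases fail because a power of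
  \<open>2\<^sup>1\<^sup>/\<^sup>d\<close> would be a quotient of differences of \<open>d\<close>-th roots of unity. Hence the points are obtained from one of
  them by multiplying a single coordinate with the \<open>d\<close>-th roots of unity, and so are their tangents and conics. A
  common point of the latter has this coordinate zero, which leaves one point for the tangents and the two roots of
  a binary quadratic form for the conics.
\<close>

section \<open>Forms in three variables\<close>

text \<open>The multiplicity is a dimension, yet it is used only through power series: sixfold
  contact has to become divisibility by \<open>fps_X ^ 6\<close> along a parametrised arc, and
  conversely such a divisibility has to produce threefold contact at the points with a zero
  coordinate. Why a line off the vertices meets each type at most twice: normalise the points to (1,
  u, w), so that |u| = 1 and |w| is constant. On the line a + b u + c w = 0 the number u then lies
  on the unit circle and on a circle |a + b u| = const, and these circles have different centres.
  Why a line through a vertex leaves one free coordinate: it fixes the ratio of the other two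
  coordinates, and the equation of the curve then fixes the d-th power of the last one. Distinct
  points have distinct roots. Why a common point of the conics has this coordinate zero: the
  reciprocals of three different scalings are roots of one polynomial of degree at most two, so that
  all its coefficients vanish.\<close>

definition is_hom :: "('a::comm_ring_1 \<Rightarrow> 'b::comm_ring_1) \<Rightarrow> bool" where
  "is_hom h \<longleftrightarrow> h 0 = 0 \<and> h 1 = 1 \<and> (\<forall>a b. h (a + b) = h a + h b) \<and> (\<forall>a b. h (a * b) = h a * h b)"

lemma is_homD:
  assumes "is_hom h"
  shows "h 0 = 0" "h 1 = 1" "h (a + b) = h a + h b" "h (a * b) = h a * h b"
  using assms by (auto simp: is_hom_def)

lemma is_hom_power: "is_hom h \<Longrightarrow> h (a ^ n) = h a ^ n"
  by (induction n) (auto simp: is_homD)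

lemma is_hom_sum: "is_hom h \<Longrightarrow> h (\<Sum>i\<in>A. f i) = (\<Sum>i\<in>A. h (f i))"
  by (induction A rule: infinite_finite_induct) (auto simp: is_homD)

lemma is_hom_poly_map_poly:
  assumes h: "is_hom h"
  shows "is_hom (\<lambda>p. poly (map_poly h p) x)"
proof -
  note hs = is_homD[OF h]
  have add: "map_poly h (p + q) = map_poly h p + map_poly h q" for p q
    by (rule poly_eqI) (simp add: coeff_map_poly hs)
  have smult: "map_poly h (smult a q) = smult (h a) (map_poly h q)" for a q
    by (rule poly_eqI) (simp add: coeff_map_poly hs)
  have "map_poly h (p * q) = map_poly h p * map_poly h q" for p q
    by (induction p) (simp_all add: add smult map_poly_pCons hs)
  then show ?thesis
    using add by (simp add: is_hom_def hs)
qed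

text \<open>The pullback of a form along the arc \<open>g\<close> of three power series. Its order
  at 0 serves as a valuation. The innermost layer embeds the complex coefficients as constant
  series.\<close>

definition subst3 :: "(3 \<Rightarrow> complex fps) \<Rightarrow> tpoly \<Rightarrow> complex fps" where
  "subst3 g P = poly (map_poly (\<lambda>q. poly (map_poly (\<lambda>r. poly (map_poly fps_const r) (g 1)) q) (g 2)) P) (g 3)"

lemma is_hom_subst3: "is_hom (subst3 g)"
proof -
  have "is_hom (fps_const :: complex \<Rightarrow> _)"
    by (auto simp: is_hom_def)
  then show ?thesis
    unfolding subst3_def[abs_def] by (intro is_hom_poly_map_poly)
qed

lemmas subst3_simps = is_homD[OF is_hom_subst3] is_hom_power[OF is_hom_subst3]

lemma is_hom_eval3: "is_hom (\<lambda>P. eval3 P v)"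
  by (auto simp: is_hom_def eval3_def)

lemmas eval3_simps = is_homD[OF is_hom_eval3] is_hom_power[OF is_hom_eval3]

lemma eval3_diff: "eval3 (P - Q) v = eval3 P v - eval3 Q v"
  by (simp add: eval3_def)

definition var :: "3 \<Rightarrow> tpoly" where
  "var i = (if i = 1 then varX else if i = 2 then varY else varZ)"

definition partial :: "3 \<Rightarrow> tpoly \<Rightarrow> tpoly" where
  "partial i = (if i = 1 then dX else if i = 2 then dY else dZ)"

lemma var_simps [simp]: "var 1 = varX" "var 2 = varY" "var 3 = varZ"
  by (auto simp: var_def)

lemma partial_simps [simp]: "partial 1 = dX" "partial 2 = dY" "partial 3 = dZ"
  by (auto simp: partial_def)

lemma eval3_var [simp]: "eval3 (var i) v = v $ i"
  and eval3_tconst [simp]: "eval3 (tconst c) v = c"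
  using exhaust_3[of i] by (auto simp: eval3_def varX_def varY_def varZ_def tconst_def)

lemmas eval3_varXYZ [simp] = eval3_var[of 1, simplified] eval3_var[of 2, simplified] eval3_var[of 3, simplified]

lemma subst3_var [simp]: "subst3 g (var i) = g i"
  and subst3_tconst [simp]: "subst3 g (tconst c) = fps_const c"
  using exhaust_3[of i]
  by (auto simp: subst3_def varX_def varY_def varZ_def tconst_def map_poly_pCons)

lemmas subst3_varXYZ [simp] = subst3_var[of _ 1, simplified] subst3_var[of _ 2, simplified] subst3_var[of _ 3, simplified]

text \<open>Turns a form that is nonzero at the base point of the arc into a unit of the power
  series ring.\<close>

lemma subst3_nth_0: "fps_nth (subst3 g P) 0 = eval3 P (\<chi> i. fps_nth (g i) 0)"
proof -
  have 1: "fps_nth (poly (map_poly fps_const r) (g 1)) 0 = poly r (fps_nth (g 1) 0)" for r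
    by (induction r) (auto simp: map_poly_pCons)
  have 2: "fps_nth (poly (map_poly (\<lambda>r. poly (map_poly fps_const r) (g 1)) q) (g 2)) 0
      = poly (poly q [:fps_nth (g 2) 0:]) (fps_nth (g 1) 0)" for q
    by (induction q) (auto simp: map_poly_pCons 1)
  show ?thesis
    unfolding subst3_def eval3_def by (induction P) (auto simp: map_poly_pCons 2)
qed

lemma sum_nonzeroE:
  assumes "(\<Sum>i\<in>A. f i) \<noteq> 0"
  obtains i where "i \<in> A" "f i \<noteq> 0"
  using assms by (meson sum.neutral)

lemma homogeneousD: "homogeneous n P \<Longrightarrow> coeff (coeff (coeff P k) j) i \<noteq> 0 \<Longrightarrow> i + j + k = n"
  by (auto simp: homogeneous_def)

lemma homogeneous_0 [simp]: "homogeneous n 0"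
  by (simp add: homogeneous_def)

lemma homogeneous_tconst [simp]: "homogeneous 0 (tconst c)"
  by (auto simp: homogeneous_def tconst_def coeff_pCons split: nat.splits)

lemma homogeneous_1 [simp]: "homogeneous 0 1"
  using homogeneous_tconst[of 1] by (simp add: tconst_def one_pCons)

lemma homogeneous_var [simp]: "homogeneous 1 (var i)"
  using exhaust_3[of i]
  by (auto simp: homogeneous_def varX_def varY_def varZ_def coeff_pCons one_pCons split: nat.splits)

lemma homogeneous_add: "homogeneous n P \<Longrightarrow> homogeneous n Q \<Longrightarrow> homogeneous n (P + Q)"
  unfolding homogeneous_def by (metis add_0_right coeff_add)

lemma homogeneous_uminus: "homogeneous n P \<Longrightarrow> homogeneous n (- P)"
  by (simp add: homogeneous_def)

lemma homogeneous_diff: "homogeneous n P \<Longrightarrow> homogeneous n Q \<Longrightarrow> homogeneous n (P - Q)"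
  using homogeneous_add[of n P "- Q"] homogeneous_uminus by simp

lemma homogeneous_mult:
  assumes P: "homogeneous m P" and Q: "homogeneous n Q"
  shows "homogeneous (m + n) (P * Q)"
  unfolding homogeneous_def
proof (intro allI impI)
  fix i j k
  assume "coeff (coeff (coeff (P * Q) k) j) i \<noteq> 0"
  then obtain k' where k': "k' \<le> k" "coeff (coeff (coeff P k' * coeff Q (k - k')) j) i \<noteq> 0"
    by (auto simp: coeff_mult[of P] coeff_sum elim: sum_nonzeroE)
  then obtain j' where j': "j' \<le> j"
    "coeff (coeff (coeff P k') j' * coeff (coeff Q (k - k')) (j - j')) i \<noteq> 0"
    by (auto simp: coeff_mult[of "coeff P k'"] coeff_sum elim: sum_nonzeroE)
  then obtain i' where i': "i' \<le> i"
    "coeff (coeff (coeff P k') j') i' * coeff (coeff (coeff Q (k - k')) (j - j')) (i - i') \<noteq> 0"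
    by (auto simp: coeff_mult[of "coeff (coeff P k') j'"] elim: sum_nonzeroE)
  then have "i' + j' + k' = m" "(i - i') + (j - j') + (k - k') = n"
    using homogeneousD[OF P, of k' j' i'] homogeneousD[OF Q, of "k - k'" "j - j'" "i - i'"] by simp_all
  with k'(1) j'(1) i'(1) show "i + j + k = m + n" by linarith
qed

lemma homogeneous_power: "homogeneous n P \<Longrightarrow> homogeneous (k * n) (P ^ k)"
  by (induction k) (auto intro: homogeneous_mult)

lemma homogeneous_tconst_mult: "homogeneous n P \<Longrightarrow> homogeneous n (tconst c * P)"
  using homogeneous_mult[OF homogeneous_tconst[of c]] by fastforce

lemma is_hom_poly_expand:
  fixes h :: "'a::comm_ring_1 poly \<Rightarrow> 'b::comm_ring_1"
  assumes h: "is_hom h"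
  shows "h p = (\<Sum>i\<le>degree p. h [:coeff p i:] * h [:0, 1:] ^ i)"
proof -
  have "p = (\<Sum>i\<le>degree p. [:coeff p i:] * [:0, 1:] ^ i)"
    by (subst poly_as_sum_of_monoms[symmetric]) (simp add: monom_altdef)
  then have "h p = h (\<Sum>i\<le>degree p. [:coeff p i:] * [:0, 1:] ^ i)"
    by (rule arg_cong)
  then show ?thesis
    by (simp only: is_hom_sum[OF h] is_homD(4)[OF h] is_hom_power[OF h])
qed

lemma tpoly_expand:
  "P = (\<Sum>k\<le>degree P. \<Sum>j\<le>degree (coeff P k). \<Sum>i\<le>degree (coeff (coeff P k) j).
     tconst (coeff (coeff (coeff P k) j) i) * varX ^ i * varY ^ j * varZ ^ k)"
proof -
  have 1: "[:[:r:]:] = (\<Sum>i\<le>degree r. tconst (coeff r i) * varX ^ i)" for r :: "complex poly"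
    unfolding tconst_def varX_def
    by (rule is_hom_poly_expand[where h = "\<lambda>r. [:[:r:]:]"]) (auto simp: is_hom_def one_pCons)
  have 2: "[:q:] = (\<Sum>j\<le>degree q. [:[:coeff q j:]:] * varY ^ j)" for q :: "complex poly poly"
    unfolding varY_def
    by (rule is_hom_poly_expand[where h = "\<lambda>r. [:r:]"]) (auto simp: is_hom_def one_pCons)
  have "P = (\<Sum>k\<le>degree P. [:coeff P k:] * varZ ^ k)"
    unfolding varZ_def by (rule is_hom_poly_expand[where h = "\<lambda>r. r"]) (auto simp: is_hom_def)
  then show ?thesis
    by (simp only: 1[symmetric] 2[symmetric] sum_distrib_right[symmetric])
qed

text \<open>A form is a sum of monomials of its own degree, and each monomial grows from its
  coefficient by one variable at a time.\<close>

lemma homogeneous_induct [consumes 1, case_names zero const add var]: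
  assumes P: "homogeneous n P"
    and zero: "\<And>n. S n 0"
    and const: "\<And>c. S 0 (tconst c)"
    and add: "\<And>n A B. S n A \<Longrightarrow> S n B \<Longrightarrow> S n (A + B)"
    and var: "\<And>n A i. homogeneous n A \<Longrightarrow> S n A \<Longrightarrow> S (Suc n) (var i * A)"
  shows "S n P"
proof -
  have pow: "homogeneous (m + k) (var i ^ k * A) \<and> S (m + k) (var i ^ k * A)"
    if "homogeneous m A" "S m A" for m k A i
  proof (induction k)
    case (Suc k)
    then show ?case
      using var[of "m + k" "var i ^ k * A" i] homogeneous_mult[OF homogeneous_var[of i], of "m + k"]
      by (auto simp: mult.assoc)
  qed (use that in auto)
  have mono: "S (i + j + k) (tconst c * varX ^ i * varY ^ j * varZ ^ k)" for c i j k
  proof -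
    have 1: "homogeneous i (tconst c * varX ^ i) \<and> S i (tconst c * varX ^ i)"
      using pow[of 0 "tconst c" i 1] const[of c] by (simp add: mult_ac)
    then have 2: "homogeneous (i + j) (tconst c * varX ^ i * varY ^ j) \<and> S (i + j) (tconst c * varX ^ i * varY ^ j)"
      using pow[of i "tconst c * varX ^ i" j 2] by (simp add: mult_ac)
    then show ?thesis
      using pow[of "i + j" "tconst c * varX ^ i * varY ^ j" k 3] by (simp add: mult_ac)
  qed
  have sum: "S n (\<Sum>i\<in>A. f i)" if "\<And>i. i \<in> A \<Longrightarrow> S n (f i)" for A and f :: "nat \<Rightarrow> tpoly"
    using that zero add by (induction A rule: infinite_finite_induct) auto
  \<comment> \<open>The expansion also lists exponents with coefficient 0, whose sum need not be
    \<open>n\<close>. The case \<open>zero\<close> in every degree covers them.\<close>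
  have "S n (tconst (coeff (coeff (coeff P k) j) i) * varX ^ i * varY ^ j * varZ ^ k)" for i j k
  proof (cases "coeff (coeff (coeff P k) j) i = 0")
    case True
    then show ?thesis using zero by (simp add: tconst_def)
  next
    case False
    then show ?thesis using mono homogeneousD[OF P False] by metis
  qed
  then show ?thesis
    by (subst tpoly_expand) (intro sum)
qed

lemma eval3_scale:
  assumes "homogeneous n P"
  shows "eval3 P (c *s v) = c ^ n * eval3 P v"
  using assms by (induction rule: homogeneous_induct) (simp_all add: eval3_simps algebra_simps)

section \<open>Intersection multiplicities\<close>

definition cst :: "complex \<Rightarrow> tpoly fract" where
  "cst c = Fract (tconst c) 1"

lemma tconst_hom: "tconst (a + b) = tconst a + tconst b" "tconst (a * b) = tconst a * tconst b"
  "tconst (- a) = - tconst a" "tconst (a - b) = tconst a - tconst b" "tconst 0 = 0" "tconst 1 = 1"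
  by (auto simp: tconst_def one_pCons)

lemma cst_hom: "cst (a + b) = cst a + cst b" "cst (a * b) = cst a * cst b"
  "cst (- a) = - cst a" "cst (a - b) = cst a - cst b" "cst 0 = 0" "cst 1 = 1"
  by (auto simp: cst_def tconst_hom fract_collapse)

lemma cst_sum: "cst (\<Sum>i\<in>A. f i) = (\<Sum>i\<in>A. cst (f i))"
  by (induction A rule: infinite_finite_induct) (auto simp: cst_hom)

lemma local_ringI:
  "homogeneous n A \<Longrightarrow> homogeneous n D \<Longrightarrow> eval_at D p \<noteq> 0 \<Longrightarrow> Fract A D \<in> local_ring p"
  by (auto simp: local_ring_def)

lemma local_ringE:
  assumes "h \<in> local_ring p"
  obtains A D n where "h = Fract A D" "homogeneous n A" "homogeneous n D" "eval_at D p \<noteq> 0" "D \<noteq> 0"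
  using assms by (fastforce simp: local_ring_def eval_at_def eval3_simps)

lemma local_idealI:
  "homogeneous n (F * A) \<Longrightarrow> homogeneous n D \<Longrightarrow> eval_at D p \<noteq> 0 \<Longrightarrow> Fract (F * A) D \<in> local_ideal F p"
  by (auto simp: local_ideal_def)

lemma local_idealE:
  assumes "h \<in> local_ideal F p"
  obtains A D n where "h = Fract (F * A) D" "homogeneous n (F * A)" "homogeneous n D" "eval_at D p \<noteq> 0" "D \<noteq> 0"
  using assms by (fastforce simp: local_ideal_def eval_at_def eval3_simps)

lemma eval_at_mult: "eval_at (P * Q) p = eval_at P p * eval_at Q p"
  and eval_at_add: "eval_at (P + Q) p = eval_at P p + eval_at Q p"
  and eval_at_diff: "eval_at (P - Q) p = eval_at P p - eval_at Q p"
  and eval_at_0 [simp]: "eval_at 0 p = 0"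
  and eval_at_1 [simp]: "eval_at 1 p = 1"
  and eval_at_tconst [simp]: "eval_at (tconst c) p = c"
  and eval_at_var [simp]: "eval_at (var i) p = rep_p2 p $ i"
  and eval_at_power: "eval_at (P ^ n) p = eval_at P p ^ n"
  by (simp_all add: eval_at_def eval3_simps eval3_diff)

lemmas eval_at_varXYZ [simp] = eval_at_var[of 1, simplified] eval_at_var[of 2, simplified] eval_at_var[of 3, simplified]

lemma local_ring_cst: "cst c \<in> local_ring p"
  unfolding cst_def by (rule local_ringI[of 0]) auto

lemma local_ring_mult:
  assumes "g \<in> local_ring p" "h \<in> local_ring p"
  shows "g * h \<in> local_ring p"
proof -
  from assms obtain A D n B E m where "g = Fract A D" "homogeneous n A" "homogeneous n D" "eval_at D p \<noteq> 0"
    "h = Fract B E" "homogeneous m B" "homogeneous m E" "eval_at E p \<noteq> 0"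
    by (elim local_ringE)
  then show ?thesis
    by (auto simp: eval_at_mult intro!: local_ringI[of "n + m"] homogeneous_mult)
qed

lemma local_ideal_mult:
  assumes "g \<in> local_ring p" "h \<in> local_ideal F p"
  shows "g * h \<in> local_ideal F p"
proof -
  from assms obtain A D n B E m where gh: "g = Fract A D" "homogeneous n A" "homogeneous n D" "eval_at D p \<noteq> 0"
    "h = Fract (F * B) E" "homogeneous m (F * B)" "homogeneous m E" "eval_at E p \<noteq> 0"
    by (elim local_ringE local_idealE)
  have "g * h = Fract (F * (A * B)) (D * E)" using gh by (simp add: algebra_simps)
  moreover have "homogeneous (n + m) (F * (A * B))"
    using homogeneous_mult[OF gh(2,6)] by (simp add: algebra_simps)
  ultimately show ?thesis
    using gh by (auto simp: eval_at_mult intro!: local_idealI[of "n + m"] homogeneous_mult)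
qed

lemma local_ideal_add:
  assumes "g \<in> local_ideal F p" "h \<in> local_ideal F p"
  shows "g + h \<in> local_ideal F p"
proof -
  from assms obtain A D n B E m where gh: "g = Fract (F * A) D" "homogeneous n (F * A)" "homogeneous n D" "eval_at D p \<noteq> 0" "D \<noteq> 0"
    "h = Fract (F * B) E" "homogeneous m (F * B)" "homogeneous m E" "eval_at E p \<noteq> 0" "E \<noteq> 0"
    by (elim local_idealE)
  have "g + h = Fract (F * (A * E + B * D)) (D * E)" using gh by (simp add: algebra_simps)
  moreover have "homogeneous (n + m) (F * (A * E + B * D))"
    using homogeneous_add[of "n + m" "F * A * E" "F * B * D"]
      homogeneous_mult[OF gh(2,8)] homogeneous_mult[OF gh(7,3)]
    by (simp add: add.commute distrib_left mult.assoc)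
  moreover have "homogeneous (n + m) (D * E)" "eval_at (D * E) p \<noteq> 0"
    using gh by (auto simp: eval_at_mult intro: homogeneous_mult)
  ultimately show ?thesis
    using local_idealI by metis
qed

lemma local_ideal_0: "0 \<in> local_ideal F p"
  using local_idealI[of 0 F 0 1 p] by (simp add: fract_collapse)

text \<open>Gaussian elimination for \<open>k\<close> homogeneous equations in more than
  \<open>k\<close> unknowns \<open>c b\<close>: the last equation expresses the unknown of a pivot
  \<open>b0\<close> through the others.\<close>

lemma linear_dependence:
  fixes M :: "'b \<Rightarrow> nat \<Rightarrow> complex"
  assumes "finite B" "card B > k"
  shows "\<exists>c. (\<exists>b\<in>B. c b \<noteq> 0) \<and> (\<forall>i<k. (\<Sum>b\<in>B. c b * M b i) = 0)"
  using assms
proof (induction k arbitrary: B M)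
  case 0
  then have "B \<noteq> {}" by auto
  then show ?case by (intro exI[of _ "\<lambda>_. 1"]) auto
next
  case (Suc k)
  show ?case
  proof (cases "\<forall>b\<in>B. M b k = 0")
    case True
    obtain c where "\<exists>b\<in>B. c b \<noteq> 0" "\<forall>i<k. (\<Sum>b\<in>B. c b * M b i) = 0"
      using Suc.IH[of B M] Suc.prems by auto
    with True show ?thesis
      by (intro exI[of _ c]) (auto simp: less_Suc_eq)
  next
    case False
    then obtain b0 where b0: "b0 \<in> B" "M b0 k \<noteq> 0" by auto
    define B' where "B' = B - {b0}"
    have B': "B = insert b0 B'" "b0 \<notin> B'" "finite B'" "card B' > k"
      using b0 Suc.prems by (auto simp: B'_def)
    obtain c where c: "\<exists>b\<in>B'. c b \<noteq> 0"
      "\<forall>i<k. (\<Sum>b\<in>B'. c b * (M b i - M b k / M b0 k * M b0 i)) = 0"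
      using Suc.IH[OF B'(3,4), of "\<lambda>b i. M b i - M b k / M b0 k * M b0 i"] by auto
    \<comment> \<open>The value at \<open>b0\<close> dictated by the last equation. With it every
      equation becomes its reduced form, and the reduced form with index \<open>k\<close> is
      trivial.\<close>
    define e where "e = - (\<Sum>b\<in>B'. c b * (M b k / M b0 k))"
    define c' where "c' = c(b0 := e)"
    have *: "(\<Sum>b\<in>B. c' b * M b i) = (\<Sum>b\<in>B'. c b * (M b i - M b k / M b0 k * M b0 i))" for i
    proof -
      have "(\<Sum>b\<in>B. c' b * M b i) = e * M b0 i + (\<Sum>b\<in>B'. c' b * M b i)"
        using B' by (simp add: c'_def)
      also have "(\<Sum>b\<in>B'. c' b * M b i) = (\<Sum>b\<in>B'. c b * M b i)"
        using B' by (intro sum.cong) (auto simp: c'_def)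
      finally show ?thesis
        by (simp add: e_def right_diff_distrib sum_subtractf sum_distrib_right sum_distrib_left mult_ac)
    qed
    have "(\<Sum>b\<in>B. c' b * M b i) = 0" if "i < Suc k" for i
      using that c(2) b0(2) unfolding * by (auto simp: less_Suc_eq)
    moreover have "\<exists>b\<in>B. c' b \<noteq> 0"
      using c(1) B' by (auto simp: c'_def)
    ultimately show ?thesis by blast
  qed
qed

text \<open>More than \<open>k\<close> elements of \<open>V\<close> have linearly dependent
  coordinate vectors of length \<open>k\<close>, and the same coefficients give a relation modulo
  \<open>W\<close>.\<close>

lemma quotient_dim_le:
  assumes W0: "0 \<in> W" and Wadd: "\<And>f g. f \<in> W \<Longrightarrow> g \<in> W \<Longrightarrow> f + g \<in> W"
    and Wmult: "\<And>c f. f \<in> W \<Longrightarrow> cst c * f \<in> W"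
    and span: "\<And>b. b \<in> V \<Longrightarrow> \<exists>c. b - (\<Sum>i<k. cst (c i) * e i) \<in> W"
  shows "quotient_dim V W \<le> enat k"
  unfolding quotient_dim_def
proof (rule SUP_least, clarify)
  fix B assume B: "finite B" "B \<subseteq> V"
    and ind: "\<forall>c. (\<Sum>b\<in>B. Fract (tconst (c b)) 1 * b) \<in> W \<longrightarrow> (\<forall>b\<in>B. c b = 0)"
  obtain M where M: "\<And>b. b \<in> B \<Longrightarrow> b - (\<Sum>i<k. cst (M b i) * e i) \<in> W"
    using span B(2) by (metis subsetD)
  show "enat (card B) \<le> enat k"
  proof (rule ccontr)
    assume "\<not> enat (card B) \<le> enat k"
    then obtain c where c: "\<exists>b\<in>B. c b \<noteq> 0" "\<forall>i<k. (\<Sum>b\<in>B. c b * M b i) = 0"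
      using linear_dependence[OF B(1), of k M] by auto
    have Wsum: "(\<Sum>b\<in>A. f b) \<in> W" if "\<And>b. b \<in> A \<Longrightarrow> f b \<in> W" for A and f :: "tpoly fract \<Rightarrow> _"
      using that W0 Wadd by (induction A rule: infinite_finite_induct) auto
    have "(\<Sum>b\<in>B. cst (c b) * (b - (\<Sum>i<k. cst (M b i) * e i))) \<in> W"
      using M by (intro Wsum Wmult)
    also have "(\<Sum>b\<in>B. cst (c b) * (b - (\<Sum>i<k. cst (M b i) * e i)))
        = (\<Sum>b\<in>B. cst (c b) * b) - (\<Sum>b\<in>B. \<Sum>i<k. cst (c b * M b i) * e i)"
      by (simp add: right_diff_distrib sum_subtractf sum_distrib_left cst_hom mult.assoc)
    also have "(\<Sum>b\<in>B. \<Sum>i<k. cst (c b * M b i) * e i) = (\<Sum>i<k. cst (\<Sum>b\<in>B. c b * M b i) * e i)"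
      by (subst sum.swap) (simp add: cst_sum sum_distrib_right)
    also have "\<dots> = 0"
      using c(2) by (simp add: cst_hom)
    finally have "\<forall>b\<in>B. c b = 0"
      using ind by (simp add: cst_def)
    with c(1) show False by blast
  qed
qed

text \<open>The two lines through the point generate its ideal where \<open>x\<close> is nonzero:
  modulo them \<open>varY\<close> and \<open>varZ\<close> are multiples of \<open>varX\<close>. The
  factor \<open>varX\<close> on the left lets both cofactors keep the degree of \<open>A\<close>,
  also in degree 0.\<close>

lemma point_ideal:
  assumes A: "homogeneous n A" and v1: "v $ 1 \<noteq> 0" and A0: "eval3 A v = 0"
  obtains A1 A2 where "homogeneous n A1" "homogeneous n A2"
    "varX * A = (tconst (v $ 1) * varY - tconst (v $ 2) * varX) * A1
      + (tconst (v $ 1) * varZ - tconst (v $ 3) * varX) * A2"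
proof -
  define l where "l = tconst (v $ 1) * varY - tconst (v $ 2) * varX"
  define m where "m = tconst (v $ 1) * varZ - tconst (v $ 3) * varX"
  \<comment> \<open>The induction needs a claim about forms that need not vanish at
    \<open>v\<close>. The residue with coefficient \<open>c\<close> is removed at the end by
    evaluating at \<open>v\<close>, where \<open>l\<close> and \<open>m\<close> vanish.\<close>
  have "\<exists>c A1 A2. homogeneous n A1 \<and> homogeneous n A2 \<and> varX * A = tconst c * varX ^ Suc n + l * A1 + m * A2"
    using A
  proof (induction rule: homogeneous_induct)
    case (zero n)
    show ?case by (intro exI[of _ 0]) (auto simp: tconst_hom)
  next
    case (const c)
    show ?case by (intro exI[of _ c] exI[of _ 0]) (auto simp: algebra_simps)
  next
    case (add n A B)
    then obtain c A1 A2 e B1 B2 where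
      "homogeneous n A1" "homogeneous n A2" "varX * A = tconst c * varX ^ Suc n + l * A1 + m * A2"
      "homogeneous n B1" "homogeneous n B2" "varX * B = tconst e * varX ^ Suc n + l * B1 + m * B2"
      by blast
    then show ?case
      by (intro exI[of _ "c + e"] exI[of _ "A1 + B1"] exI[of _ "A2 + B2"])
        (auto simp: algebra_simps tconst_hom intro: homogeneous_add)
  next
    case (var n A i)
    then obtain c A1 A2 where
      A: "homogeneous n A1" "homogeneous n A2" "varX * A = tconst c * varX ^ Suc n + l * A1 + m * A2"
      by blast
    have hv: "homogeneous (Suc n) (var j * B)" if "homogeneous n B" for j B
      using homogeneous_mult[OF homogeneous_var that] by simp
    have hX: "homogeneous (Suc n) (tconst e * varX ^ Suc n)" for e
      using homogeneous_power[OF homogeneous_var[of 1], of "Suc n"]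
      by (intro homogeneous_tconst_mult) simp
    have c: "tconst c = tconst (c / v $ 1) * tconst (v $ 1)"
      "tconst (c * v $ j / v $ 1) = tconst (c / v $ 1) * tconst (v $ j)" for j
      using v1 by (auto simp: tconst_hom(2)[symmetric])
    consider "i = 1" | "i = 2" | "i = 3" using exhaust_3[of i] by auto
    then show ?case
    proof cases
      case 1
      have "varX * (var i * A) = varX * (varX * A)" using 1 by simp
      also have "\<dots> = tconst c * varX ^ Suc (Suc n) + l * (varX * A1) + m * (varX * A2)"
        unfolding A(3) by (simp add: algebra_simps)
      finally show ?thesis
        using hv[OF A(1), of 1] hv[OF A(2), of 1] by auto
    next
      case 2
      have "varX * (var i * A) = varY * (varX * A)" using 2 by (simp add: mult_ac)
      also have "\<dots> = tconst (c * v $ 2 / v $ 1) * varX ^ Suc (Suc n)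
          + l * (varY * A1 + tconst (c / v $ 1) * varX ^ Suc n) + m * (varY * A2)"
        unfolding A(3) c(2) by (subst c(1)) (simp add: algebra_simps l_def)
      finally show ?thesis
        using homogeneous_add[OF hv[OF A(1), of 2] hX] hv[OF A(2), of 2] by auto
    next
      case 3
      have "varX * (var i * A) = varZ * (varX * A)" using 3 by (simp add: mult_ac)
      also have "\<dots> = tconst (c * v $ 3 / v $ 1) * varX ^ Suc (Suc n)
          + l * (varZ * A1) + m * (varZ * A2 + tconst (c / v $ 1) * varX ^ Suc n)"
        unfolding A(3) c(2) by (subst c(1)) (simp add: algebra_simps m_def)
      finally show ?thesis
        using homogeneous_add[OF hv[OF A(2), of 3] hX] hv[OF A(1), of 3] by auto
    qed
  qed
  then obtain c A1 A2 where A12: "homogeneous n A1" "homogeneous n A2"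
    "varX * A = tconst c * varX ^ Suc n + l * A1 + m * A2" by blast
  from arg_cong[OF A12(3), of "\<lambda>P. eval3 P v"] have "c * (v $ 1) ^ Suc n = 0"
    by (simp add: eval3_simps eval3_diff l_def m_def A0)
  then have "c = 0" using v1 by simp
  with A12 that show ?thesis by (simp add: l_def m_def tconst_hom)
qed

lemma eval3_dZ_mult: "eval3 (dZ (P * Q)) v = eval3 (dZ P) v * eval3 Q v + eval3 P v * eval3 (dZ Q) v"
  and eval3_dZ_add: "eval3 (dZ (P + Q)) v = eval3 (dZ P) v + eval3 (dZ Q) v"
  by (simp_all add: dZ_def pderiv_mult pderiv_add eval3_simps mult_ac)

text \<open>
  At a point \<open>p\<close> of \<open>F = 0\<close> with \<open>F\<^sub>z \<noteq> 0\<close> the function \<open>t = (v\<^sub>1 y - v\<^sub>2 x) / x\<close> generates the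
  maximal ideal of the local ring of the curve.
\<close>

lemma local_division:
  assumes F: "homogeneous d F" "eval_at F p = 0" and v1: "rep_p2 p $ 1 \<noteq> 0"
    and Fz: "eval_at (dZ F) p \<noteq> 0"
    and t: "t = Fract (tconst (rep_p2 p $ 1) * varY - tconst (rep_p2 p $ 2) * varX) varX"
    and h: "h \<in> local_ring p"
  obtains c h' where "h' \<in> local_ring p" "h - cst c - t * h' \<in> local_ideal F p"
proof -
  define v where "v = rep_p2 p"
  define l where "l = tconst (v $ 1) * varY - tconst (v $ 2) * varX"
  define m where "m = tconst (v $ 1) * varZ - tconst (v $ 3) * varX"
  obtain F1 F2 where F12: "homogeneous d F1" "homogeneous d F2" "varX * F = l * F1 + m * F2"
    using point_ideal[of d F v] F v1 unfolding v_def eval_at_def l_def m_def by blast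
  have z: "dZ varX = 0" "dZ varY = 0" "dZ varZ = 1" "dZ (tconst a) = 0" for a
    by (auto simp: dZ_def varX_def varY_def varZ_def tconst_def pderiv_pCons one_pCons)
  have dZ_diff: "dZ (P - Q) = dZ P - dZ Q" for P Q by (simp add: dZ_def pderiv_diff)
  have lm: "eval3 l v = 0" "eval3 m v = 0" "eval3 (dZ l) v = 0" "eval3 (dZ m) v = v $ 1"
    by (auto simp: l_def m_def eval3_simps eval3_diff eval3_dZ_mult dZ_diff z)
  \<comment> \<open>At \<open>v\<close> the derivative of \<open>l\<close> and the values of
    \<open>l\<close>, \<open>m\<close> and \<open>F\<close> vanish, so only \<open>dZ m\<close>
    survives on the right and \<open>F2\<close> agrees with \<open>dZ F\<close>. Hence
    \<open>F2\<close> is invertible, and modulo \<open>F\<close> the form \<open>m\<close> equals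
    \<open>- l * F1 / F2\<close>.\<close>
  from arg_cong[OF F12(3), of "\<lambda>P. eval3 (dZ P) v"] have "eval3 F2 v = eval3 (dZ F) v"
    using v1 by (simp add: eval3_dZ_mult eval3_dZ_add z eval3_simps lm) (simp add: v_def)
  then have F2: "eval_at F2 p \<noteq> 0" using Fz by (simp add: eval_at_def v_def)
  obtain A D n where AD: "h = Fract A D" "homogeneous n A" "homogeneous n D" "eval_at D p \<noteq> 0" "D \<noteq> 0"
    using h by (rule local_ringE)
  define c where "c = eval_at A p / eval_at D p"
  define N where "N = A - tconst c * D"
  have N: "homogeneous n N" "eval3 N v = 0"
    using AD by (auto simp: N_def c_def v_def eval_at_def eval3_simps eval3_diff
      intro!: homogeneous_diff homogeneous_tconst_mult)
  obtain N1 N2 where N12: "homogeneous n N1" "homogeneous n N2" "varX * N = l * N1 + m * N2"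
    using point_ideal[of n N v] N v1 unfolding v_def l_def m_def by blast
  have nz: "F2 \<noteq> 0" "varX \<noteq> 0"
    using F2 by (auto simp: varX_def)
  have evX: "eval_at varX p \<noteq> 0" using v1 by simp
  \<comment> \<open>Obtained by inserting \<open>m = - l * F1 / F2\<close> into
    \<open>varX * N = l * N1 + m * N2\<close> and dividing \<open>N / D\<close> by
    \<open>t = l / varX\<close>.\<close>
  define h' where "h' = Fract (N1 * F2 - N2 * F1) (F2 * D)"
  have h': "h' \<in> local_ring p"
    unfolding h'_def
  proof (rule local_ringI[of "d + n"])
    show "homogeneous (d + n) (N1 * F2 - N2 * F1)"
      using homogeneous_mult[OF N12(1) F12(2)] homogeneous_mult[OF N12(2) F12(1)]
      by (simp add: homogeneous_diff add.commute)
    show "homogeneous (d + n) (F2 * D)" using F12 AD by (auto intro: homogeneous_mult)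
    show "eval_at (F2 * D) p \<noteq> 0" using F2 AD by (simp add: eval_at_mult)
  qed
  have "h - cst c = Fract N D"
    using AD by (simp add: cst_def N_def)
  then have "h - cst c - t * h' = Fract (N * (varX * (F2 * D)) - l * (N1 * F2 - N2 * F1) * D) (D * (varX * (F2 * D)))"
    using AD nz unfolding t h'_def by (simp add: l_def v_def)
  also have "N * (varX * (F2 * D)) - l * (N1 * F2 - N2 * F1) * D = F * (varX * N2) * D"
  proof -
    have "N * (varX * (F2 * D)) - l * (N1 * F2 - N2 * F1) * D
        = (varX * N * F2 - l * (N1 * F2 - N2 * F1)) * D" by (simp add: algebra_simps)
    also have "varX * N * F2 - l * (N1 * F2 - N2 * F1) = (l * F1 + m * F2) * N2"
      unfolding N12(3) by (simp add: algebra_simps)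
    also have "\<dots> = F * (varX * N2)"
      unfolding F12(3)[symmetric] by (simp add: algebra_simps)
    finally show ?thesis .
  qed
  also have "Fract (F * (varX * N2) * D) (D * (varX * (F2 * D))) = Fract (F * (varX * N2)) (varX * (F2 * D))"
    using AD nz by (simp add: eq_fract)
  also have "\<dots> \<in> local_ideal F p"
  proof (rule local_idealI[of "Suc (d + n)"])
    have "homogeneous (Suc n) (varX * N2)"
      using homogeneous_mult[OF homogeneous_var[of 1] N12(2)] by simp
    from homogeneous_mult[OF F(1) this] show "homogeneous (Suc (d + n)) (F * (varX * N2))" by simp
    have "homogeneous (d + n) (F2 * D)" using F12 AD by (auto intro: homogeneous_mult)
    from homogeneous_mult[OF homogeneous_var[of 1] this]
    show "homogeneous (Suc (d + n)) (varX * (F2 * D))" by simp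
    show "eval_at (varX * (F2 * D)) p \<noteq> 0" using F2 AD evX by (simp add: eval_at_mult)
  qed
  finally show ?thesis using that h' by blast
qed

text \<open>
  Divide \<open>Q\<close> by \<open>t\<close> modulo \<open>F\<close> as often as possible. If this stops after \<open>i < k\<close> steps, then \<open>t\<^sup>i\<close> lies
  in the ideal of \<open>Q\<close> and \<open>F\<close>, so that \<open>1, t, \<dots>, t\<^sup>i\<^sup>-\<^sup>1\<close> span the quotient and the multiplicity is at most \<open>i\<close>.
\<close>

lemma contact_identity:
  assumes F: "homogeneous d F" "eval_at F p = 0" and v1: "rep_p2 p $ 1 \<noteq> 0"
    and Fz: "eval_at (dZ F) p \<noteq> 0"
    and Q: "homogeneous n Q" and mult: "intersection_mult Q F p \<ge> enat k"
  obtains E A B where "eval_at E p \<noteq> 0"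
    "Q * E = (tconst (rep_p2 p $ 1) * varY - tconst (rep_p2 p $ 2) * varX) ^ k * A + F * B"
proof -
  define l where "l = tconst (rep_p2 p $ 1) * varY - tconst (rep_p2 p $ 2) * varX"
  define t where "t = Fract l varX"
  define g where "g = Fract Q (varX ^ n)"
  define W where "W = {f + g | f g. f \<in> local_ideal Q p \<and> g \<in> local_ideal F p}"
  have X: "varX \<noteq> 0" "homogeneous 1 varX" by (auto simp: varX_def intro: homogeneous_var[of 1, simplified])
  have hl: "homogeneous 1 l"
    unfolding l_def using homogeneous_var[of 1] homogeneous_var[of 2]
    by (auto intro!: homogeneous_diff homogeneous_tconst_mult)
  have evX: "eval_at varX p \<noteq> 0" using v1 by simp
  have tO: "t \<in> local_ring p"
    unfolding t_def using hl X evX by (auto intro!: local_ringI[of 1])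
  have tpow: "t ^ i \<in> local_ring p" for i
    by (induction i) (auto intro: local_ring_mult tO simp: local_ring_cst[of 1, unfolded cst_hom])
  have hXn: "homogeneous i (varX ^ i)" for i
    using homogeneous_power[OF X(2), of i] by simp
  have gI: "g \<in> local_ideal Q p"
    using local_idealI[of n Q 1 "varX ^ n" p] Q hXn evX unfolding g_def by (simp add: eval_at_power)
  have gO: "g \<in> local_ring p"
    unfolding g_def using Q hXn evX by (intro local_ringI[of n]) (auto simp: eval_at_power)
  have WQ: "f \<in> W" if "f \<in> local_ideal Q p" for f
    unfolding W_def using that local_ideal_0[of F p] by (intro CollectI exI[of _ f] exI[of _ 0]) auto
  have WF: "f \<in> W" if "f \<in> local_ideal F p" for f
    unfolding W_def using that local_ideal_0[of Q p] by (intro CollectI exI[of _ 0] exI[of _ f]) auto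
  have Wadd: "a + b \<in> W" if "a \<in> W" "b \<in> W" for a b
  proof -
    from that obtain f g f' g' where "a = f + g" "b = f' + g'"
      "f \<in> local_ideal Q p" "g \<in> local_ideal F p" "f' \<in> local_ideal Q p" "g' \<in> local_ideal F p"
      unfolding W_def by blast
    then have "a + b = (f + f') + (g + g')" "f + f' \<in> local_ideal Q p" "g + g' \<in> local_ideal F p"
      by (auto intro: local_ideal_add)
    then show ?thesis unfolding W_def by blast
  qed
  have Wmult: "a * b \<in> W" if "a \<in> local_ring p" "b \<in> W" for a b
  proof -
    from that obtain f g where "b = f + g" "f \<in> local_ideal Q p" "g \<in> local_ideal F p"
      unfolding W_def by blast
    then have "a * b = a * f + a * g" "a * f \<in> local_ideal Q p" "a * g \<in> local_ideal F p"
      using that by (auto intro: local_ideal_mult simp: algebra_simps)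
    then show ?thesis unfolding W_def by blast
  qed
  have W0: "0 \<in> W" by (intro WF local_ideal_0)
  note div = local_division[OF F v1 Fz t_def[unfolded l_def]]
  \<comment> \<open>Taylor expansion in \<open>t\<close> with remainder, modulo the ideal of
    \<open>F\<close>.\<close>
  have expand: "\<exists>c h'. h' \<in> local_ring p \<and> h - (\<Sum>i<j. cst (c i) * t ^ i) - t ^ j * h' \<in> local_ideal F p"
    if "h \<in> local_ring p" for h j
  proof (induction j)
    case 0
    show ?case using that local_ideal_0 by (intro exI[of _ "\<lambda>_. 0"] exI[of _ h]) auto
  next
    case (Suc j)
    then obtain c h' where h': "h' \<in> local_ring p" "h - (\<Sum>i<j. cst (c i) * t ^ i) - t ^ j * h' \<in> local_ideal F p"
      by blast
    obtain e h'' where h'': "h'' \<in> local_ring p" "h' - cst e - t * h'' \<in> local_ideal F p"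
      using div[OF h'(1)] by blast
    have "(h - (\<Sum>i<j. cst (c i) * t ^ i) - t ^ j * h') + t ^ j * (h' - cst e - t * h'') \<in> local_ideal F p"
      by (intro local_ideal_add local_ideal_mult tpow h' h'')
    also have "(h - (\<Sum>i<j. cst (c i) * t ^ i) - t ^ j * h') + t ^ j * (h' - cst e - t * h'')
        = h - (\<Sum>i<Suc j. cst ((c(j := e)) i) * t ^ i) - t ^ Suc j * h''"
      by (simp add: algebra_simps)
    finally show ?case using h'' by blast
  qed
  have no_pow: "t ^ i \<notin> W" if "i < k" for i
  proof
    assume ti: "t ^ i \<in> W"
    have "quotient_dim (local_ring p) W \<le> enat i"
    proof (rule quotient_dim_le[where e = "\<lambda>j. t ^ j"])
      fix h assume "h \<in> local_ring p"
      then obtain c h' where h': "h' \<in> local_ring p" "h - (\<Sum>j<i. cst (c j) * t ^ j) - t ^ i * h' \<in> local_ideal F p"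
        using expand by blast
      have "(h - (\<Sum>j<i. cst (c j) * t ^ j) - t ^ i * h') + h' * t ^ i \<in> W"
        using h' by (intro Wadd WF Wmult ti)
      then show "\<exists>c. h - (\<Sum>j<i. cst (c j) * t ^ j) \<in> W" by (auto simp: algebra_simps)
    qed (use W0 Wadd Wmult local_ring_cst in auto)
    then have "enat k \<le> enat i"
      using mult unfolding intersection_mult_def W_def by order
    with that show False by simp
  qed
  have "\<exists>h. h \<in> local_ring p \<and> g - t ^ j * h \<in> local_ideal F p" if "j \<le> k" for j
    using that
  proof (induction j)
    case 0
    show ?case using gO local_ideal_0 by (intro exI[of _ g]) auto
  next
    case (Suc j)
    then obtain h where h: "h \<in> local_ring p" "g - t ^ j * h \<in> local_ideal F p" by auto
    obtain c h' where h': "h' \<in> local_ring p" "h - cst c - t * h' \<in> local_ideal F p"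
      using div[OF h(1)] by blast
    have "(g - t ^ j * h) + t ^ j * (h - cst c - t * h') \<in> local_ideal F p"
      by (intro local_ideal_add local_ideal_mult tpow h h')
    then have *: "g - t ^ j * (cst c + t * h') \<in> local_ideal F p"
      by (simp add: algebra_simps)
    \<comment> \<open>Otherwise \<open>cst c + t * h'\<close> is a unit of the local ring, because
      \<open>t\<close> vanishes at \<open>p\<close>. Then \<open>t ^ j\<close> would lie in
      \<open>W\<close>, against \<open>no_pow\<close>.\<close>
    have "c = 0"
    proof (rule ccontr)
      assume c: "c \<noteq> 0"
      obtain A D m where AD: "h' = Fract A D" "homogeneous m A" "homogeneous m D" "eval_at D p \<noteq> 0" "D \<noteq> 0"
        using h'(1) by (rule local_ringE)
      define N where "N = tconst c * (varX * D) + l * A"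
      have U: "cst c + t * h' = Fract N (varX * D)"
        using AD X by (simp add: cst_def t_def N_def)
      have evN: "eval_at N p \<noteq> 0"
        using AD c v1 by (simp add: N_def eval_at_mult eval_at_add eval_at_diff l_def)
      have "Fract (varX * D) N \<in> local_ring p"
      proof (rule local_ringI[OF _ _ evN])
        show XD: "homogeneous (1 + m) (varX * D)"
          by (intro homogeneous_mult X AD)
        show "homogeneous (1 + m) N"
          unfolding N_def by (intro homogeneous_add homogeneous_tconst_mult XD homogeneous_mult hl AD)
      qed
      moreover have "t ^ j * (cst c + t * h') \<in> W"
      proof -
        have "g + cst (-1) * (g - t ^ j * (cst c + t * h')) \<in> W"
          by (intro Wadd WQ gI Wmult local_ring_cst WF *)
        then show ?thesis by (simp add: cst_hom)
      qed
      ultimately have "Fract (varX * D) N * (t ^ j * (cst c + t * h')) \<in> W"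
        by (rule Wmult)
      also have "Fract (varX * D) N * (t ^ j * (cst c + t * h')) = t ^ j * (Fract (varX * D) N * Fract N (varX * D))"
        unfolding U by (simp only: mult_ac)
      also have "Fract (varX * D) N * Fract N (varX * D) = 1"
      proof -
        have "N \<noteq> 0" using evN by auto
        then show ?thesis
          using AD X by (simp add: One_fract_def eq_fract)
      qed
      finally show False using no_pow[of j] Suc.prems by simp
    qed
    then have "g - t ^ Suc j * h' \<in> local_ideal F p"
      using * by (simp add: cst_hom mult_ac)
    then show ?case using h' by blast
  qed
  then obtain h where h: "h \<in> local_ring p" "g - t ^ k * h \<in> local_ideal F p" by blast
  obtain A D a where AD: "h = Fract A D" "eval_at D p \<noteq> 0" "D \<noteq> 0"
    using h(1) by (rule local_ringE)
  obtain B D' b where B: "g - t ^ k * h = Fract (F * B) D'" "eval_at D' p \<noteq> 0" "D' \<noteq> 0"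
    using h(2) by (rule local_idealE)
  have tk: "t ^ k = Fract (l ^ k) (varX ^ k)"
    unfolding t_def by (induction k) (simp_all add: One_fract_def)
  have "g = Fract (F * B) D' + t ^ k * h"
    using B(1) by (simp add: algebra_simps)
  then have "Fract Q (varX ^ n) = Fract (F * B * (varX ^ k * D) + l ^ k * A * D') (D' * (varX ^ k * D))"
    using AD X B by (simp add: g_def tk)
  then have "Q * (D' * (varX ^ k * D)) = (F * B * (varX ^ k * D) + l ^ k * A * D') * varX ^ n"
    using AD X B by (simp add: eq_fract)
  then have "Q * (D' * (varX ^ k * D)) = l ^ k * (A * D' * varX ^ n) + F * (B * (varX ^ k * D) * varX ^ n)"
    by (simp add: algebra_simps)
  moreover have "eval_at (D' * (varX ^ k * D)) p \<noteq> 0"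
    using AD B v1 by (simp add: eval_at_mult eval_at_power)
  ultimately show ?thesis
    using that unfolding l_def by blast
qed

section \<open>Partial derivatives, tangents and inflection points of the Fermat curve\<close>

lemma fermat_altdef: "fermat d = (\<Sum>a\<in>UNIV. var a ^ d)"
  by (simp add: fermat_def sum_3)

lemma tangent_line_altdef: "tangent_line F p = (\<Sum>a\<in>UNIV. tconst (eval_at (partial a F) p) * var a)"
  by (simp add: tangent_line_def sum_3)

definition is_derivation :: "('a::comm_ring_1 \<Rightarrow> 'a) \<Rightarrow> bool" where
  "is_derivation D \<longleftrightarrow> D 0 = 0 \<and> (\<forall>a b. D (a + b) = D a + D b) \<and> (\<forall>a b. D (a * b) = D a * b + a * D b)"

lemma is_derivationD:
  assumes "is_derivation D"
  shows "D 0 = 0" "D (a + b) = D a + D b" "D (a * b) = D a * b + a * D b"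
  using assms by (auto simp: is_derivation_def)

text \<open>\<open>dX\<close> and \<open>dY\<close> act on the coefficients with respect to the
  outer variables, so the Leibniz rule has to be lifted from a coefficient ring to its
  polynomials.\<close>

lemma is_derivation_map_poly:
  assumes D: "is_derivation D"
  shows "is_derivation (map_poly D)"
proof -
  note Ds = is_derivationD[OF D]
  have add: "map_poly D (p + q) = map_poly D p + map_poly D q" for p q
    by (rule poly_eqI) (simp add: coeff_map_poly Ds)
  have smult: "map_poly D (smult a q) = smult (D a) q + smult a (map_poly D q)" for a q
    by (rule poly_eqI) (simp add: coeff_map_poly Ds)
  have "map_poly D (p * q) = map_poly D p * q + p * map_poly D q" for p q
    by (induction p) (simp_all add: add smult map_poly_pCons Ds algebra_simps)
  then show ?thesis
    using add by (simp add: is_derivation_def)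
qed

lemma is_derivation_pderiv: "is_derivation (pderiv :: 'a::idom poly \<Rightarrow> _)"
  unfolding is_derivation_def by (simp add: pderiv_add pderiv_mult mult.commute add.commute)

lemma is_derivation_partial: "is_derivation (partial i)"
  unfolding partial_def dX_def dY_def dZ_def
  by (simp add: is_derivation_map_poly is_derivation_pderiv)

lemmas partial_add = is_derivationD(2)[OF is_derivation_partial]
  and partial_mult = is_derivationD(3)[OF is_derivation_partial]
  and partial_0 [simp] = is_derivationD(1)[OF is_derivation_partial]

lemma partial_sum: "partial i (\<Sum>a\<in>A. f a) = (\<Sum>a\<in>A. partial i (f a))"
  by (induction A rule: infinite_finite_induct) (auto simp: partial_add)

lemma partial_tconst [simp]: "partial i (tconst c) = 0"
  by (auto simp: partial_def dX_def dY_def dZ_def tconst_def map_poly_pCons pderiv_pCons)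

lemma partial_var: "partial i (var j) = (if i = j then 1 else 0)"
  using exhaust_3[of i] exhaust_3[of j]
  by (auto simp: dX_def dY_def dZ_def varX_def varY_def varZ_def map_poly_pCons pderiv_pCons one_pCons)

lemma partial_power: "partial i (P ^ n) = of_nat n * P ^ (n - 1) * partial i P"
proof (induction n)
  case 0
  show ?case using partial_tconst[of i 1] by (simp add: tconst_hom)
next
  case (Suc n)
  then show ?case by (cases n) (simp_all add: partial_mult algebra_simps)
qed

lemma eval3_of_nat [simp]: "eval3 (of_nat n) v = of_nat n"
  by (simp add: eval3_def)

lemma eval_at_partial_fermat: "eval_at (partial i (fermat d)) p = of_nat d * (rep_p2 p $ i) ^ (d - 1)"
proof -
  have "partial i (fermat d) = (\<Sum>a\<in>UNIV. if i = a then of_nat d * var a ^ (d - 1) else 0)"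
    unfolding fermat_altdef partial_sum by (intro sum.cong) (auto simp: partial_power partial_var)
  then show ?thesis
    by (simp add: eval_at_def eval3_simps)
qed

lemma eval_at_fermat: "eval_at (fermat d) p = (\<Sum>a\<in>UNIV. (rep_p2 p $ a) ^ d)"
  by (simp add: fermat_altdef sum_3 eval_at_def eval3_simps)

lemma rep_p2_nonzero: "rep_p2 p \<noteq> 0"
  using Quotient_rep_reflp[OF Quotient_p2, of p] by (simp add: proj_rel_def)

lemma fps_X_power_dvd_nth: "fps_X ^ k dvd f \<Longrightarrow> i < k \<Longrightarrow> fps_nth f i = (0::'a::comm_ring_1)"
  by (auto simp: dvd_def fps_X_power_mult_nth)

lemma dvd_unit_cancel: "is_unit u \<Longrightarrow> a dvd b * u \<Longrightarrow> a dvd (b::complex fps)"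
  by (simp only: dvd_mult_unit_iff)

lemma Fract_hom: "is_hom (\<lambda>P::'a::idom. Fract P 1)"
  by (auto simp: is_hom_def fract_collapse)

text \<open>The fraction \<open>t = l / e\<close> pulls back to \<open>fps_X\<close> times a unit.
  Both ideals pull back into the multiples of \<open>fps_X ^ k\<close>, whereas a nontrivial
  combination of \<open>1, t, ..., t ^ (k - 1)\<close> pulls back to order below \<open>k\<close>.
  So these powers are independent modulo the ideal.\<close>

lemma intersection_mult_ge:
  assumes g0: "\<And>a. fps_nth (g a) 0 = rep_p2 p $ a"
    and L: "fps_X ^ k dvd subst3 g L" and F: "fps_X ^ k dvd subst3 g F"
    and l: "homogeneous 1 l" "subst3 g l = fps_X" and e: "homogeneous 1 e" "eval_at e p \<noteq> 0"
  shows "intersection_mult L F p \<ge> enat k"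
proof -
  have ev: "fps_nth (subst3 g P) 0 = eval_at P p" for P
    by (simp add: subst3_nth_0 g0 eval_at_def)
  have unit: "is_unit (subst3 g P)" if "eval_at P p \<noteq> 0" for P
    using that by (simp add: ev)
  define t where "t = Fract l e"
  define W where "W = {f + g | f g. f \<in> local_ideal L p \<and> g \<in> local_ideal F p}"
  define \<iota> where "\<iota> = (\<lambda>P::tpoly. Fract P 1)"
  have \<iota>: "is_hom \<iota>" unfolding \<iota>_def by (rule Fract_hom)
  have \<iota>_eq: "\<iota> P = \<iota> R \<longleftrightarrow> P = R" for P R by (simp add: \<iota>_def eq_fract)
  have e0: "e \<noteq> 0" using e by auto
  then have \<iota>e: "\<iota> e \<noteq> 0" using \<iota>_eq[of e 0] is_homD[OF \<iota>] by simp
  have t: "t * \<iota> e = \<iota> l" using e0 by (simp add: t_def \<iota>_def eq_fract)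
  \<comment> \<open>\<open>subst3\<close> acts on polynomials, so relations between powers of
    \<open>t\<close> are first multiplied by \<open>e ^ k\<close> to clear denominators.\<close>
  have tpow: "t ^ n * \<iota> e ^ k = \<iota> (l ^ n * e ^ (k - n))" if "n \<le> k" for n
  proof -
    have "t ^ n * \<iota> e ^ k = (t * \<iota> e) ^ n * \<iota> e ^ (k - n)"
      using that by (simp add: power_mult_distrib mult.assoc flip: power_add)
    then show ?thesis
      by (simp add: t is_homD[OF \<iota>] is_hom_power[OF \<iota>])
  qed
  define e' where "e' = subst3 g e"
  have e': "fps_nth e' 0 \<noteq> 0" using e by (simp add: e'_def ev)
  have nth: "fps_nth (fps_X ^ n * e' ^ m) i = (if i < n then 0 else fps_nth (e' ^ m) (i - n))" for n m i
    by (simp add: fps_X_power_mult_nth)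
  have inj: "inj_on (\<lambda>n. t ^ n) {..<k}"
  proof -
    have False if "m < n" "n < k" "t ^ m = t ^ n" for m n
    proof -
      have "\<iota> (l ^ m * e ^ (k - m)) = \<iota> (l ^ n * e ^ (k - n))"
        using tpow[of m] tpow[of n] that by simp
      then have "subst3 g (l ^ m * e ^ (k - m)) = subst3 g (l ^ n * e ^ (k - n))"
        by (simp add: \<iota>_eq)
      then have "fps_nth (fps_X ^ m * e' ^ (k - m)) m = fps_nth (fps_X ^ n * e' ^ (k - n)) m"
        by (simp add: subst3_simps l e'_def)
      with that e' show False by (simp add: nth fps_nth_power_0)
    qed
    then show ?thesis
      by (intro inj_onI) (metis lessThan_iff nat_neq_iff)
  qed
  define B where "B = (\<lambda>n. t ^ n) ` {..<k}"
  have "t \<in> local_ring p" unfolding t_def using l e by (intro local_ringI[of 1])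
  then have "t ^ n \<in> local_ring p" for n
    by (induction n) (auto intro: local_ring_mult simp: local_ring_cst[of 1, unfolded cst_hom])
  then have BO: "B \<subseteq> local_ring p" by (auto simp: B_def)
  have ind: "\<forall>b\<in>B. c b = 0" if "(\<Sum>b\<in>B. Fract (tconst (c b)) 1 * b) \<in> W" for c
  proof -
    define c' where "c' n = c (t ^ n)" for n
    define S where "S = (\<Sum>n<k. tconst (c' n) * (l ^ n * e ^ (k - n)))"
    from that have "(\<Sum>n<k. cst (c' n) * t ^ n) \<in> W"
      using inj by (simp add: B_def sum.reindex cst_def c'_def)
    then obtain A D A' D' where AD: "(\<Sum>n<k. cst (c' n) * t ^ n) = Fract (L * A) D + Fract (F * A') D'"
      "eval_at D p \<noteq> 0" "D \<noteq> 0" "eval_at D' p \<noteq> 0" "D' \<noteq> 0"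
      unfolding W_def by (auto elim!: local_idealE)
    have S: "(\<Sum>n<k. cst (c' n) * t ^ n) * \<iota> e ^ k = \<iota> S"
      unfolding S_def is_hom_sum[OF \<iota>] sum_distrib_right
      by (intro sum.cong) (simp_all add: is_homD(4)[OF \<iota>] tpow mult.assoc, simp add: cst_def \<iota>_def)
    have "\<iota> (S * (D * D')) = (\<Sum>n<k. cst (c' n) * t ^ n) * \<iota> e ^ k * \<iota> (D * D')"
      by (simp add: S is_homD[OF \<iota>])
    also have "\<dots> = (\<Sum>n<k. cst (c' n) * t ^ n) * \<iota> (D * D') * \<iota> (e ^ k)"
      by (simp add: is_hom_power[OF \<iota>])
    also have "(\<Sum>n<k. cst (c' n) * t ^ n) * \<iota> (D * D') = \<iota> (L * A * D' + F * A' * D)"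
      using AD by (simp add: \<iota>_def eq_fract)
    finally have "S * (D * D') = (L * A * D' + F * A' * D) * e ^ k"
      unfolding is_homD(4)[OF \<iota>, symmetric] \<iota>_eq .
    then have "subst3 g (S * (D * D')) = subst3 g ((L * A * D' + F * A' * D) * e ^ k)"
      by simp
    also have "fps_X ^ k dvd \<dots>"
      using L F by (simp add: subst3_simps)
    finally have "fps_X ^ k dvd subst3 g S * subst3 g (D * D')"
      by (simp add: subst3_simps)
    then have dvd: "fps_X ^ k dvd subst3 g S"
      by (rule dvd_unit_cancel[rotated]) (rule unit, simp add: AD eval_at_mult)
    \<comment> \<open>Comparison of coefficients at index \<open>n\<close>: smaller terms vanish by
      induction, larger ones have order above \<open>n\<close>.\<close>
    have c'0: "c' n = 0" if "n < k" for n
      using that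
    proof (induction n rule: less_induct)
      case (less n)
      have "0 = fps_nth (subst3 g S) n"
        using fps_X_power_dvd_nth[OF dvd less.prems] by simp
      also have "\<dots> = (\<Sum>m<k. c' m * fps_nth (fps_X ^ m * e' ^ (k - m)) n)"
        by (simp add: S_def is_hom_sum[OF is_hom_subst3] subst3_simps l e'_def fps_sum_nth)
      also have "\<dots> = (\<Sum>m<k. if m = n then c' n * fps_nth (e' ^ (k - n)) 0 else 0)"
        using less by (intro sum.cong) (auto simp: nth not_less)
      finally show ?case using less.prems e' by (simp add: fps_nth_power_0)
    qed
    then show ?thesis by (auto simp: B_def c'_def)
  qed
  have "enat (card B) \<le> quotient_dim (local_ring p) W"
  proof -
    have "finite B" by (simp add: B_def)
    with BO ind have "B \<in> {B. finite B \<and> B \<subseteq> local_ring p \<and>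
        (\<forall>c. (\<Sum>b\<in>B. Fract (tconst (c b)) 1 * b) \<in> W \<longrightarrow> (\<forall>b\<in>B. c b = 0))}"
      by blast
    then show ?thesis
      unfolding quotient_dim_def by (rule SUP_upper)
  qed
  moreover have "card B = k" using inj by (simp add: B_def card_image)
  ultimately show ?thesis by (simp add: intersection_mult_def W_def)
qed

text \<open>The arc \<open>g\<close> is the tangent line itself, not the curve: since coordinate
  \<open>i\<close> of \<open>p\<close> is zero, the tangent does not involve it, and varying this
  coordinate alone restricts the equation of the curve to \<open>fps_X ^ d\<close>.\<close>

lemma fermat_inflection_point:
  assumes d: "d > 2" and p: "eval_at (fermat d) p = 0" and i: "rep_p2 p $ i = 0"
  shows "inflection_point (fermat d) p"
proof -
  define v where "v = rep_p2 p"
  have "\<exists>j. v $ j \<noteq> 0" using rep_p2_nonzero[of p] by (auto simp: v_def vec_eq_iff)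
  then obtain j where j: "v $ j \<noteq> 0" by blast
  define g where "g a = (if a = i then fps_X else fps_const (v $ a))" for a
  have sum0: "(\<Sum>a\<in>UNIV. (v $ a) ^ d) = 0"
    using p by (simp add: eval_at_fermat v_def)
  have "enat 3 \<le> intersection_mult (tangent_line (fermat d) p) (fermat d) p"
  proof (rule intersection_mult_ge[where g = g and l = "var i" and e = "var j"])
    show "fps_nth (g a) 0 = rep_p2 p $ a" for a
      using i by (simp add: g_def v_def)
    have "subst3 g (tangent_line (fermat d) p) = (\<Sum>a\<in>UNIV. fps_const (of_nat d * (v $ a) ^ (d - 1)) * g a)"
      by (simp add: tangent_line_altdef is_hom_sum[OF is_hom_subst3] subst3_simps eval_at_partial_fermat v_def)
    also have "\<dots> = (\<Sum>a\<in>UNIV. fps_const (of_nat d * (v $ a) ^ d))"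
    proof (rule sum.cong)
      fix a :: 3
      have "(v $ a) ^ d = (v $ a) ^ (d - 1) * v $ a" using d by (cases d) auto
      then show "fps_const (of_nat d * (v $ a) ^ (d - 1)) * g a = fps_const (of_nat d * (v $ a) ^ d)"
        using i d by (auto simp: g_def v_def)
    qed simp
    also have "\<dots> = fps_const (of_nat d * (\<Sum>a\<in>UNIV. (v $ a) ^ d))"
      by (simp add: sum_3 distrib_left)
    finally show "fps_X ^ 3 dvd subst3 g (tangent_line (fermat d) p)"
      by (simp add: sum0)
    have "subst3 g (fermat d) = (\<Sum>a\<in>UNIV. g a ^ d)"
      by (simp add: fermat_altdef is_hom_sum[OF is_hom_subst3] subst3_simps)
    also have "\<dots> = (\<Sum>a\<in>UNIV. fps_const ((v $ a) ^ d) + (if a = i then fps_X ^ d else 0))"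
      using i d by (intro sum.cong) (auto simp: g_def v_def fps_const_power)
    also have "\<dots> = fps_const (\<Sum>a\<in>UNIV. (v $ a) ^ d) + fps_X ^ d"
      by (simp add: sum.distrib) (simp add: sum_3)
    finally show "fps_X ^ 3 dvd subst3 g (fermat d)"
      using d by (simp add: sum0 le_imp_power_dvd)
    show "homogeneous 1 (var i)" "homogeneous 1 (var j)" "eval_at (var j) p \<noteq> 0"
      using j homogeneous_var by (auto simp: v_def simp del: One_nat_def)
    show "subst3 g (var i) = fps_X"
      by (simp add: g_def)
  qed
  then show ?thesis
    using p by (simp add: inflection_point_def zero_locus_def numeral_eq_enat)
qed

section \<open>Osculating conics\<close>

text \<open>
  The Taylor coefficients of order 1 to 5 of \<open>p Y + q Z + s Y\<^sup>2 + r Z\<^sup>2 + w Y Z\<close> for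
  \<open>Y = (1 + b t)\<^sup>m\<close> and \<open>Z = (1 + t)\<^sup>m\<close>, the \<open>n\<close>-th one multiplied by \<open>n! / m\<close>.
\<close>

locale conic_equations =
  fixes b m p q s r w :: complex
  assumes E1: "p*b + q + 2*(s*b + r) + w*(1 + b) = 0"
    and E2: "(m-1)*(p*b^2 + q) + 2*(2*m-1)*(s*b^2 + r) + w*((m-1)*(1 + b^2) + 2*m*b) = 0"
    and E3: "(m-1)*(m-2)*(p*b^3 + q) + 2*(2*m-1)*(2*m-2)*(s*b^3 + r)
      + w*((m-1)*(m-2)*(1 + b^3) + 3*m*(m-1)*(b + b^2)) = 0"
    and E4: "(m-1)*(m-2)*(m-3)*(p*b^4 + q) + 2*(2*m-1)*(2*m-2)*(2*m-3)*(s*b^4 + r)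
      + w*((m-1)*(m-2)*(m-3)*(1 + b^4) + 4*m*(m-1)*(m-2)*(b + b^3) + 6*m*(m-1)^2*b^2) = 0"
    and E5: "(m-1)*(m-2)*(m-3)*(m-4)*(p*b^5 + q) + 2*(2*m-1)*(2*m-2)*(2*m-3)*(2*m-4)*(s*b^5 + r)
      + w*((m-1)*(m-2)*(m-3)*(m-4)*(1 + b^5) + 5*m*(m-1)*(m-2)*(m-3)*(b + b^4)
        + 10*m*(m-1)^2*(m-2)*(b^2 + b^3)) = 0"
    and m: "m \<noteq> 0" "m \<noteq> 1" "m \<noteq> -1" "m \<noteq> 2" "2*m \<noteq> 1" and b: "b \<noteq> 0" "b \<noteq> 1"
begin

lemma m1: "m - 1 \<noteq> 0"
  using m by simp

text \<open>Eliminates \<open>q\<close>, so that \<open>p\<close> is determined by \<open>s\<close>,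
  \<open>r\<close> and \<open>w\<close>.\<close>

lemma X1: "b*(b-1)*(m-1)*p + 2*b*(2*m*b - m - b + 1) * s + 2*m*r + b*(m*b + m - b + 1)*w = 0"
  using E1 E2 by algebra

text \<open>\<open>Y1\<close>, \<open>Y2\<close>, \<open>Y3\<close> eliminate \<open>p\<close> and
  \<open>q\<close>. Since \<open>p*b^n + q\<close> satisfies the linear recurrence with
  characteristic roots 1 and \<open>b\<close>, three consecutive equations, weighted for the falling
  factors of \<open>m\<close>, cancel it. A factor \<open>m\<close>, and in \<open>Y3\<close> also
  \<open>m - 1\<close>, splits off.\<close>

lemma Y1: "2*b^2*(2*m*b - m - b + 2) * s - 2*(m*b - 2*m - 2*b + 1)*r + b*(b+1)*(m+1)*w = 0"
  (is "?Y = 0")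
proof -
  have "m * ?Y = 0" using E1 E2 E3 by algebra
  then show ?thesis by (simp only: mult_eq_0_iff m m1 simp_thms)
qed

lemma Y2: "2*b^3*(2*m-1)*(2*m*b - m - 2*b + 3) * s - 2*(2*m-1)*(m*b - 2*m - 3*b + 2)*r
    + b*(m+1)*(m*b^2 + 2*m*b + m - b^2 - 1)*w = 0" (is "?Y = 0")
proof -
  have "m * ?Y = ((m-1)*(m-2)*(m-3)*(p*b^4 + q) + 2*(2*m-1)*(2*m-2)*(2*m-3)*(s*b^4 + r) + w*((m-1)*(m-2)*(m-3)*(1 + b^4) + 4*m*(m-1)*(m-2)*(b + b^3) + 6*m*(m-1)^2*b^2))
      - ((m-3) + b*(m-3)) * ((m-1)*(m-2)*(p*b^3 + q) + 2*(2*m-1)*(2*m-2)*(s*b^3 + r) + w*((m-1)*(m-2)*(1 + b^3) + 3*m*(m-1)*(b + b^2)))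
      + b*(m-3)*(m-2) * ((m-1)*(p*b^2 + q) + 2*(2*m-1)*(s*b^2 + r) + w*((m-1)*(1 + b^2) + 2*m*b))"
    by algebra
  then have "m * ?Y = 0" unfolding E2 E3 E4 by simp
  then show ?thesis by (simp only: mult_eq_0_iff m m1 simp_thms)
qed

lemma Y3: "4*b^4*(2*m-1)*(2*m*b - m - 3*b + 4) * s - 4*(2*m-1)*(m*b - 2*m - 4*b + 3)*r
    + b*(b+1)*(m+1)*(m*b^2 + 2*m*b + m - 2*b^2 + 2*b - 2)*w = 0" (is "?Y = 0")
proof -
  have "m * (m - 1) * ?Y = ((m-1)*(m-2)*(m-3)*(m-4)*(p*b^5 + q) + 2*(2*m-1)*(2*m-2)*(2*m-3)*(2*m-4)*(s*b^5 + r) + w*((m-1)*(m-2)*(m-3)*(m-4)*(1 + b^5) + 5*m*(m-1)*(m-2)*(m-3)*(b + b^4) + 10*m*(m-1)^2*(m-2)*(b^2 + b^3)))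
      - ((m-4) + b*(m-4)) * ((m-1)*(m-2)*(m-3)*(p*b^4 + q) + 2*(2*m-1)*(2*m-2)*(2*m-3)*(s*b^4 + r) + w*((m-1)*(m-2)*(m-3)*(1 + b^4) + 4*m*(m-1)*(m-2)*(b + b^3) + 6*m*(m-1)^2*b^2))
      + b*(m-4)*(m-3) * ((m-1)*(m-2)*(p*b^3 + q) + 2*(2*m-1)*(2*m-2)*(s*b^3 + r) + w*((m-1)*(m-2)*(1 + b^3) + 3*m*(m-1)*(b + b^2)))"
    by algebra
  then have "m * (m - 1) * ?Y = 0" unfolding E3 E4 E5 by simp
  then show ?thesis by (simp only: mult_eq_0_iff m m1 simp_thms)
qed

text \<open>Cramer's rule for \<open>Y1\<close>, \<open>Y2\<close>, \<open>Y3\<close> in the unknowns \<open>s\<close>, \<open>r\<close>, \<open>w\<close>, with common factors removed.\<close>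

lemma zero_cases: "(b+1)*(b-2)*(2*b-1) = 0 \<or> p = 0 \<and> q = 0 \<and> s = 0 \<and> r = 0 \<and> w = 0"
proof -
  \<comment> \<open>Collects the factors that the locale makes nonzero. Besides these, the
    coefficients of \<open>w\<close>, \<open>s\<close> and \<open>r\<close> obtained below contain
    only \<open>(b+1)*(b-2)*(2*b-1)\<close>.\<close>
  define D where "D = b * (b-1) * (m-1) * (m-1) * (m-2) * (2*m-1) * (m+1)"
  have D: "D \<noteq> 0" using m b by (auto simp: D_def eq_neg_iff_add_eq_0)
  show ?thesis
  proof (rule disjCI)
    assume "\<not> (p = 0 \<and> q = 0 \<and> s = 0 \<and> r = 0 \<and> w = 0)"
    have "- (b * (b-1)^2 * (m-1)^2 * (m+1) * (m-2) * ((b+1)*(b-2)*(2*b-1)) * w)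
      = (2*b*(2*m-1)*(2*m^2*b^2 - 5*m^2*b + 2*m^2 - 9*m*b^2 + 18*m*b - 9*m + 9*b^2 - 17*b + 9)) * (2*b^2*(2*m*b - m - b + 2) * s - 2*(m*b - 2*m - 2*b + 1)*r + b*(b+1)*(m+1)*w)
      + (-2*(b+1)*(2*m^2*b^2 - 5*m^2*b + 2*m^2 - 7*m*b^2 + 14*m*b - 7*m + 6*b^2 - 11*b + 6))
        * (2*b^3*(2*m-1)*(2*m*b - m - 2*b + 3) * s - 2*(2*m-1)*(m*b - 2*m - 3*b + 2)*r + b*(m+1)*(m*b^2 + 2*m*b + m - b^2 - 1)*w)
      + ((m-1)*(2*m*b^2 - 5*m*b + 2*m - 4*b^2 + 7*b - 4))
        * (4*b^4*(2*m-1)*(2*m*b - m - 3*b + 4) * s - 4*(2*m-1)*(m*b - 2*m - 4*b + 3)*r + b*(b+1)*(m+1)*(m*b^2 + 2*m*b + m - 2*b^2 + 2*b - 2)*w)"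
      by algebra
    then have w: "b * (b-1)^2 * (m-1)^2 * (m+1) * (m-2) * ((b+1)*(b-2)*(2*b-1)) * w = 0"
      unfolding Y1 Y2 Y3 by simp
    have "- 2 * (b^2 * (b-1)^2 * (m-1)^2 * (2*m-1) * (m-2) * ((b+1)*(b-2)*(2*b-1)) * s)
      = (-1*(2*m-1)*(m^2*b^3 - 3*m^2*b - 2*m^2 - 5*m*b^3 + 2*m*b^2 + 5*m*b + 4*m + 6*b^3 - 6*b^2 - 2)) * (2*b^2*(2*m*b - m - b + 2) * s - 2*(m*b - 2*m - 2*b + 1)*r + b*(b+1)*(m+1)*w)
      + ((b+1)*(m^2*b^2 + m^2*b - 6*m^2 - 4*m*b^2 - m*b + 11*m + 4*b^2 - 2*b - 4))
        * (2*b^3*(2*m-1)*(2*m*b - m - 2*b + 3) * s - 2*(2*m-1)*(m*b - 2*m - 3*b + 2)*r + b*(m+1)*(m*b^2 + 2*m*b + m - b^2 - 1)*w)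
      + (-1*(m-1)*(m*b^2 - m*b - 2*m - 2*b^2 + 2*b + 1))
        * (4*b^4*(2*m-1)*(2*m*b - m - 3*b + 4) * s - 4*(2*m-1)*(m*b - 2*m - 4*b + 3)*r + b*(b+1)*(m+1)*(m*b^2 + 2*m*b + m - 2*b^2 + 2*b - 2)*w)"
      by algebra
    then have s: "b^2 * (b-1)^2 * (m-1)^2 * (2*m-1) * (m-2) * ((b+1)*(b-2)*(2*b-1)) * s = 0"
      unfolding Y1 Y2 Y3 by simp
    have "2 * ((b-1)^2 * (m-1)^2 * (2*m-1) * (m-2) * ((b+1)*(b-2)*(2*b-1)) * r)
      = (-b*(2*m-1)*(2*m^2*b^3 + 3*m^2*b^2 - m^2 - 4*m*b^3 - 5*m*b^2 - 2*m*b + 5*m + 2*b^3 + 6*b - 6)) * (2*b^2*(2*m*b - m - b + 2) * s - 2*(m*b - 2*m - 2*b + 1)*r + b*(b+1)*(m+1)*w)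
      + ((b+1)*(6*m^2*b^2 - m^2*b - m^2 - 11*m*b^2 + m*b + 4*m + 4*b^2 + 2*b - 4))
        * (2*b^3*(2*m-1)*(2*m*b - m - 2*b + 3) * s - 2*(2*m-1)*(m*b - 2*m - 3*b + 2)*r + b*(m+1)*(m*b^2 + 2*m*b + m - b^2 - 1)*w)
      + (-1*(m-1)*(2*m*b^2 + m*b - m - b^2 - 2*b + 2))
        * (4*b^4*(2*m-1)*(2*m*b - m - 3*b + 4) * s - 4*(2*m-1)*(m*b - 2*m - 4*b + 3)*r + b*(b+1)*(m+1)*(m*b^2 + 2*m*b + m - 2*b^2 + 2*b - 2)*w)"
      by algebra
    then have r: "(b-1)^2 * (m-1)^2 * (2*m-1) * (m-2) * ((b+1)*(b-2)*(2*b-1)) * r = 0"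
      unfolding Y1 Y2 Y3 by simp
    show "(b+1)*(b-2)*(2*b-1) = 0"
    proof (rule ccontr)
      assume nz: "(b+1)*(b-2)*(2*b-1) \<noteq> 0"
      have "w = 0" "s = 0" "r = 0"
        using w s r nz D by (auto simp: D_def)
      moreover from this have "p = 0" using X1 D by (auto simp: D_def)
      moreover from calculation have "q = 0" using E1 by simp
      ultimately show False using \<open>\<not> (p = 0 \<and> q = 0 \<and> s = 0 \<and> r = 0 \<and> w = 0)\<close> by simp
    qed
  qed
qed

text \<open>Here the d-th powers of two coordinates agree, and the solutions inherit the symmetry
  between them. Everything is then determined by \<open>s\<close>. The values 2 and 1/2 of
  \<open>b\<close> reduce to this one by permuting the coordinates.\<close>

lemma symmetric_case:
  assumes "b = -1"
  shows "s = r" "p = q" "(m+1)*w = 2*(2*m-1)*(5-3*m) * s" "(m-1)*p = w - 2*(2*m-1) * s"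
proof -
  have "(m - 1) * (s - r) = 0" using Y1 unfolding assms by algebra
  with m show sr: "s = r" by simp
  have "2 * ((m+1)*w - 2*(2*m-1)*(5-3*m) * s) = 0"
    using Y2 unfolding assms sr by algebra
  then show "(m+1)*w = 2*(2*m-1)*(5-3*m) * s" by simp
  show "p = q" using E1 unfolding assms sr by algebra
  have "2 * ((m-1)*p - (w - 2*(2*m-1) * s)) = 0"
    using X1 unfolding assms sr by algebra
  then have "(m-1)*p - (w - 2*(2*m-1) * s) = 0" by (subst (asm) mult_eq_0_iff) simp
  then show "(m-1)*p = w - 2*(2*m-1) * s" by simp
qed

end

section \<open>Coefficients of linear and quadratic forms, contact along power series\<close>

lemma UNIV_3_distinct:
  assumes "i \<noteq> j" "i \<noteq> k" "j \<noteq> (k::3)"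
  shows "UNIV = {i, j, k}"
proof -
  have "card {i, j, k} = card (UNIV :: 3 set)" using assms by simp
  then show ?thesis by (metis card_subset_eq finite_class.finite_UNIV subset_UNIV)
qed

lemma sum_3_distinct:
  assumes "i \<noteq> j" "i \<noteq> k" "j \<noteq> (k::3)"
  shows "(\<Sum>a\<in>UNIV. f a) = f i + f j + f k"
  using assms by (simp add: UNIV_3_distinct[OF assms] add.assoc)

lemma vec_eq_distinctI:
  fixes w w' :: "complex ^ 3"
  assumes "i \<noteq> j" "i \<noteq> k" "j \<noteq> k" "w $ i = w' $ i" "w $ j = w' $ j" "w $ k = w' $ k"
  shows "w = w'"
  unfolding vec_eq_iff
proof
  fix x
  have "x \<in> {i, j, k}" using UNIV_3_distinct[OF assms(1-3)] by blast
  then show "w $ x = w' $ x" using assms(4-6) by auto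
qed

text \<open>Every monomial of positive degree gives up one variable. Two applications produce the
  coefficient matrix of a quadratic form.\<close>

lemma homogeneous_decompose:
  assumes "homogeneous n A"
  shows "case n of 0 \<Rightarrow> \<exists>c. A = tconst c
    | Suc k \<Rightarrow> \<exists>B. (\<forall>a. homogeneous k (B a)) \<and> A = (\<Sum>a\<in>UNIV. var a * B a)"
  using assms
proof (induction rule: homogeneous_induct)
  case (zero n)
  show ?case by (cases n) (auto intro: exI[of _ 0] exI[of _ "\<lambda>_. 0"] simp: tconst_hom)
next
  case (const c)
  show ?case by auto
next
  case (add n A B)
  show ?case
  proof (cases n)
    case 0
    with add obtain a b where "A = tconst a" "B = tconst b" by auto
    then show ?thesis using 0 by (auto intro!: exI[of _ "a + b"] simp: tconst_hom)
  next
    case (Suc k)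
    with add obtain A' B' where "\<forall>a. homogeneous k (A' a)" "A = (\<Sum>a\<in>UNIV. var a * A' a)"
      "\<forall>a. homogeneous k (B' a)" "B = (\<Sum>a\<in>UNIV. var a * B' a)" by auto
    then show ?thesis using Suc
      by (auto intro!: exI[of _ "\<lambda>a. A' a + B' a"] homogeneous_add simp: distrib_left sum.distrib)
  qed
next
  case (var n A i)
  have "var i * A = (\<Sum>a\<in>UNIV. var a * (if a = i then A else 0))"
    by (simp add: if_distrib cong: if_cong)
  with var show ?case by (auto intro!: exI[of _ "\<lambda>a. if a = i then A else 0"])
qed

lemma linear_form:
  assumes "homogeneous 1 L"
  obtains c where "L = (\<Sum>a\<in>UNIV. tconst (c a) * var a)"
proof -
  obtain B where B: "\<forall>a. homogeneous 0 (B a)" "L = (\<Sum>a\<in>UNIV. var a * B a)"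
    using homogeneous_decompose[OF assms] by auto
  have "\<forall>a. \<exists>c. B a = tconst c"
    using B(1) homogeneous_decompose[of 0] by auto
  then obtain c where "\<And>a. B a = tconst (c a)" by metis
  with B(2) that show ?thesis by (simp add: mult.commute)
qed

lemma quadratic_form:
  assumes "homogeneous 2 Q"
  obtains M where "\<And>a b. M a b = M b a" "Q = (\<Sum>a\<in>UNIV. \<Sum>b\<in>UNIV. tconst (M a b) * var a * var b)"
proof -
  have "homogeneous (Suc 1) Q" using assms by (simp add: numeral_2_eq_2)
  then obtain B where B: "\<forall>a. homogeneous 1 (B a)" "Q = (\<Sum>a\<in>UNIV. var a * B a)"
    using homogeneous_decompose[of "Suc 1" Q] by auto
  have "\<forall>a. \<exists>c. B a = (\<Sum>b\<in>UNIV. tconst (c b) * var b)"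
    using B(1) by (metis linear_form)
  then obtain c where c: "\<And>a. B a = (\<Sum>b\<in>UNIV. tconst (c a b) * var b)" by metis
  have "Q = (\<Sum>a\<in>UNIV. \<Sum>b\<in>UNIV. tconst (c a b) * var a * var b)"
    unfolding B(2) c by (simp add: sum_distrib_left mult_ac)
  also have "\<dots> = (\<Sum>a\<in>UNIV. \<Sum>b\<in>UNIV. tconst (c a b / 2) * var a * var b)
      + (\<Sum>a\<in>UNIV. \<Sum>b\<in>UNIV. tconst (c a b / 2) * var a * var b)"
    by (simp flip: sum.distrib distrib_right tconst_hom)
  also have "\<dots> = (\<Sum>a\<in>UNIV. \<Sum>b\<in>UNIV. tconst (c a b / 2) * var a * var b)
      + (\<Sum>a\<in>UNIV. \<Sum>b\<in>UNIV. tconst (c b a / 2) * var a * var b)"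
    by (subst (2) sum.swap) (simp add: mult_ac)
  also have "\<dots> = (\<Sum>a\<in>UNIV. \<Sum>b\<in>UNIV. tconst ((c a b + c b a) / 2) * var a * var b)"
    by (simp add: add_divide_distrib flip: sum.distrib distrib_right tconst_hom)
  finally have "Q = (\<Sum>a\<in>UNIV. \<Sum>b\<in>UNIV. tconst ((c a b + c b a) / 2) * var a * var b)" .
  then show ?thesis
    by (rule that[rotated]) (simp add: add.commute)
qed

lemma is_unit_subst3:
  assumes "\<And>a. fps_nth (g a) 0 = rep_p2 p $ a" "eval_at P p \<noteq> 0"
  shows "is_unit (subst3 g P)"
  using assms by (simp add: subst3_nth_0 eval_at_def)

lemma fps_X_dvd_iff_nth_0: "fps_X dvd (f :: complex fps) \<longleftrightarrow> fps_nth f 0 = 0"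
proof
  assume "fps_X dvd f"
  then show "fps_nth f 0 = 0" using fps_X_power_dvd_nth[of 1 f 0] by simp
next
  assume "fps_nth f 0 = 0"
  then have "f = fps_X * fps_shift 1 f"
    by (intro fps_ext) (simp add: fps_X_mult_nth)
  then show "fps_X dvd f" by (metis dvd_triv_left)
qed

text \<open>Along an arc on the curve, the identity \<open>Q * E = l ^ k * A + F * B\<close> loses
  its last term, \<open>E\<close> becomes a unit, and \<open>l\<close> is divisible by
  \<open>fps_X\<close> because it vanishes at \<open>p\<close>.\<close>

lemma contact_arc:
  assumes mult: "intersection_mult Q (fermat d) p \<ge> enat k" and Q: "homogeneous n Q"
    and d: "d > 0" and p: "eval_at (fermat d) p = 0" and v: "\<And>a. rep_p2 p $ a \<noteq> 0"
    and g0: "\<And>a. fps_nth (g a) 0 = rep_p2 p $ a" and g: "(\<Sum>a\<in>UNIV. g a ^ d) = 0"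
  shows "fps_X ^ k dvd subst3 g Q"
proof -
  have hF: "homogeneous d (fermat d)"
    using homogeneous_power[OF homogeneous_var, of d]
    by (simp add: fermat_altdef sum_3 homogeneous_add del: var_simps)
  \<comment> \<open>Nonzero coordinates make the chart \<open>x \<noteq> 0\<close> and the
    derivative in \<open>z\<close>, which \<open>contact_identity\<close> fixes, available at every
    point considered.\<close>
  have Fz: "eval_at (dZ (fermat d)) p \<noteq> 0"
    using eval_at_partial_fermat[of 3 d p] v d by simp
  obtain E A B where E: "eval_at E p \<noteq> 0"
    "Q * E = (tconst (rep_p2 p $ 1) * varY - tconst (rep_p2 p $ 2) * varX) ^ k * A + fermat d * B"
    using contact_identity[OF hF p v Fz Q mult] by blast
  define l where "l = tconst (rep_p2 p $ 1) * varY - tconst (rep_p2 p $ 2) * varX"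
  have "subst3 g (fermat d) = 0"
    using g by (simp add: fermat_altdef is_hom_sum[OF is_hom_subst3] subst3_simps)
  with arg_cong[OF E(2), of "subst3 g"] have "subst3 g Q * subst3 g E = subst3 g l ^ k * subst3 g A"
    by (simp add: subst3_simps l_def)
  moreover have "fps_X dvd subst3 g l"
    unfolding fps_X_dvd_iff_nth_0 subst3_nth_0 l_def by (simp add: eval3_diff eval3_simps g0)
  ultimately have "fps_X ^ k dvd subst3 g Q * subst3 g E"
    by (simp add: dvd_power_same dvd_mult2)
  then show ?thesis
    using dvd_unit_cancel is_unit_subst3[OF g0 E(1)] by blast
qed

text \<open>The branch of \<open>(1 + b X)^(1/d)\<close> with constant term 1, as a binomial series
  with explicit coefficients.\<close>

definition fps_root :: "nat \<Rightarrow> complex \<Rightarrow> complex fps" where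
  "fps_root d b = fps_binomial (1 / of_nat d) oo (fps_const b * fps_X)"

lemma fps_root_power:
  assumes "d > 0"
  shows "fps_root d b ^ d = 1 + fps_const b * fps_X"
proof -
  have "fps_binomial c ^ n = fps_binomial (of_nat n * c)" for c :: complex and n
    by (induction n) (simp_all add: fps_binomial_add_mult algebra_simps)
  then have "fps_binomial (1 / of_nat d) ^ d = fps_binomial (1::complex)"
    using assms by simp
  also have "\<dots> = 1 + fps_X"
    using fps_binomial_of_nat[of 1] by simp
  finally show ?thesis
    by (simp add: fps_root_def fps_compose_power fps_compose_add_distrib)
qed

lemma fps_nth_root: "fps_nth (fps_root d b) n = b ^ n * ((1 / of_nat d) gchoose n)"
  by (simp add: fps_root_def fps_compose_linear)

lemma gchoose_simps:
  fixes m :: complex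
  shows "m gchoose 2 = m * (m - 1) / 2" "m gchoose 3 = m * (m - 1) * (m - 2) / 6"
    "m gchoose 4 = m * (m - 1) * (m - 2) * (m - 3) / 24"
    "m gchoose 5 = m * (m - 1) * (m - 2) * (m - 3) * (m - 4) / 120"
proof -
  have rec: "m gchoose Suc n = (m gchoose n) * (m - of_nat n) / of_nat (Suc n)" for n
    using gbinomial_mult_1[of m n] by (simp add: field_simps del: of_nat_Suc)
  show 2: "m gchoose 2 = m * (m - 1) / 2"
    using rec[of 1] by (simp add: numeral_2_eq_2)
  show 3: "m gchoose 3 = m * (m - 1) * (m - 2) / 6"
    using rec[of 2] 2 by simp
  show 4: "m gchoose 4 = m * (m - 1) * (m - 2) * (m - 3) / 24"
    using rec[of 3] 3 by simp
  show "m gchoose 5 = m * (m - 1) * (m - 2) * (m - 3) * (m - 4) / 120"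
    using rec[of 4] 4 by simp
qed

text \<open>The arc keeps coordinate \<open>i\<close> and multiplies the coordinates
  \<open>j\<close> and \<open>k\<close> by d-th roots of \<open>1 + b X\<close> and
  \<open>1 + X\<close>. The value of \<open>b\<close> cancels the linear term in the equation of the
  curve. Passing from \<open>M\<close> to \<open>N\<close> moves the point to (1, 1, 1); the factors
  2 turn matrix entries into coefficients of mixed terms.\<close>

lemma fermat_conic_equations:
  assumes d: "d > 3" and F: "eval_at (fermat d) p = 0" and v: "\<And>a. v $ a \<noteq> 0" "v = rep_p2 p"
    and Q: "Q = (\<Sum>a\<in>UNIV. \<Sum>b\<in>UNIV. tconst (M a b) * var a * var b)" "\<And>a b. M a b = M b a"
    and hQ: "homogeneous 2 Q"
    and mult: "intersection_mult Q (fermat d) p \<ge> enat 6"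
    and ijk: "i \<noteq> j" "i \<noteq> k" "j \<noteq> k"
    and N: "\<And>a b. N a b = M a b * v $ a * v $ b"
  shows "conic_equations (- (v $ k ^ d) / v $ j ^ d) (1 / of_nat d)
      (2 * N i j) (2 * N i k) (N j j) (N k k) (2 * N j k)"
    and "N i i = - (2 * N i j + 2 * N i k + N j j + N k k + 2 * N j k)"
proof -
  define m :: complex where "m = 1 / of_nat d"
  define b where "b = - (v $ k ^ d) / v $ j ^ d"
  define Y where "Y = fps_root d b"
  define Z where "Z = fps_root d 1"
  define g where "g a = fps_const (v $ a) * (if a = i then 1 else if a = j then Y else Z)" for a
  have g_eq: "g i = fps_const (v $ i)" "g j = fps_const (v $ j) * Y" "g k = fps_const (v $ k) * Z"
    using ijk by (auto simp: g_def)
  have b: "v $ j ^ d * b = - (v $ k ^ d)" using v by (simp add: b_def)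
  have sum0: "v $ i ^ d + v $ j ^ d + v $ k ^ d = 0"
    using F by (simp add: eval_at_fermat sum_3_distinct[OF ijk] v)
  have "(\<Sum>a\<in>UNIV. g a ^ d) = fps_const (v $ i ^ d) + fps_const (v $ j ^ d) * (1 + fps_const b * fps_X)
      + fps_const (v $ k ^ d) * (1 + fps_X)"
    using d fps_root_power[of d 1] fps_root_power[of d b]
    by (simp add: sum_3_distinct[OF ijk] g_eq power_mult_distrib fps_const_power Y_def Z_def)
  also have "\<dots> = fps_const (v $ i ^ d + v $ j ^ d + v $ k ^ d)
      + fps_const (v $ j ^ d * b + v $ k ^ d) * fps_X"
    by (simp add: algebra_simps fps_const_add[symmetric] fps_const_mult[symmetric] del: fps_const_add fps_const_mult)
  also have "\<dots> = 0" by (simp add: sum0 b)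
  finally have gd: "(\<Sum>a\<in>UNIV. g a ^ d) = 0" .
  have nth0: "fps_nth Y 0 = 1" "fps_nth Z 0 = 1"
    by (simp_all add: Y_def Z_def fps_nth_root)
  have dvd: "fps_X ^ 6 dvd subst3 g Q"
  proof (rule contact_arc[OF mult hQ _ F])
    show "fps_nth (g a) 0 = rep_p2 p $ a" for a
      using nth0 by (simp add: g_def v)
  qed (use d gd v in auto)
  define f where "f = fps_const (N i i) + fps_const (2 * N i j) * Y + fps_const (2 * N i k) * Z
    + fps_const (N j j) * (Y * Y) + fps_const (N k k) * (Z * Z) + fps_const (2 * N j k) * (Y * Z)"
  define C where "C x y = fps_const (N x y)" for x y
  have Csym: "C x y = C y x" for x y using Q(2)[of x y] by (simp add: C_def N mult_ac)
  have C2: "fps_const (2 * N x y) = 2 * C x y" for x y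
    by (simp add: C_def numeral_fps_const)
  have "subst3 g Q = (\<Sum>x\<in>UNIV. \<Sum>y\<in>UNIV. fps_const (M x y) * g x * g y)"
    unfolding Q(1) by (simp add: is_hom_sum[OF is_hom_subst3] subst3_simps)
  also have "\<dots> = (\<Sum>x\<in>UNIV. \<Sum>y\<in>UNIV. C x y
      * (if x = i then 1 else if x = j then Y else Z) * (if y = i then 1 else if y = j then Y else Z))"
  proof (intro sum.cong refl)
    fix x y
    have "C x y = fps_const (M x y) * fps_const (v $ x) * fps_const (v $ y)"
      by (simp add: C_def N)
    then show "fps_const (M x y) * g x * g y = C x y
      * (if x = i then 1 else if x = j then Y else Z) * (if y = i then 1 else if y = j then Y else Z)"
      by (simp only: g_def mult_ac)
  qed
  also have "\<dots> = f"
  proof -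
    have f_eq: "f = C i i + 2 * C i j * Y + 2 * C i k * Z + C j j * (Y * Y) + C k k * (Z * Z) + 2 * C j k * (Y * Z)"
      unfolding f_def C2 by (simp add: C_def)
    have neq: "j \<noteq> i" "k \<noteq> i" "k \<noteq> j" using ijk by auto
    show ?thesis
      unfolding sum_3_distinct[OF ijk] f_eq Csym[of j i] Csym[of k i] Csym[of k j]
      using neq by (simp add: algebra_simps)
  qed
  finally have "fps_X ^ 6 dvd f" using dvd by simp
  then have f: "fps_nth f n = 0" if "n < 6" for n
    using that fps_X_power_dvd_nth by blast
  define y where "y n = fps_nth Y n" for n
  define z where "z n = fps_nth Z n" for n
  have y: "y 0 = 1" "y 1 = b * m" "y 2 = b ^ 2 * (m * (m - 1) / 2)" "y 3 = b ^ 3 * (m * (m - 1) * (m - 2) / 6)"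
    "y 4 = b ^ 4 * (m * (m - 1) * (m - 2) * (m - 3) / 24)"
    "y 5 = b ^ 5 * (m * (m - 1) * (m - 2) * (m - 3) * (m - 4) / 120)"
    by (simp_all add: y_def Y_def fps_nth_root flip: m_def gchoose_simps)
  have z: "z 0 = 1" "z 1 = m" "z 2 = m * (m - 1) / 2" "z 3 = m * (m - 1) * (m - 2) / 6"
    "z 4 = m * (m - 1) * (m - 2) * (m - 3) / 24"
    "z 5 = m * (m - 1) * (m - 2) * (m - 3) * (m - 4) / 120"
    by (simp_all add: z_def Z_def fps_nth_root flip: m_def gchoose_simps)
  have fn: "2 * N i j * y n + 2 * N i k * z n + N j j * (\<Sum>l=0..n. y l * y (n - l))
      + N k k * (\<Sum>l=0..n. z l * z (n - l)) + 2 * N j k * (\<Sum>l=0..n. y l * z (n - l)) = 0"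
    if "0 < n" "n < 6" for n
  proof -
    have "2 * N i j * fps_nth Y n + 2 * N i k * fps_nth Z n + N j j * fps_nth (Y * Y) n
        + N k k * fps_nth (Z * Z) n + 2 * N j k * fps_nth (Y * Z) n = 0"
      using f[OF that(2)] that(1) by (simp add: f_def)
    then show ?thesis by (simp add: fps_mult_nth y_def z_def)
  qed
  have set: "{0..1} = {0,1::nat}" "{0..2} = {0,1,2::nat}" "{0..3} = {0,1,2,3::nat}"
    "{0..4} = {0,1,2,3,4::nat}" "{0..5} = {0,1,2,3,4,5::nat}"
    by auto
  show "N i i = - (2 * N i j + 2 * N i k + N j j + N k k + 2 * N j k)"
    using f[of 0] by (simp add: f_def nth0) algebra
  have m0: "m \<noteq> 0" using d by (simp add: m_def)
  have f1: "2 * N i j * y 1 + 2 * N i k * z 1 + N j j * (y 0 * y 1 + y 1 * y 0)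
      + N k k * (z 0 * z 1 + z 1 * z 0) + 2 * N j k * (y 0 * z 1 + y 1 * z 0) = 0"
    using fn[of 1] by (simp add: set add.assoc)
  \<comment> \<open>Here and for \<open>E2\<close> to \<open>E5\<close>, the n-th equation times
    \<open>m\<close> is \<open>n!\<close> times the n-th Taylor coefficient. The constant
    coefficient has already given \<open>N i i\<close>.\<close>
  have E1: "(2*N i j)*b + (2*N i k) + 2*(N j j*b + N k k) + (2*N j k)*(1 + b) = 0" (is "?E = 0")
  proof -
    have "m * ?E = 1 * (2 * N i j * y 1 + 2 * N i k * z 1 + N j j * (y 0 * y 1 + y 1 * y 0)
      + N k k * (z 0 * z 1 + z 1 * z 0) + 2 * N j k * (y 0 * z 1 + y 1 * z 0))"
      unfolding y z by algebra
    then show ?thesis unfolding f1 using m0 by simp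
  qed
  have f2: "2 * N i j * y 2 + 2 * N i k * z 2 + N j j * (y 0 * y 2 + y 1 * y 1 + y 2 * y 0)
      + N k k * (z 0 * z 2 + z 1 * z 1 + z 2 * z 0) + 2 * N j k * (y 0 * z 2 + y 1 * z 1 + y 2 * z 0) = 0"
    using fn[of 2] by (simp add: set add.assoc)
  have E2: "(m-1)*((2*N i j)*b^2 + (2*N i k)) + 2*(2*m-1)*(N j j*b^2 + N k k) + (2*N j k)*((m-1)*(1 + b^2) + 2*m*b) = 0" (is "?E = 0")
  proof -
    have "m * ?E = 2 * (2 * N i j * y 2 + 2 * N i k * z 2 + N j j * (y 0 * y 2 + y 1 * y 1 + y 2 * y 0)
      + N k k * (z 0 * z 2 + z 1 * z 1 + z 2 * z 0) + 2 * N j k * (y 0 * z 2 + y 1 * z 1 + y 2 * z 0))"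
      unfolding y z by (simp add: divide_simps, algebra)
    then show ?thesis unfolding f2 using m0 by simp
  qed
  have f3: "2 * N i j * y 3 + 2 * N i k * z 3 + N j j * (y 0 * y 3 + y 1 * y 2 + y 2 * y 1 + y 3 * y 0)
      + N k k * (z 0 * z 3 + z 1 * z 2 + z 2 * z 1 + z 3 * z 0) + 2 * N j k * (y 0 * z 3 + y 1 * z 2 + y 2 * z 1 + y 3 * z 0) = 0"
    using fn[of 3] by (simp add: set add.assoc)
  have E3: "(m-1)*(m-2)*((2*N i j)*b^3 + (2*N i k)) + 2*(2*m-1)*(2*m-2)*(N j j*b^3 + N k k) + (2*N j k)*((m-1)*(m-2)*(1 + b^3) + 3*m*(m-1)*(b + b^2)) = 0" (is "?E = 0")
  proof -
    have "m * ?E = 6 * (2 * N i j * y 3 + 2 * N i k * z 3 + N j j * (y 0 * y 3 + y 1 * y 2 + y 2 * y 1 + y 3 * y 0)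
      + N k k * (z 0 * z 3 + z 1 * z 2 + z 2 * z 1 + z 3 * z 0) + 2 * N j k * (y 0 * z 3 + y 1 * z 2 + y 2 * z 1 + y 3 * z 0))"
      unfolding y z by (simp add: divide_simps, algebra)
    then show ?thesis unfolding f3 using m0 by simp
  qed
  have f4: "2 * N i j * y 4 + 2 * N i k * z 4 + N j j * (y 0 * y 4 + y 1 * y 3 + y 2 * y 2 + y 3 * y 1 + y 4 * y 0)
      + N k k * (z 0 * z 4 + z 1 * z 3 + z 2 * z 2 + z 3 * z 1 + z 4 * z 0) + 2 * N j k * (y 0 * z 4 + y 1 * z 3 + y 2 * z 2 + y 3 * z 1 + y 4 * z 0) = 0"
    using fn[of 4] by (simp add: set add.assoc)
  have E4: "(m-1)*(m-2)*(m-3)*((2*N i j)*b^4 + (2*N i k)) + 2*(2*m-1)*(2*m-2)*(2*m-3)*(N j j*b^4 + N k k) + (2*N j k)*((m-1)*(m-2)*(m-3)*(1 + b^4) + 4*m*(m-1)*(m-2)*(b + b^3) + 6*m*(m-1)^2*b^2) = 0" (is "?E = 0")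
  proof -
    have "m * ?E = 24 * (2 * N i j * y 4 + 2 * N i k * z 4 + N j j * (y 0 * y 4 + y 1 * y 3 + y 2 * y 2 + y 3 * y 1 + y 4 * y 0)
      + N k k * (z 0 * z 4 + z 1 * z 3 + z 2 * z 2 + z 3 * z 1 + z 4 * z 0) + 2 * N j k * (y 0 * z 4 + y 1 * z 3 + y 2 * z 2 + y 3 * z 1 + y 4 * z 0))"
      unfolding y z by (simp add: divide_simps, algebra)
    then show ?thesis unfolding f4 using m0 by simp
  qed
  have f5: "2 * N i j * y 5 + 2 * N i k * z 5 + N j j * (y 0 * y 5 + y 1 * y 4 + y 2 * y 3 + y 3 * y 2 + y 4 * y 1 + y 5 * y 0)
      + N k k * (z 0 * z 5 + z 1 * z 4 + z 2 * z 3 + z 3 * z 2 + z 4 * z 1 + z 5 * z 0) + 2 * N j k * (y 0 * z 5 + y 1 * z 4 + y 2 * z 3 + y 3 * z 2 + y 4 * z 1 + y 5 * z 0) = 0"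
    using fn[of 5] by (simp add: set add.assoc)
  have E5: "(m-1)*(m-2)*(m-3)*(m-4)*((2*N i j)*b^5 + (2*N i k)) + 2*(2*m-1)*(2*m-2)*(2*m-3)*(2*m-4)*(N j j*b^5 + N k k) + (2*N j k)*((m-1)*(m-2)*(m-3)*(m-4)*(1 + b^5) + 5*m*(m-1)*(m-2)*(m-3)*(b + b^4) + 10*m*(m-1)^2*(m-2)*(b^2 + b^3)) = 0" (is "?E = 0")
  proof -
    have "m * ?E = 120 * (2 * N i j * y 5 + 2 * N i k * z 5 + N j j * (y 0 * y 5 + y 1 * y 4 + y 2 * y 3 + y 3 * y 2 + y 4 * y 1 + y 5 * y 0)
      + N k k * (z 0 * z 5 + z 1 * z 4 + z 2 * z 3 + z 3 * z 2 + z 4 * z 1 + z 5 * z 0) + 2 * N j k * (y 0 * z 5 + y 1 * z 4 + y 2 * z 3 + y 3 * z 2 + y 4 * z 1 + y 5 * z 0))"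
      unfolding y z by (simp add: divide_simps, algebra)
    then show ?thesis unfolding f5 using m0 by simp
  qed
  have "conic_equations b m (2 * N i j) (2 * N i k) (N j j) (N k k) (2 * N j k)"
  proof
    have "complex_of_nat d \<noteq> of_nat 1" "complex_of_nat d \<noteq> of_nat 2" "complex_of_nat (2 * d) \<noteq> of_nat 1"
      "complex_of_nat (d + 1) \<noteq> of_nat 0"
      using d by (simp_all only: of_nat_eq_iff)
    then show "m \<noteq> 1" "m \<noteq> -1" "m \<noteq> 2" "2 * m \<noteq> 1"
      using d by (auto simp: m_def field_simps eq_neg_iff_add_eq_0)
    show "b \<noteq> 0" using v by (simp add: b_def)
    show "b \<noteq> 1"
    proof
      assume "b = 1"
      with b sum0 have "v $ i ^ d = 0" by simp
      with v show False by simp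
    qed
  qed (fact E1 E2 E3 E4 E5 m0)+
  then show "conic_equations (- (v $ k ^ d) / v $ j ^ d) (1 / of_nat d)
      (2 * N i j) (2 * N i k) (N j j) (N k k) (2 * N j k)"
    by (simp only: b_def m_def)
qed

text \<open>
  The conic with sixfold contact with \<open>X\<^sup>d + Y\<^sup>d = 2 Z\<^sup>d\<close> at \<open>(1, 1, 1)\<close>. A sextactic point has this form after
  scaling and permuting the coordinates.
\<close>

definition osc_form :: "nat \<Rightarrow> complex \<Rightarrow> complex \<Rightarrow> complex \<Rightarrow> complex" where
  "osc_form d X Y Z = of_nat (d * (d + 1)) * (X^2 + Y^2) - of_nat (2 * (d - 2) * (5 * d - 3)) * X * Y
     + of_nat (8 * d * (d - 2)) * (X + Y) * Z - of_nat (4 * (d + 1) * (2 * d - 3)) * Z^2"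

text \<open>Clears the denominators of the symmetric solution for \<open>m = 1 / D\<close>. The
  results, relative to \<open>s\<close>, are the origin of the constants in
  \<open>osc_form\<close>.\<close>

lemma conic_coefficients:
  fixes D s w p e :: complex
  assumes D: "D \<noteq> 0" "D - 1 \<noteq> 0"
    and w: "(1 / D + 1) * w = 2 * (2 * (1 / D) - 1) * (5 - 3 * (1 / D)) * s"
    and p: "(1 / D - 1) * (2 * p) = w - 2 * (2 * (1 / D) - 1) * s"
    and e: "e = - (2 * p + 2 * p + s + s + w)"
  shows "D * (D + 1) * w = 2 * (2 - D) * (5 * D - 3) * s" "D * (D + 1) * p = 4 * D * (D - 2) * s"
    "D * (D + 1) * e = - 4 * (D + 1) * (2 * D - 3) * s"
proof -
  have 1: "D * (1 / D) = 1" using D by simp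
  have "D * (D + 1) * w = D * D * ((1 / D + 1) * w)"
    using D by (simp add: field_simps)
  also have "\<dots> = 2 * (2 * (D * (1 / D)) - D) * (5 * D - 3 * (D * (1 / D))) * s"
    unfolding w by (simp add: algebra_simps)
  finally show W: "D * (D + 1) * w = 2 * (2 - D) * (5 * D - 3) * s"
    unfolding 1 by simp
  have "(1 - D) * (2 * p) = D * ((1 / D - 1) * (2 * p))"
    using D by (simp add: field_simps)
  also have "\<dots> = D * w - 2 * (2 * (D * (1 / D)) - D) * s"
    unfolding p by (simp add: algebra_simps)
  finally have P: "(1 - D) * (2 * p) = D * w - 2 * (2 - D) * s"
    unfolding 1 by simp
  have "2 * (D - 1) * (D * (D + 1) * p - 4 * D * (D - 2) * s)
      = - (D * (D + 1)) * ((1 - D) * (2 * p) - (D * w - 2 * (2 - D) * s))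
        - D * (D * (D + 1) * w - 2 * (2 - D) * (5 * D - 3) * s)"
    by algebra
  also have "\<dots> = 0" unfolding P W by simp
  finally show P': "D * (D + 1) * p = 4 * D * (D - 2) * s" using D by simp
  have "D * (D + 1) * e = - 4 * (D * (D + 1) * p) - 2 * (D * (D + 1)) * s - D * (D + 1) * w"
    unfolding e by algebra
  also have "\<dots> = - 4 * (D + 1) * (2 * D - 3) * s"
    unfolding P' W by algebra
  finally show "D * (D + 1) * e = - 4 * (D + 1) * (2 * D - 3) * s" .
qed

text \<open>The indices are arbitrary, so the second claim can be applied to whichever pair the
  first one yields. The coordinate outside the pair becomes the last argument of
  \<open>osc_form\<close>.\<close>

lemma hyperosculating_conic_cases:
  assumes d: "d > 3" and F: "eval_at (fermat d) p = 0" and v: "\<And>a. v $ a \<noteq> 0" "v = rep_p2 p"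
    and Q: "hyperosculating_conic (fermat d) p Q" and ijk: "i \<noteq> j" "i \<noteq> k" "j \<noteq> k"
  shows "v $ j ^ d = v $ k ^ d \<or> v $ i ^ d = v $ j ^ d \<or> v $ i ^ d = v $ k ^ d" (is ?A)
    and "v $ j ^ d = v $ k ^ d \<Longrightarrow>
      \<exists>l. l \<noteq> 0 \<and> (\<forall>w. eval3 Q w = l * osc_form d (w $ j / v $ j) (w $ k / v $ k) (w $ i / v $ i))"
      (is "_ \<Longrightarrow> ?B")
proof -
  have hQ: "homogeneous 2 Q" "Q \<noteq> 0" and mult: "intersection_mult Q (fermat d) p \<ge> enat 6"
    using Q by (auto simp: hyperosculating_conic_def osculating_conic_def is_conic_def numeral_eq_enat)
  obtain M where M: "\<And>a b. M a b = M b a" "Q = (\<Sum>a\<in>UNIV. \<Sum>b\<in>UNIV. tconst (M a b) * var a * var b)"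
    using quadratic_form[OF hQ(1)] by blast
  define N where "N a b = M a b * v $ a * v $ b" for a b
  define b where "b = - (v $ k ^ d) / v $ j ^ d"
  have Nsym: "N x y = N y x" for x y using M(1)[of x y] by (simp add: N_def mult_ac)
  note eqs = fermat_conic_equations[OF d F v M(2,1) hQ(1) mult ijk N_def]
  interpret conic_equations b "1 / of_nat d" "2 * N i j" "2 * N i k" "N j j" "N k k" "2 * N j k"
    using eqs(1) by (simp add: b_def)
  note Nii = eqs(2)
  have sum0: "v $ i ^ d + v $ j ^ d + v $ k ^ d = 0"
    using F by (simp add: eval_at_fermat sum_3_distinct[OF ijk] v)
  have vk: "v $ k ^ d = - b * v $ j ^ d" using v by (simp add: b_def)
  \<comment> \<open>\<open>N i i\<close> is a combination of the other five entries, so if these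
    were zero, \<open>Q\<close> would vanish.\<close>
  have nonzero: "\<not> (N i j = 0 \<and> N i k = 0 \<and> N j j = 0 \<and> N k k = 0 \<and> N j k = 0)"
  proof
    assume *: "N i j = 0 \<and> N i k = 0 \<and> N j j = 0 \<and> N k k = 0 \<and> N j k = 0"
    then have "N i i = 0" using Nii by simp
    then have "N x y = 0" for x y
      using * Nsym UNIV_3_distinct[OF ijk] by (metis UNIV_I empty_iff insertE)
    then have "M x y = 0" for x y using v by (simp add: N_def)
    with M(2) hQ(2) show False by (simp add: tconst_hom)
  qed
  show ?A
  proof -
    \<comment> \<open>The d-th powers in positions \<open>j\<close>, \<open>k\<close>,
      \<open>i\<close> are proportional to \<open>1\<close>, \<open>- b\<close>,
      \<open>b - 1\<close>. The roots -1, 2 and 1/2 are exactly the values of \<open>b\<close> for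
      which two of these agree.\<close>
    have "(b+1)*(b-2)*(2*b-1) = 0" using zero_cases nonzero by auto
    then consider "b = -1" | "b = 2" | "2 * b = 1"
      by (auto simp: eq_neg_iff_add_eq_0)
    then show ?thesis
    proof cases
      case 1
      then show ?thesis using vk by simp
    next
      case 2
      then have "v $ i ^ d - v $ j ^ d = v $ i ^ d + v $ j ^ d + v $ k ^ d"
        using vk by simp
      then have "v $ i ^ d = v $ j ^ d" unfolding sum0 by simp
      then show ?thesis by simp
    next
      case 3
      have "2 * v $ k ^ d = - (2 * b) * v $ j ^ d" using vk by simp
      then have "v $ i ^ d - v $ k ^ d = v $ i ^ d + v $ j ^ d + v $ k ^ d"
        unfolding 3 by simp
      then have "v $ i ^ d = v $ k ^ d" unfolding sum0 by simp
      then show ?thesis by simp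
    qed
  qed
  show ?B if "v $ j ^ d = v $ k ^ d"
  proof -
    have b: "b = -1" using that v(1)[of j] v(1)[of k] by (simp add: b_def)
    define s where "s = N j j"
    define D :: complex where "D = of_nat d"
    have D: "D \<noteq> 0" "D - 1 \<noteq> 0" using d by (simp_all add: D_def)
    have D1: "D + 1 \<noteq> 0"
      using of_nat_neq_0[of d, where 'a = complex] by (simp add: D_def add.commute)
    note sc = symmetric_case[OF b]
    have kk: "N k k = s" and ik: "N i k = N i j" using sc(1,2) by (simp_all add: s_def)
    have jk: "D * (D + 1) * (2 * N j k) = 2 * (2 - D) * (5 * D - 3) * s"
      and ij: "D * (D + 1) * N i j = 4 * D * (D - 2) * s"
      and ii: "D * (D + 1) * N i i = - 4 * (D + 1) * (2 * D - 3) * s"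
      using conic_coefficients[OF D(1,2), where w = "2 * N j k" and p = "N i j" and e = "N i i" and s = s]
        sc(3,4) Nii unfolding kk ik by (simp_all add: D_def s_def)
    have s0: "s \<noteq> 0"
    proof
      assume "s = 0"
      with ij jk D D1 have "N i j = 0" "N j k = 0" by auto
      with \<open>s = 0\<close> kk ik nonzero show False by (simp add: s_def)
    qed
    define l where "l = s / (D * (D + 1))"
    have l: "l \<noteq> 0" "s = l * (D * (D + 1))" using s0 D D1 by (auto simp: l_def)
    have DD: "D * (D + 1) \<noteq> 0" using D D1 by simp
    have Nl: "N j j = l * (D * (D + 1))" "2 * N j k = l * (2 * (2 - D) * (5 * D - 3))"
      "N i j = l * (4 * D * (D - 2))" "N i i = l * (- 4 * (D + 1) * (2 * D - 3))"
    proof -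
      have cancel: "x = l * y" if "D * (D + 1) * x = y * s" for x y
        using that DD by (simp add: l_def eq_divide_eq mult.commute)
      show "N j j = l * (D * (D + 1))" using l(2) by (simp add: s_def)
      show "2 * N j k = l * (2 * (2 - D) * (5 * D - 3))" "N i j = l * (4 * D * (D - 2))"
        "N i i = l * (- 4 * (D + 1) * (2 * D - 3))"
        by (rule cancel, rule jk ij ii)+
    qed
    have of_nat: "of_nat (d * (d + 1)) = D * (D + 1)" "of_nat (2 * (d - 2) * (5 * d - 3)) = 2 * (D - 2) * (5 * D - 3)"
      "of_nat (8 * d * (d - 2)) = 8 * D * (D - 2)" "of_nat (4 * (d + 1) * (2 * d - 3)) = 4 * (D + 1) * (2 * D - 3)"
      using d by (simp_all add: D_def of_nat_diff, simp add: algebra_simps)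
    have "eval3 Q w = l * osc_form d (w $ j / v $ j) (w $ k / v $ k) (w $ i / v $ i)" for w
    proof -
      define x where "x a = w $ a / v $ a" for a
      have "eval3 Q w = (\<Sum>a\<in>UNIV. \<Sum>c\<in>UNIV. M a c * w $ a * w $ c)"
        unfolding M(2) by (simp add: is_hom_sum[OF is_hom_eval3] eval3_simps)
      also have "\<dots> = (\<Sum>a\<in>UNIV. \<Sum>c\<in>UNIV. N a c * x a * x c)"
        using v by (intro sum.cong refl) (simp add: N_def x_def)
      also have "\<dots> = N i i * x i ^ 2 + N j j * x j ^ 2 + s * x k ^ 2 + 2 * N i j * x i * x j
          + 2 * N i j * x i * x k + 2 * N j k * x j * x k"
        unfolding sum_3_distinct[OF ijk] Nsym[of j i] Nsym[of k i] Nsym[of k j] ik kk by algebra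
      also have "\<dots> = l * osc_form d (x j) (x k) (x i)"
        unfolding osc_form_def of_nat Nl l(2) by algebra
      finally show ?thesis by (simp add: x_def)
    qed
    with l(1) show ?thesis by blast
  qed
qed

section \<open>Multiplicities of unions of lines and conics\<close>

text \<open>All iterated partial derivatives of order below \<open>m\<close> are zero at
  \<open>q\<close>. The recursion admits every order of differentiation, so the Leibniz rule can be
  used without commuting derivatives.\<close>

primrec vanishes :: "nat \<Rightarrow> tpoly \<Rightarrow> p2 \<Rightarrow> bool" where
  "vanishes 0 P q \<longleftrightarrow> True"
| "vanishes (Suc m) P q \<longleftrightarrow> eval_at P q = 0 \<and> (\<forall>i. vanishes m (partial i P) q)"

lemma vanishes_Suc_le: "vanishes (Suc m) P q \<Longrightarrow> vanishes m P q"
  by (induction m arbitrary: P) auto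

lemma vanishes_add: "vanishes m P q \<Longrightarrow> vanishes m R q \<Longrightarrow> vanishes m (P + R) q"
  by (induction m arbitrary: P R) (auto simp: partial_add eval_at_add)

lemma vanishes_mult_right: "vanishes m P q \<Longrightarrow> vanishes m (P * R) q"
proof (induction m arbitrary: P R)
  case (Suc m)
  from vanishes_Suc_le[OF Suc.prems] Suc show ?case
    by (simp add: partial_mult eval_at_mult vanishes_add)
qed simp

lemma vanishes_Suc_mult:
  "eval_at C q = 0 \<Longrightarrow> vanishes m P q \<Longrightarrow> vanishes (Suc m) (C * P) q"
proof (induction m arbitrary: P)
  case 0
  then show ?case by (simp add: eval_at_mult)
next
  case (Suc m)
  have "vanishes (Suc m) (P * partial i C) q" for i
    using Suc.prems(2) by (rule vanishes_mult_right)
  moreover have "vanishes (Suc m) (C * partial i P) q" for i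
    using Suc by simp
  ultimately have "vanishes (Suc m) (partial i C * P + C * partial i P) q" for i
    by (metis vanishes_add mult.commute)
  moreover have "eval_at (C * P) q = 0" using Suc.prems by (simp add: eval_at_mult)
  ultimately show ?case
    unfolding vanishes.simps(2)[of "Suc m"] partial_mult by blast
qed

lemma vanishes_prod:
  "finite I \<Longrightarrow> (\<And>i. i \<in> I \<Longrightarrow> eval_at (C i) q = 0) \<Longrightarrow> vanishes (card I) (\<Prod>i\<in>I. C i) q"
  by (induction I rule: finite_induct) (auto simp del: vanishes.simps(2) intro: vanishes_Suc_mult)

lemma vanishes_iterate: "vanishes m P q \<Longrightarrow> vanishes (m - n) ((partial i ^^ n) P) q"
proof (induction n arbitrary: m P)
  case (Suc n)
  then have "vanishes (m - 1) (partial i P) q" by (cases m) auto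
  from Suc.IH[OF this] show ?case by (simp add: funpow_Suc_right del: funpow.simps)
qed simp

lemma vanishes_eval: "vanishes m P q \<Longrightarrow> m > 0 \<Longrightarrow> eval_at P q = 0"
  by (cases m) auto

lemma iterate_partial_add: "(partial i ^^ n) (P + R) = (partial i ^^ n) P + (partial i ^^ n) R"
  by (induction n) (auto simp: partial_add)

lemma eval_iterate_partial_mult:
  "vanishes m P q \<Longrightarrow> eval_at ((partial i ^^ m) (R * P)) q = eval_at R q * eval_at ((partial i ^^ m) P) q"
proof (induction m arbitrary: P R)
  case 0
  then show ?case by (simp add: eval_at_mult)
next
  case (Suc m)
  have "vanishes (Suc m - m) ((partial i ^^ m) P) q" using Suc.prems by (rule vanishes_iterate)
  then have "eval_at ((partial i ^^ m) P) q = 0" by (simp add: Suc_diff_le)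
  moreover have "vanishes m P q" "vanishes m (partial i P) q"
    using Suc.prems vanishes_Suc_le by auto
  ultimately show ?case
    using Suc.IH by (simp add: funpow_Suc_right partial_mult iterate_partial_add eval_at_add del: funpow.simps)
qed

text \<open>Exactly one of the \<open>Suc m\<close> derivatives must fall on \<open>C\<close>: with
  none the value of \<open>C\<close> is 0, with more too few are left for \<open>P\<close>.\<close>

lemma eval_iterate_partial_Suc_mult:
  "eval_at C q = 0 \<Longrightarrow> vanishes m P q \<Longrightarrow> eval_at ((partial i ^^ Suc m) (C * P)) q
    = of_nat (Suc m) * eval_at (partial i C) q * eval_at ((partial i ^^ m) P) q"
proof (induction m arbitrary: P)
  case 0
  then show ?case by (simp add: partial_mult eval_at_mult eval_at_add)
next
  case (Suc m)
  have "eval_at ((partial i ^^ Suc (Suc m)) (C * P)) q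
      = eval_at ((partial i ^^ Suc m) (partial i C * P)) q + eval_at ((partial i ^^ Suc m) (C * partial i P)) q"
    by (subst funpow_Suc_right) (simp add: partial_mult iterate_partial_add eval_at_add del: funpow.simps)
  also have "eval_at ((partial i ^^ Suc m) (partial i C * P)) q
      = eval_at (partial i C) q * eval_at ((partial i ^^ Suc m) P) q"
    using Suc.prems(2) by (rule eval_iterate_partial_mult)
  also have "eval_at ((partial i ^^ Suc m) (C * partial i P)) q
      = of_nat (Suc m) * eval_at (partial i C) q * eval_at ((partial i ^^ m) (partial i P)) q"
    using Suc by simp
  also have "(partial i ^^ m) (partial i P) = (partial i ^^ Suc m) P"
    by (simp add: funpow_Suc_right del: funpow.simps)
  finally show ?case by (simp add: algebra_simps del: funpow.simps)
qed

lemma eval_iterate_partial_prod: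
  "finite I \<Longrightarrow> (\<And>i. i \<in> I \<Longrightarrow> eval_at (C i) q = 0) \<Longrightarrow>
    eval_at ((partial a ^^ card I) (\<Prod>i\<in>I. C i)) q = fact (card I) * (\<Prod>i\<in>I. eval_at (partial a (C i)) q)"
proof (induction I rule: finite_induct)
  case (insert j I)
  have "vanishes (card I) (\<Prod>i\<in>I. C i) q"
    using insert by (intro vanishes_prod) auto
  then have "eval_at ((partial a ^^ Suc (card I)) (C j * (\<Prod>i\<in>I. C i))) q
      = of_nat (Suc (card I)) * eval_at (partial a (C j)) q * eval_at ((partial a ^^ card I) (\<Prod>i\<in>I. C i)) q"
    using insert by (intro eval_iterate_partial_Suc_mult) auto
  with insert show ?case by (simp add: algebra_simps del: funpow.simps)
qed simp

text \<open>A product of \<open>n\<close> forms through \<open>q\<close> vanishes to order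
  \<open>n\<close>, and its n-th derivative in a single direction \<open>a\<close> is
  \<open>n!\<close> times the product of the first derivatives. One direction that suits all factors
  therefore settles the multiplicity.\<close>

lemma point_mult_prod:
  assumes I: "finite I" and C: "\<And>i. i \<in> I \<Longrightarrow> eval_at (C i) q = 0"
    and D: "\<And>i. i \<in> I \<Longrightarrow> eval_at (partial a (C i)) q \<noteq> 0"
  shows "point_mult (\<Prod>i\<in>I. C i) q = card I"
  unfolding point_mult_def
proof (rule Least_equality)
  have "eval_at ((partial a ^^ card I) (\<Prod>i\<in>I. C i)) q \<noteq> 0"
    using eval_iterate_partial_prod[of I C q a] I C D by simp
  moreover have "\<exists>i j k. i + j + k = n \<and> (dX ^^ i) ((dY ^^ j) ((dZ ^^ k) P)) = (partial a ^^ n) P" for n P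
  proof -
    consider "a = 1" | "a = 2" | "a = 3" using exhaust_3[of a] by auto
    then show ?thesis
    proof cases
      case 1
      then show ?thesis by (intro exI[of _ n] exI[of _ 0]) simp
    next
      case 2
      then show ?thesis by (intro exI[of _ 0] exI[of _ n]) simp
    next
      case 3
      then show ?thesis by (intro exI[of _ 0] exI[of _ n]) simp
    qed
  qed
  ultimately show "\<exists>i j k. i + j + k = card I \<and> eval_at ((dX ^^ i) ((dY ^^ j) ((dZ ^^ k) (\<Prod>i\<in>I. C i)))) q \<noteq> 0"
    by metis
next
  fix m
  assume "\<exists>i j k. i + j + k = m \<and> eval_at ((dX ^^ i) ((dY ^^ j) ((dZ ^^ k) (\<Prod>i\<in>I. C i)))) q \<noteq> 0"
  then obtain i j k where ijk: "i + j + k = m" "eval_at ((dX ^^ i) ((dY ^^ j) ((dZ ^^ k) (\<Prod>i\<in>I. C i)))) q \<noteq> 0"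
    by blast
  have "vanishes (card I - k - j - i) ((partial 1 ^^ i) ((partial 2 ^^ j) ((partial 3 ^^ k) (\<Prod>i\<in>I. C i)))) q"
    using vanishes_prod[OF I C] by (intro vanishes_iterate) auto
  then have "\<not> card I - k - j - i > 0"
    using vanishes_eval ijk(2) by fastforce
  with ijk(1) show "card I \<le> m" by simp
qed

section \<open>Common points of families of lines and conics\<close>

lemma abs_p2_rep:
  assumes "u \<noteq> 0"
  obtains c where "c \<noteq> 0" "rep_p2 (abs_p2 u) = c *s u"
proof -
  have "proj_rel u u" using assms by (auto simp: proj_rel_def intro!: exI[of _ 1])
  then have "proj_rel (rep_p2 (abs_p2 u)) u"
    using Quotient_rep_abs[OF Quotient_p2] by blast
  then obtain c where c: "c \<noteq> 0" "u = c *s rep_p2 (abs_p2 u)" by (auto simp: proj_rel_def)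
  then have "rep_p2 (abs_p2 u) = inverse c *s u" by (metis vector_smult_assoc left_inverse vector_smult_lid)
  with c that show ?thesis by (metis inverse_nonzero_iff_nonzero)
qed

lemma eval_at_abs_p2:
  assumes "homogeneous n P" "u \<noteq> 0"
  shows "eval_at P (abs_p2 u) = 0 \<longleftrightarrow> eval3 P u = 0"
  using abs_p2_rep[OF assms(2)] eval3_scale[OF assms(1)] by (metis eval_at_def mult_eq_0_iff power_not_zero)

lemma p2_eqI:
  assumes "c \<noteq> 0" "rep_p2 q = c *s rep_p2 p"
  shows "p = q"
proof -
  have "proj_rel (rep_p2 p) (rep_p2 q)"
    using assms rep_p2_nonzero by (auto simp: proj_rel_def)
  then show ?thesis using Quotient_rel_rep[OF Quotient_p2] by blast
qed

lemma p2_eq_abs: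
  assumes "rep_p2 p = c *s u"
  shows "p = abs_p2 u"
proof -
  have "c \<noteq> 0" "u \<noteq> 0" using assms rep_p2_nonzero[of p] by auto
  obtain e where e: "e \<noteq> 0" "rep_p2 (abs_p2 u) = e *s u" using abs_p2_rep[OF \<open>u \<noteq> 0\<close>] by blast
  have "rep_p2 (abs_p2 u) = (e / c) *s rep_p2 p"
    using e assms \<open>c \<noteq> 0\<close> by (simp add: vector_smult_assoc)
  then show ?thesis using p2_eqI[of "e / c" "abs_p2 u" p] e \<open>c \<noteq> 0\<close> by simp
qed

lemma eval3_partial_linear:
  assumes "homogeneous 1 L"
  shows "eval3 (partial a L) w = eval3 L (axis a 1)"
proof -
  obtain c where c: "L = (\<Sum>a\<in>UNIV. tconst (c a) * var a)" using linear_form[OF assms] by blast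
  show ?thesis
    unfolding c partial_sum is_hom_sum[OF is_hom_eval3]
    by (intro sum.cong refl) (auto simp: partial_mult partial_var eval3_simps axis_def)
qed

text \<open>The central difference is exact for quadratic forms. It yields derivatives of a conic
  from its values alone, which is how the conics are given later.\<close>

lemma eval3_partial_quadratic:
  assumes "homogeneous 2 Q"
  shows "eval3 (partial a Q) w = (eval3 Q (w + axis a 1) - eval3 Q (w - axis a 1)) / 2"
proof -
  obtain M where M: "Q = (\<Sum>a\<in>UNIV. \<Sum>b\<in>UNIV. tconst (M a b) * var a * var b)"
    using quadratic_form[OF assms] by blast
  have "eval3 (partial a Q) w = (\<Sum>x\<in>UNIV. \<Sum>y\<in>UNIV. M x y * (axis a 1 $ x * w $ y + w $ x * axis a 1 $ y))"
    unfolding M partial_sum is_hom_sum[OF is_hom_eval3]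
    by (intro sum.cong refl) (auto simp: partial_mult partial_var eval3_simps axis_def algebra_simps)
  also have "\<dots> = (\<Sum>x\<in>UNIV. \<Sum>y\<in>UNIV. (M x y * (w + axis a 1) $ x * (w + axis a 1) $ y
      - M x y * (w - axis a 1) $ x * (w - axis a 1) $ y) / 2)"
    by (intro sum.cong refl) (simp add: field_simps)
  also have "\<dots> = (eval3 Q (w + axis a 1) - eval3 Q (w - axis a 1)) / 2"
    unfolding M by (simp add: is_hom_sum[OF is_hom_eval3] eval3_simps sum_subtractf sum_divide_distrib[symmetric])
  finally show ?thesis .
qed

lemma quadratic_three_roots:
  fixes K B C e f g :: complex
  assumes "K * e^2 + B * e + C = 0" "K * f^2 + B * f + C = 0" "K * g^2 + B * g + C = 0"
    and ne: "e \<noteq> f" "e \<noteq> g" "f \<noteq> g"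
  shows "K = 0" "B = 0" "C = 0"
proof -
  have "(e - f) * (e - g) * (f - g) * K
      = (f - g) * (K * e^2 + B * e + C) - (e - g) * (K * f^2 + B * f + C) + (e - f) * (K * g^2 + B * g + C)"
    by algebra
  then show K: "K = 0" unfolding assms using ne by simp
  have "(e - f) * B = (K * e^2 + B * e + C) - (K * f^2 + B * f + C)" unfolding K by algebra
  then show "B = 0" unfolding assms using ne by simp
  then show "C = 0" using assms(1) K by simp
qed

text \<open>Up to the factors \<open>c n\<close>, the lines differ only in the coefficient of
  coordinate \<open>k\<close>. Subtracting two of them forces this coordinate to be zero.\<close>

lemma concurrent_lines:
  fixes T :: "nat \<Rightarrow> tpoly"
  assumes ijk: "i \<noteq> j" "i \<noteq> k" "j \<noteq> k" and I: "finite I" "card I \<ge> 2"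
    and T: "\<And>n. n \<in> I \<Longrightarrow> homogeneous 1 (T n)"
    and ev: "\<And>n w. n \<in> I \<Longrightarrow> eval3 (T n) w = c n * (w $ i + r * w $ j + m n * w $ k)"
    and c: "\<And>n. n \<in> I \<Longrightarrow> c n \<noteq> 0" and m: "inj_on m I"
  shows "\<exists>q. (\<Inter>n\<in>I. zero_locus (T n)) = {q} \<and> fold_point_of_union (card I) I T q"
proof -
  define u :: "complex ^ 3" where "u = (\<chi> a. if a = i then - r else if a = j then 1 else 0)"
  have u: "u $ i = - r" "u $ j = 1" "u $ k = 0" using ijk by (auto simp: u_def)
  then have "u \<noteq> 0" by auto
  define q where "q = abs_p2 u"
  have q: "eval_at (T n) q = 0" if "n \<in> I" for n
    using eval_at_abs_p2[OF T[OF that] \<open>u \<noteq> 0\<close>] by (simp add: q_def ev that u)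
  obtain x y where xy: "x \<in> I" "y \<in> I" "x \<noteq> y"
    using I by (metis card_le_Suc0_iff_eq not_less_eq_eq numeral_2_eq_2)
  have "p = q" if "p \<in> (\<Inter>n\<in>I. zero_locus (T n))" for p
  proof -
    define w where "w = rep_p2 p"
    have eq: "w $ i + r * w $ j + m n * w $ k = 0" if "n \<in> I" for n
      using \<open>p \<in> _\<close> that ev[OF that, of w] c[OF that] by (auto simp: zero_locus_def eval_at_def w_def)
    have "(m x - m y) * w $ k = (w $ i + r * w $ j + m x * w $ k) - (w $ i + r * w $ j + m y * w $ k)"
      by (simp add: algebra_simps)
    then have "(m x - m y) * w $ k = 0" unfolding eq[OF xy(1)] eq[OF xy(2)] by simp
    then have wk: "w $ k = 0" using m xy by (auto dest: inj_onD)
    then have wi: "w $ i = - r * w $ j" using eq[OF xy(1)] by (simp add: add_eq_0_iff)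
    have "w = w $ j *s u"
      using u wi wk by (intro vec_eq_distinctI[OF ijk]) auto
    then show "p = q" unfolding q_def w_def by (rule p2_eq_abs)
  qed
  then have "(\<Inter>n\<in>I. zero_locus (T n)) = {q}" using q xy by (auto simp: zero_locus_def)
  moreover have "inj_on (\<lambda>n. zero_locus (T n)) I"
  proof (rule inj_onI)
    fix a b assume ab: "a \<in> I" "b \<in> I" "zero_locus (T a) = zero_locus (T b)"
    \<comment> \<open>The point of the line \<open>T a\<close> on the side \<open>w $ j = 0\<close>,
      from which \<open>m a\<close> can be read off.\<close>
    define h :: "complex ^ 3" where "h = (\<chi> x. if x = i then - m a else if x = k then 1 else 0)"
    have h: "h $ i = - m a" "h $ j = 0" "h $ k = 1" using ijk by (auto simp: h_def)
    then have "h \<noteq> 0" by auto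
    have "abs_p2 h \<in> zero_locus (T a)"
      using eval_at_abs_p2[OF T[OF ab(1)] \<open>h \<noteq> 0\<close>] by (simp add: zero_locus_def ev ab h)
    then have "eval3 (T b) h = 0"
      unfolding ab(3) using eval_at_abs_p2[OF T[OF ab(2)] \<open>h \<noteq> 0\<close>] by (simp add: zero_locus_def)
    then have "m a = m b" using ev[OF ab(2), of h] c[OF ab(2)] by (simp add: h)
    then show "a = b" using m ab by (auto dest: inj_onD)
  qed
  moreover have "point_mult (\<Prod>n\<in>I. T n) q = card I"
  proof (rule point_mult_prod[where a = i])
    fix n assume n: "n \<in> I"
    show "eval_at (partial i (T n)) q \<noteq> 0"
      unfolding eval_at_def eval3_partial_linear[OF T[OF n]] ev[OF n] using c[OF n] ijk
      by (simp add: axis_def)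
  qed (use I q in auto)
  ultimately show ?thesis by (auto simp: fold_point_of_union_def)
qed

text \<open>The conics arise from one conic by scaling coordinate \<open>k\<close>. At a common
  point \<open>1 / m n\<close> satisfies a quadratic equation independent of \<open>n\<close>; three
  values force \<open>Z = 0\<close> and the binary form in \<open>X\<close>, \<open>Y\<close> to
  vanish. \<open>disc\<close> keeps its two roots apart and the derivatives in direction
  \<open>i\<close> nonzero, and \<open>b\<close> keeps the conics distinct.\<close>

lemma conics_two_points:
  fixes Q :: "nat \<Rightarrow> tpoly" and a b1 b2 q1 q2 q3 r :: complex
  assumes ijk: "i \<noteq> j" "i \<noteq> k" "j \<noteq> k" and I: "finite I" "card I \<ge> 3"
    and Q: "\<And>n. n \<in> I \<Longrightarrow> homogeneous 2 (Q n)"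
    and \<Phi>: "\<And>X Y Z. \<Phi> X Y Z = a * Z^2 + (b1 * X + b2 * Y) * Z + (q1 * X^2 + q2 * X * Y + q3 * Y^2)"
    and ev: "\<And>n w. n \<in> I \<Longrightarrow> eval3 (Q n) w = c n * \<Phi> (w $ i) (w $ j / r) (w $ k / m n)"
    and c: "\<And>n. n \<in> I \<Longrightarrow> c n \<noteq> 0" and m: "inj_on m I" "\<And>n. n \<in> I \<Longrightarrow> m n \<noteq> 0" and r: "r \<noteq> 0"
    and a: "a \<noteq> 0" and b: "b1 \<noteq> 0 \<or> b2 \<noteq> 0" and q1: "q1 \<noteq> 0" and disc: "q2^2 \<noteq> 4 * q1 * q3"
  shows "\<exists>p1 p2. p1 \<noteq> p2 \<and> (\<Inter>n\<in>I. zero_locus (Q n)) = {p1, p2} \<and>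
    fold_point_of_union (card I) I Q p1 \<and> fold_point_of_union (card I) I Q p2"
proof -
  define s where "s = csqrt (q2^2 - 4 * q1 * q3)"
  have s: "s^2 = q2^2 - 4 * q1 * q3" "s \<noteq> 0" using disc by (auto simp: s_def)
  define t1 t2 where t_def: "t1 = (- q2 + s) / (2 * q1)" "t2 = (- q2 - s) / (2 * q1)"
  have t: "2 * q1 * t1 + q2 = s" "2 * q1 * t2 + q2 = - s" using q1 by (simp_all add: t_def)
  have t': "2 * q1 * t1 = s - q2" "2 * q1 * t2 = - s - q2" using q1 by (simp_all add: t_def)
  have t12: "t1 \<noteq> t2"
  proof
    assume "t1 = t2"
    with t' have "s - q2 = - s - q2" by metis
    with s(2) show False by simp
  qed
  have factor: "4 * q1 * (q1 * X^2 + q2 * X * Y + q3 * Y^2) = (2 * q1 * (X - t1 * Y)) * (2 * q1 * (X - t2 * Y))" for X Y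
  proof -
    have "(2 * q1 * (X - t1 * Y)) * (2 * q1 * (X - t2 * Y))
        = (2 * q1 * X - (2 * q1 * t1) * Y) * (2 * q1 * X - (2 * q1 * t2) * Y)" by algebra
    also have "\<dots> = (2 * q1 * X - (s - q2) * Y) * (2 * q1 * X - (- s - q2) * Y)"
      unfolding t' ..
    also have "\<dots> = 4 * q1^2 * X^2 + 4 * q1 * q2 * X * Y + (q2^2 - s^2) * Y^2" by algebra
    also have "\<dots> = 4 * q1 * (q1 * X^2 + q2 * X * Y + q3 * Y^2)" unfolding s(1) by algebra
    finally show ?thesis ..
  qed
  have root: "q1 * t^2 + q2 * t + q3 = 0" if "t = t1 \<or> t = t2" for t
    using factor[of t 1] that q1 by auto
  have split: "X = t1 * Y \<or> X = t2 * Y" if "q1 * X^2 + q2 * X * Y + q3 * Y^2 = 0" for X Y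
    using factor[of X Y] that q1 by auto
  define u :: "complex \<Rightarrow> complex \<Rightarrow> complex ^ 3" where
    "u t z = (\<chi> a. if a = i then t else if a = j then r else z)" for t z
  have u: "u t z $ i = t" "u t z $ j = r" "u t z $ k = z" for t z using ijk by (auto simp: u_def)
  have u0: "u t z \<noteq> 0" for t z using u(2)[of t z] r by auto
  define p where "p t = abs_p2 (u t 0)" for t
  have on: "eval_at (Q n) (p t) = 0" if "n \<in> I" "t = t1 \<or> t = t2" for n t
    using eval_at_abs_p2[OF Q[OF that(1)] u0] root[OF that(2)] r
    by (simp add: p_def ev[OF that(1)] u \<Phi>)
  have "p t1 \<noteq> p t2"
  proof
    assume eq: "p t1 = p t2"
    obtain e1 where e1: "e1 \<noteq> 0" "rep_p2 (p t1) = e1 *s u t1 0" using abs_p2_rep[OF u0] unfolding p_def by blast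
    obtain e2 where e2: "e2 \<noteq> 0" "rep_p2 (p t2) = e2 *s u t2 0" using abs_p2_rep[OF u0] unfolding p_def by blast
    have *: "e1 *s u t1 0 = e2 *s u t2 0" using e1 e2 eq by simp
    from arg_cong[OF *, of "\<lambda>v. v $ j"] arg_cong[OF *, of "\<lambda>v. v $ i"] have "e1 = e2" "e1 * t1 = e2 * t2"
      using r by (simp_all add: u)
    then show False using e1 t12 by simp
  qed
  moreover have "(\<Inter>n\<in>I. zero_locus (Q n)) = {p t1, p t2}"
  proof
    show "{p t1, p t2} \<subseteq> (\<Inter>n\<in>I. zero_locus (Q n))" using on by (auto simp: zero_locus_def)
    obtain A where A: "A \<subseteq> I" "card A = 3" using I(2) obtain_subset_with_card_n by metis
    then obtain x y z where "A = {x, y, z}" and xyz: "x \<noteq> y" "x \<noteq> z" "y \<noteq> z"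
      unfolding card_3_iff by blast
    with A have xyzI: "x \<in> I" "y \<in> I" "z \<in> I" by auto
    show "(\<Inter>n\<in>I. zero_locus (Q n)) \<subseteq> {p t1, p t2}"
    proof
      fix g assume g: "g \<in> (\<Inter>n\<in>I. zero_locus (Q n))"
      define w where "w = rep_p2 g"
      define X Y Z where XYZ: "X = w $ i" "Y = w $ j / r" "Z = w $ k"
      have eq: "(a * Z^2) * (1 / m n)^2 + ((b1 * X + b2 * Y) * Z) * (1 / m n) + (q1 * X^2 + q2 * X * Y + q3 * Y^2) = 0"
        if "n \<in> I" for n
      proof -
        have "eval3 (Q n) w = 0" using g that by (auto simp: zero_locus_def eval_at_def w_def)
        then have "\<Phi> X Y (Z / m n) = 0" using ev[OF that, of w] c[OF that] by (simp add: XYZ)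
        then show ?thesis unfolding \<Phi> by (simp add: power_divide)
      qed
      have "1 / m x \<noteq> 1 / m y" "1 / m x \<noteq> 1 / m z" "1 / m y \<noteq> 1 / m z"
        using m(1) xyz xyzI by (auto dest: inj_onD)
      from quadratic_three_roots[OF eq[OF xyzI(1)] eq[OF xyzI(2)] eq[OF xyzI(3)] this]
      have "a * Z^2 = 0" "q1 * X^2 + q2 * X * Y + q3 * Y^2 = 0" by auto
      then have Z: "Z = 0" and "X = t1 * Y \<or> X = t2 * Y" using a split by auto
      then obtain t where t: "t = t1 \<or> t = t2" "X = t * Y" by blast
      have "w = Y *s u t 0"
        using t(2) Z r by (intro vec_eq_distinctI[OF ijk]) (simp_all add: u XYZ)
      then have "g = p t" unfolding w_def p_def by (rule p2_eq_abs)
      then show "g \<in> {p t1, p t2}" using t(1) by auto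
    qed
  qed
  moreover have inj: "inj_on (\<lambda>n. zero_locus (Q n)) I"
  proof (rule inj_onI)
    fix x y assume xy: "x \<in> I" "y \<in> I" "zero_locus (Q x) = zero_locus (Q y)"
    \<comment> \<open>A linear form that vanished at both roots would be zero. At a suitable root
      the line \<open>X = t * Y\<close> meets the conic in a second point with
      \<open>Z \<noteq> 0\<close>.\<close>
    have "\<exists>t. (t = t1 \<or> t = t2) \<and> b1 * t + b2 \<noteq> 0"
    proof (rule ccontr)
      assume "\<nexists>t. (t = t1 \<or> t = t2) \<and> b1 * t + b2 \<noteq> 0"
      then have *: "b1 * t1 + b2 = 0" "b1 * t2 + b2 = 0" by auto
      have "b1 * (t1 - t2) = (b1 * t1 + b2) - (b1 * t2 + b2)" by algebra
      then have "b1 = 0" unfolding * using t12 by simp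
      then show False using * b by simp
    qed
    then obtain t where t: "t = t1 \<or> t = t2" "b1 * t + b2 \<noteq> 0" by blast
    define B where "B = b1 * t + b2"
    have B: "B \<noteq> 0" using t(2) by (simp add: B_def)
    \<comment> \<open>That second point, which lies at \<open>Z = - B / a\<close> before scaling by
      \<open>m x\<close>. It determines \<open>m x\<close>.\<close>
    define h where "h = u t (- B * m x / a)"
    have val: "\<Phi> t 1 z = z * (a * z + B)" for z
      using root[OF t(1)] by (simp add: \<Phi> B_def power2_eq_square algebra_simps)
    have evh: "eval3 (Q n) h = c n * \<Phi> t 1 (- B * m x / a / m n)" if "n \<in> I" for n
      using ev[OF that, of h] r by (simp add: h_def u)
    have "eval3 (Q x) h = 0"
      unfolding evh[OF xy(1)] val using a m(2)[OF xy(1)] by simp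
    then have "abs_p2 h \<in> zero_locus (Q x)"
      using eval_at_abs_p2[OF Q[OF xy(1)], of h] u0 by (simp add: zero_locus_def h_def)
    then have "eval3 (Q y) h = 0"
      unfolding xy(3) using eval_at_abs_p2[OF Q[OF xy(2)], of h] u0 by (simp add: zero_locus_def h_def)
    then have "(- B * m x / a / m y) * (a * (- B * m x / a / m y) + B) = 0"
      using evh[OF xy(2)] c[OF xy(2)] by (simp add: val)
    moreover have "- B * m x / a / m y \<noteq> 0" using B a m(2) xy by simp
    ultimately have "a * (- B * m x / a / m y) + B = 0" by (metis mult_eq_0_iff)
    moreover have "a * (- B * m x / a / m y) + B = B * (1 - m x / m y)"
      using a by (simp add: algebra_simps)
    ultimately have "m x / m y = 1" using B by simp
    then have "m x = m y" using m(2)[OF xy(2)] by simp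
    then show "x = y" using m(1) xy by (auto dest: inj_onD)
  qed
  moreover have "fold_point_of_union (card I) I Q (p t)" if t: "t = t1 \<or> t = t2" for t
  proof -
    obtain e where e: "e \<noteq> 0" "rep_p2 (p t) = e *s u t 0" using abs_p2_rep[OF u0] unfolding p_def by blast
    have "point_mult (\<Prod>n\<in>I. Q n) (p t) = card I"
    proof (rule point_mult_prod[where a = i])
      fix n assume n: "n \<in> I"
      show "eval_at (Q n) (p t) = 0" using on n t by blast
      have ax: "axis i 1 $ i = (1::complex)" "axis i 1 $ j = (0::complex)" "axis i 1 $ k = (0::complex)"
        using ijk by (auto simp: axis_def)
      have "eval_at (partial i (Q n)) (p t) = c n * ((\<Phi> (e * t + 1) e 0 - \<Phi> (e * t - 1) e 0) / 2)"
        unfolding eval_at_def eval3_partial_quadratic[OF Q[OF n]] ev[OF n] e(2) using r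
        by (simp add: u ax algebra_simps)
      also have "(\<Phi> (e * t + 1) e 0 - \<Phi> (e * t - 1) e 0) / 2 = e * (2 * q1 * t + q2)"
        unfolding \<Phi> by (simp add: field_simps power2_eq_square)
      finally show "eval_at (partial i (Q n)) (p t) \<noteq> 0"
        using c[OF n] e(1) s(2) t \<open>2 * q1 * t1 + q2 = s\<close> \<open>2 * q1 * t2 + q2 = - s\<close> by auto
    qed (use I in auto)
    then show ?thesis using inj by (simp add: fold_point_of_union_def)
  qed
  ultimately show ?thesis by blast
qed

section \<open>Lines through sextactic points\<close>

lemma cmod_root_of_unity:
  assumes "u ^ d = 1" "d > 0"
  shows "cmod u = 1"
proof -
  have "cmod u ^ d = 1 ^ d" using assms(1) by (simp flip: norm_power)
  then show ?thesis by (rule power_eq_imp_eq_base) (use assms in auto)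
qed

lemma cnj_eq_divide: "t \<noteq> 0 \<Longrightarrow> cnj t = of_real ((cmod t)^2) / t"
  unfolding complex_norm_square by simp

lemma cmod_root_minus_2:
  assumes "w ^ d = -2" "R ^ d = 4" "R > 0" "d > 0"
  shows "(cmod w)^2 = R"
proof -
  have "((cmod w)^2) ^ d = (cmod w ^ d)^2" by (simp only: power_mult[symmetric] mult.commute)
  also have "cmod w ^ d = 2" using arg_cong[OF assms(1), of cmod] by (simp add: norm_power)
  finally have "((cmod w)^2) ^ d = R ^ d" using assms(2) by simp
  then show ?thesis by (rule power_eq_imp_eq_base) (use assms in auto)
qed

text \<open>The squared lengths of the sides and diagonals of the regular d-gon inscribed in the
  unit circle.\<close>

definition unit_norms :: "nat \<Rightarrow> real set" where
  "unit_norms d = {(cmod (1 - t))^2 | t. t ^ d = 1 \<and> t \<noteq> 1}"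

lemma unit_normsI: "t ^ d = 1 \<Longrightarrow> t \<noteq> 1 \<Longrightarrow> (cmod (1 - t))^2 \<in> unit_norms d"
  by (auto simp: unit_norms_def)

lemma unit_norms_cases:
  assumes N: "N \<in> unit_norms d" and d: "d > 0"
  obtains t where "t ^ d = 1" "t \<noteq> 1" "t \<noteq> 0" "complex_of_real N = 2 - t - 1 / t"
proof -
  obtain t where t: "t ^ d = 1" "t \<noteq> 1" "N = (cmod (1 - t))^2"
    using N by (auto simp: unit_norms_def)
  have "cmod t = 1" using t(1) d by (rule cmod_root_of_unity)
  then have t0: "t \<noteq> 0" by auto
  then have cnj: "cnj t = 1 / t" using \<open>cmod t = 1\<close> by (simp add: cnj_eq_divide)
  have "complex_of_real N = (1 - t) * (1 - 1 / t)"
    using complex_norm_square[of "1 - t"] by (simp add: t(3) cnj)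
  also have "\<dots> = 2 - t - 1 / t" using t0 by (simp add: field_simps)
  finally show ?thesis using that t t0 by blast
qed

lemma unit_norms_pos: "N \<in> unit_norms d \<Longrightarrow> N > 0"
  by (auto simp: unit_norms_def)

lemma unit_norms_4: "N \<in> unit_norms 4 \<Longrightarrow> N = 2 \<or> N = 4"
proof -
  assume "N \<in> unit_norms 4"
  then obtain t where t: "t ^ 4 = 1" "t \<noteq> 1" "t \<noteq> 0" "complex_of_real N = 2 - t - 1 / t"
    by (rule unit_norms_cases) simp
  have "(t - 1) * (t + 1) * (t^2 + 1) = 0" using t(1) by algebra
  then consider "t = -1" | "t^2 + 1 = 0"
    using t(2) by (auto simp: eq_neg_iff_add_eq_0)
  then show ?thesis
  proof cases
    case 1
    then have "complex_of_real N = of_real 4" using t by simp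
    then show ?thesis by (subst (asm) of_real_eq_iff) simp
  next
    case 2
    then have "1 / t = - t" using t(3) by (simp add: field_simps power2_eq_square eq_neg_iff_add_eq_0)
    then have "complex_of_real N = of_real 2" using t(4) by simp
    then show ?thesis by (subst (asm) of_real_eq_iff) simp
  qed
qed

lemma unit_norms_6: "N \<in> unit_norms 6 \<Longrightarrow> N = 1 \<or> N = 3 \<or> N = 4"
proof -
  assume "N \<in> unit_norms 6"
  then obtain t where t: "t ^ 6 = 1" "t \<noteq> 1" "t \<noteq> 0" "complex_of_real N = 2 - t - 1 / t"
    by (rule unit_norms_cases) simp
  have "(t - 1) * (t + 1) * (t^2 + t + 1) * (t^2 - t + 1) = 0" using t(1) by algebra
  then consider "t = -1" | "t^2 + t + 1 = 0" | "t^2 - t + 1 = 0"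
    using t(2) by (auto simp: eq_neg_iff_add_eq_0)
  then show ?thesis
  proof cases
    case 1
    then have "complex_of_real N = of_real 4" using t by simp
    then show ?thesis by (subst (asm) of_real_eq_iff) simp
  next
    case 2
    then have "t * (- (t + 1)) = 1" by algebra
    then have "1 / t = - (t + 1)" using t(3) by (metis nonzero_mult_div_cancel_left)
    then have "complex_of_real N = of_real 3" using t(4) by simp
    then show ?thesis by (subst (asm) of_real_eq_iff) simp
  next
    case 3
    then have "t * (1 - t) = 1" by algebra
    then have "1 / t = 1 - t" using t(3) by (metis nonzero_mult_div_cancel_left)
    then have "complex_of_real N = of_real 1" using t(4) by simp
    then show ?thesis by (subst (asm) of_real_eq_iff) simp
  qed
qed

lemma unit_norms_5: "N \<in> unit_norms 5 \<Longrightarrow> N^2 - 5 * N + 5 = 0"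
proof -
  assume "N \<in> unit_norms 5"
  then obtain t where t: "t ^ 5 = 1" "t \<noteq> 1" "t \<noteq> 0" "complex_of_real N = 2 - t - 1 / t"
    by (rule unit_norms_cases) simp
  have "(t - 1) * (t^4 + t^3 + t^2 + t + 1) = 0" using t(1) by algebra
  then have s: "t^4 + t^3 + t^2 + t + 1 = 0" using t(2) by simp
  define n where "n = complex_of_real N"
  have "n * t = 2 * t - t^2 - 1"
    unfolding n_def t(4) using t(3) by (simp add: field_simps power2_eq_square)
  \<comment> \<open>Since \<open>n * t = - (t - 1)^2\<close>, the left-hand side becomes the fifth
    cyclotomic polynomial in \<open>t\<close>.\<close>
  then have "t^2 * (n^2 - 5 * n + 5) = (2 * t - t^2 - 1)^2 - 5 * t * (2 * t - t^2 - 1) + 5 * t^2"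
    by algebra
  also have "\<dots> = t^4 + t^3 + t^2 + t + 1" by algebra
  finally have "n^2 - 5 * n + 5 = 0" using s t(3) by simp
  then have "complex_of_real (N^2 - 5 * N + 5) = of_real 0" by (simp add: n_def)
  then show ?thesis by (subst (asm) of_real_eq_iff) simp
qed

text \<open>
  Normalise the two points to \<open>(1, \<zeta>\<^sub>i, \<alpha>\<^sub>i)\<close>, where \<open>\<zeta>\<^sub>i\<^sup>d = 1\<close> and \<open>\<alpha>\<^sub>i\<^sup>d = -2\<close>. The line is their cross
  product, so the moduli of its coefficients are differences of roots of unity, up to the factor \<open>R = \<bar>\<alpha>\<^sub>i\<bar>\<^sup>2\<close>.
\<close>

lemma line_through_pair:
  fixes a b c x1 y1 z1 x2 y2 z2 :: complex and R :: real
  assumes d: "d > 0" and R: "R > 0" "R ^ d = 4"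
    and abc: "a \<noteq> 0" "b \<noteq> 0" "c \<noteq> 0"
    and x: "x1 \<noteq> 0" "x2 \<noteq> 0"
    and p1: "a * x1 + b * y1 + c * z1 = 0" "y1 ^ d = x1 ^ d" "z1 ^ d = - 2 * x1 ^ d"
    and p2: "a * x2 + b * y2 + c * z2 = 0" "y2 ^ d = x2 ^ d" "z2 ^ d = - 2 * x2 ^ d"
    and distinct: "\<And>t. \<not> (x2 = t * x1 \<and> y2 = t * y1 \<and> z2 = t * z1)"
  obtains k Na Nb Nc where "k > 0" "Na \<in> unit_norms d" "Nb \<in> unit_norms d" "Nc \<in> unit_norms d"
    "(cmod a)^2 = k * R * Na" "(cmod b)^2 = k * R * Nb" "(cmod c)^2 = k * Nc"
    "(b * cnj c) ^ d = (cnj b * c) ^ d"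
proof -
  define u1 u2 w1 w2 where u_def: "u1 = y1 / x1" "u2 = y2 / x2" and w_def: "w1 = z1 / x1" "w2 = z2 / x2"
  have eq: "a + b * u1 + c * w1 = 0" "a + b * u2 + c * w2 = 0"
  proof -
    have "a + b * u1 + c * w1 = (a * x1 + b * y1 + c * z1) / x1"
      "a + b * u2 + c * w2 = (a * x2 + b * y2 + c * z2) / x2"
      using x by (simp_all add: u_def w_def add_divide_distrib)
    then show "a + b * u1 + c * w1 = 0" "a + b * u2 + c * w2 = 0"
      unfolding p1(1) p2(1) by simp_all
  qed
  have ud: "u1 ^ d = 1" "u2 ^ d = 1" and wd: "w1 ^ d = -2" "w2 ^ d = -2"
    using p1 p2 x by (simp_all add: u_def w_def power_divide)
  note cmod_u = cmod_root_of_unity[OF _ d]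
  note cmod_w = cmod_root_minus_2[OF _ R(2,1) d]
  note un = cmod_u[OF ud(1)] cmod_u[OF ud(2)] and wn = cmod_w[OF wd(1)] cmod_w[OF wd(2)]
  have nz: "u1 \<noteq> 0" "u2 \<noteq> 0" "w1 \<noteq> 0" "w2 \<noteq> 0" using un wn R by auto
  have diff: "b * (u1 - u2) = c * (w2 - w1)" using eq by algebra
  have "u1 \<noteq> u2"
  proof
    assume "u1 = u2"
    with diff abc have "w1 = w2" by simp
    moreover have "y1 = u1 * x1" "y2 = u2 * x2" "z1 = w1 * x1" "z2 = w2 * x2"
      using x by (simp_all add: u_def w_def)
    ultimately have "x2 = (x2 / x1) * x1 \<and> y2 = (x2 / x1) * y1 \<and> z2 = (x2 / x1) * z1"
      using \<open>u1 = u2\<close> x by simp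
    with distinct show False by blast
  qed
  define m where "m = c / (u2 - u1)"
  have c: "c = m * (u2 - u1)" using \<open>u1 \<noteq> u2\<close> by (simp add: m_def)
  have "(u2 - u1) * b = (u2 - u1) * (m * (w1 - w2))" using diff c by algebra
  then have b: "b = m * (w1 - w2)" using \<open>u1 \<noteq> u2\<close> by simp
  have a: "a = m * (u1 * w2 - u2 * w1)" using eq(1) b c by algebra
  have m0: "m \<noteq> 0" using c abc by auto
  have sq: "(cmod (x - y))^2 = (cmod x)^2 * (cmod (1 - y / x))^2" if "x \<noteq> 0" for x y
  proof -
    have "x - y = x * (1 - y / x)" using that by (simp add: right_diff_distrib)
    then show ?thesis by (simp only: norm_mult power_mult_distrib)
  qed
  show ?thesis
  proof (rule that[of "(cmod m)^2" "(cmod (1 - (u2 * w1) / (u1 * w2)))^2" "(cmod (1 - w2 / w1))^2" "(cmod (1 - u1 / u2))^2"])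
    show "(cmod m)^2 > 0" using m0 by simp
    show "(cmod (1 - (u2 * w1) / (u1 * w2)))^2 \<in> unit_norms d"
    proof (rule unit_normsI)
      show "((u2 * w1) / (u1 * w2)) ^ d = 1" by (simp add: power_divide power_mult_distrib ud wd)
      show "(u2 * w1) / (u1 * w2) \<noteq> 1" using a abc nz by auto
    qed
    show "(cmod (1 - w2 / w1))^2 \<in> unit_norms d"
    proof (rule unit_normsI)
      show "(w2 / w1) ^ d = 1" by (simp add: power_divide wd)
      show "w2 / w1 \<noteq> 1" using b abc nz by auto
    qed
    show "(cmod (1 - u1 / u2))^2 \<in> unit_norms d"
    proof (rule unit_normsI)
      show "(u1 / u2) ^ d = 1" by (simp add: power_divide ud)
      show "u1 / u2 \<noteq> 1" using \<open>u1 \<noteq> u2\<close> nz by auto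
    qed
    have "(cmod a)^2 = (cmod m)^2 * (cmod (u1 * w2 - u2 * w1))^2"
      unfolding a by (simp add: norm_mult power_mult_distrib)
    also have "(cmod (u1 * w2 - u2 * w1))^2 = R * (cmod (1 - (u2 * w1) / (u1 * w2)))^2"
      using nz by (subst sq) (auto simp: norm_mult power_mult_distrib un wn)
    finally show "(cmod a)^2 = (cmod m)^2 * R * (cmod (1 - (u2 * w1) / (u1 * w2)))^2" by simp
    have "(cmod b)^2 = (cmod m)^2 * (cmod (w1 - w2))^2"
      unfolding b by (simp add: norm_mult power_mult_distrib)
    also have "(cmod (w1 - w2))^2 = R * (cmod (1 - w2 / w1))^2"
      using nz by (subst sq) (auto simp: wn)
    finally show "(cmod b)^2 = (cmod m)^2 * R * (cmod (1 - w2 / w1))^2" by simp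
    have "(cmod c)^2 = (cmod m)^2 * (cmod (u2 - u1))^2"
      unfolding c by (simp add: norm_mult power_mult_distrib)
    also have "(cmod (u2 - u1))^2 = (cmod (1 - u1 / u2))^2"
      using nz by (subst sq) (auto simp: un)
    finally show "(cmod c)^2 = (cmod m)^2 * (cmod (1 - u1 / u2))^2" .
    have cu: "cnj u1 = 1 / u1" "cnj u2 = 1 / u2" "cnj w1 = R / w1" "cnj w2 = R / w2"
      using cnj_eq_divide[of u1] cnj_eq_divide[of u2] cnj_eq_divide[of w1] cnj_eq_divide[of w2] nz un wn
      by simp_all
    \<comment> \<open>\<open>b * cnj c\<close> and its conjugate differ only in a last factor, whose
      d-th power is 1 in both cases. So the d-th power of \<open>b * cnj c\<close> is real, which
      restricts its argument to multiples of pi / d.\<close>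
    have bc: "b * cnj c = m * cnj m * (w1 - w2) * (u1 - u2) * (1 / (u1 * u2))"
    proof -
      have "1 / u2 - 1 / u1 = (u1 - u2) * (1 / (u1 * u2))" using nz by (simp add: field_simps)
      then show ?thesis unfolding b c by (simp add: cu)
    qed
    have cb: "cnj b * c = m * cnj m * (w1 - w2) * (u1 - u2) * (R / (w1 * w2))"
    proof -
      have "R / w1 - R / w2 = (w2 - w1) * (R / (w1 * w2))" using nz by (simp add: field_simps)
      then have "cnj b * c = cnj m * ((w2 - w1) * (R / (w1 * w2))) * (m * (u2 - u1))"
        unfolding b c by (simp add: cu)
      also have "\<dots> = m * cnj m * (w1 - w2) * (u1 - u2) * (R / (w1 * w2))" by algebra
      finally show ?thesis .
    qed
    have "complex_of_real R ^ d = 4" using R(2) by (metis of_real_numeral of_real_power)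
    then have "(1 / (u1 * u2)) ^ d = (R / (w1 * w2)) ^ d"
      by (simp add: power_divide power_mult_distrib ud wd)
    then show "(b * cnj c) ^ d = (cnj b * c) ^ d"
      unfolding bc cb power_mult_distrib[of _ "1 / (u1 * u2)"] power_mult_distrib[of _ "R / (w1 * w2)"] by simp
  qed
qed

text \<open>With \<open>cnj u = 1 / u\<close> on the unit circle, the condition |a + b u| = |c| R is
  a quadratic equation for \<open>u\<close> with leading coefficient \<open>cnj a * b\<close>.
  Points with the same \<open>u\<close> coincide, since the line determines
  \<open>w\<close>.\<close>

lemma not_three_points:
  fixes a b c :: complex and x y z :: "nat \<Rightarrow> complex"
  assumes d: "d > 0" and abc: "a \<noteq> 0" "b \<noteq> 0" "c \<noteq> 0"
    and x: "\<And>n. n \<in> A \<Longrightarrow> x n \<noteq> 0"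
    and p: "\<And>n. n \<in> A \<Longrightarrow> a * x n + b * y n + c * z n = 0" "\<And>n. n \<in> A \<Longrightarrow> y n ^ d = x n ^ d"
      "\<And>n. n \<in> A \<Longrightarrow> z n ^ d = - 2 * x n ^ d"
    and distinct: "\<And>t m n. m \<in> A \<Longrightarrow> n \<in> A \<Longrightarrow> m \<noteq> n \<Longrightarrow> \<not> (x n = t * x m \<and> y n = t * y m \<and> z n = t * z m)"
    and A: "{m, n, l} \<subseteq> A" "m \<noteq> n" "m \<noteq> l" "n \<noteq> l"
  shows False
proof -
  define u where "u n = y n / x n" for n
  define w where "w n = z n / x n" for n
  define R where "R = cmod (w m)"
  have eq: "c * w n = - (a + b * u n)" if "n \<in> A" for n
  proof -
    have "c * w n + (a + b * u n) = (a * x n + b * y n + c * z n) / x n"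
      using x[OF that] by (simp add: u_def w_def add_divide_distrib)
    then show ?thesis using p(1)[OF that] by (simp add: add_eq_0_iff)
  qed
  have ud: "u n ^ d = 1" and wd: "w n ^ d = -2" if "n \<in> A" for n
    using p(2,3)[OF that] x[OF that] by (simp_all add: u_def w_def power_divide)
  have u1: "cmod (u n) = 1" if "n \<in> A" for n
    using ud[OF that] d by (rule cmod_root_of_unity)
  have wR: "cmod (w n) = R" if "n \<in> A" for n
  proof -
    have "cmod (w n) ^ d = R ^ d" using wd[OF that] wd[of m] A by (simp add: R_def flip: norm_power)
    then show ?thesis by (rule power_eq_imp_eq_base) (use d in \<open>auto simp: R_def\<close>)
  qed
  define T where "T = complex_of_real ((cmod c * R)^2)"
  define B where "B = a * cnj a + b * cnj b - T"
  have quad: "cnj a * b * u n ^ 2 + B * u n + a * cnj b = 0" if "n \<in> A" for n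
  proof -
    define U V where UV: "U = u n" "V = cnj (u n)"
    have cu: "V * U = 1"
      using complex_norm_square[of "u n"] u1[OF that] by (simp add: mult.commute UV)
    have "cmod (a + b * u n) = cmod (c * w n)"
      unfolding eq[OF that] norm_minus_cancel ..
    then have "cmod (a + b * u n) = cmod c * R" by (simp add: norm_mult wR[OF that])
    then have "T = (a + b * u n) * cnj (a + b * u n)"
      unfolding T_def complex_norm_square[symmetric] by simp
    then have "U * ((a + b * U) * (cnj a + cnj b * V) - T) = 0" by (simp add: UV)
    also have "U * ((a + b * U) * (cnj a + cnj b * V) - T)
        = cnj a * b * U^2 + (a * cnj a + (V * U) * b * cnj b - T) * U + a * cnj b * (V * U)"
      by algebra
    finally show ?thesis unfolding cu by (simp add: B_def UV)
  qed
  have inj: "u i \<noteq> u j" if "i \<in> A" "j \<in> A" "i \<noteq> j" for i j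
  proof
    assume uu: "u i = u j"
    have "c * w i = c * w j" unfolding eq[OF that(1)] eq[OF that(2)] uu ..
    then have "w i = w j" using abc by simp
    moreover have "y i = u i * x i" "y j = u j * x j" "z i = w i * x i" "z j = w j * x j"
      using x that by (simp_all add: u_def w_def)
    ultimately have "x j = (x j / x i) * x i \<and> y j = (x j / x i) * y i \<and> z j = (x j / x i) * z i"
      using uu x[OF that(1)] by simp
    with distinct that show False by blast
  qed
  define e f g where efg: "e = u m" "f = u n" "g = u l"
  define K where "K = cnj a * b"
  define C where "C = a * cnj b"
  have q: "K * e^2 + B * e + C = 0" "K * f^2 + B * f + C = 0" "K * g^2 + B * g + C = 0"
    using quad A by (auto simp: efg K_def C_def)
  have ne: "e - f \<noteq> 0" "e - g \<noteq> 0" "f - g \<noteq> 0" using inj A by (auto simp: efg)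
  have "K = 0" using quadratic_three_roots(1)[OF q] ne by simp
  then show False using abc by (simp add: K_def)
qed

text \<open>For \<open>d = 6\<close> the norms are 1, 3, 4 and \<open>R ^ 3 = 2\<close>, which would
  make the cube root of 2 rational. For \<open>d = 5\<close> the norms are (5 - sqrt 5)/2 and (5 +
  sqrt 5)/2; distinct products of two of them differ by a factor above 2, whereas 1 < R < 2.\<close>

lemma unit_norms_ratio:
  assumes d: "d = 5 \<or> d = 6" and R: "R > 0" "R ^ d = 4"
    and N: "N1 \<in> unit_norms d" "N2 \<in> unit_norms d" "N3 \<in> unit_norms d" "N4 \<in> unit_norms d"
  shows "R * N1 * N2 \<noteq> N3 * N4"
proof
  assume eq: "R * N1 * N2 = N3 * N4"
  show False
  proof (cases "d = 6")
    case True
    have "(R ^ 3 - 2) * (R ^ 3 + 2) = R ^ 6 - 4" by algebra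
    then have "(R ^ 3 - 2) * (R ^ 3 + 2) = 0" using R(2) True by simp
    then have "R ^ 3 = 2" using zero_less_power[OF R(1), of 3] by auto
    then have "2 * (N1 * N2) ^ 3 = (N3 * N4) ^ 3"
      unfolding eq[symmetric] by (simp add: power_mult_distrib)
    then show False
      using N[THEN unit_norms_6[unfolded True[symmetric]]] by (elim disjE) simp_all
  next
    case False
    with d have d5: "d = 5" by simp
    have R12: "1 < R" "R < 2"
    proof -
      show "1 < R" using R power_le_one[of R 5] by (force simp: d5 not_less[symmetric])
      show "R < 2" using R power_mono[of 2 R 5] by (force simp: d5 not_less[symmetric])
    qed
    define n1 :: real where "n1 = (5 - sqrt 5) / 2"
    define n2 :: real where "n2 = (5 + sqrt 5) / 2"
    have n: "n1 > 0" "n2 > 2 * n1"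
    proof -
      have "sqrt 5 < 3" by (rule real_less_lsqrt) auto
      moreover have "sqrt 5 > 2" by (rule real_less_rsqrt) auto
      ultimately show "n1 > 0" "n2 > 2 * n1" by (auto simp: n1_def n2_def)
    qed
    have cases: "N = n1 \<or> N = n2" if "N \<in> unit_norms d" for N
    proof -
      have "(N - n1) * (N - n2) = N^2 - 5 * N + 5"
        by (simp add: n1_def n2_def field_simps power2_eq_square)
      also have "\<dots> = 0" using unit_norms_5 that d5 by simp
      finally show ?thesis by simp
    qed
    have prod: "N * N' = n1 * n1 \<or> N * N' = n1 * n2 \<or> N * N' = n2 * n2"
      if "N \<in> unit_norms d" "N' \<in> unit_norms d" for N N'
      using cases[OF that(1)] cases[OF that(2)] by (auto simp: mult.commute)
    have ord: "n1 * n1 > 0" "n1 * n2 > 2 * (n1 * n1)" "n2 * n2 > 2 * (n1 * n2)"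
      using n by (auto simp: mult_strict_left_mono mult.left_commute intro!: mult_strict_right_mono)
    define p where "p = N1 * N2"
    define q where "q = N3 * N4"
    have "p > 0" using N unit_norms_pos by (simp add: p_def)
    then have "p < R * p" "R * p < 2 * p" using R12 by auto
    then have "p < q" "q < 2 * p" using eq by (simp_all add: p_def q_def mult.assoc)
    then show False
      using prod[OF N(1,2)] prod[OF N(3,4)] ord unfolding p_def[symmetric] q_def[symmetric] by auto
  qed
qed

text \<open>
  The law of cosines, with \<open>R = \<surd>2\<close>: the squared sides are \<open>2 Na\<close>, \<open>R Nb\<close>, \<open>Nc\<close>, and the angle is a multiple
  of \<open>\<pi>/4\<close>.
\<close>

lemma quartic_pair_and_point:
  fixes a b c x y z :: complex and R :: real
  assumes R: "R > 0" "R ^ 4 = 4" and k: "k > 0"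
    and N: "Na \<in> unit_norms 4" "Nb \<in> unit_norms 4" "Nc \<in> unit_norms 4"
    and abc: "(cmod a)^2 = k * R * Na" "(cmod b)^2 = k * R * Nb" "(cmod c)^2 = k * Nc"
      "(b * cnj c) ^ 4 = (cnj b * c) ^ 4"
    and p: "y \<noteq> 0" "a * x + b * y + c * z = 0" "z ^ 4 = y ^ 4" "x ^ 4 = - 2 * y ^ 4"
  shows False
proof -
  have "(R ^ 2 - 2) * (R ^ 2 + 2) = R ^ 4 - 4" by algebra
  then have "(R ^ 2 - 2) * (R ^ 2 + 2) = 0" using R(2) by simp
  then have R2: "R ^ 2 = 2" using zero_less_power[OF R(1), of 2] by auto
  define u where "u = z / y"
  define w where "w = x / y"
  have u4: "u ^ 4 = 1" and w4: "w ^ 4 = -2"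
    using p by (simp_all add: u_def w_def power_divide)
  have u1: "cmod u = 1" using u4 by (rule cmod_root_of_unity) simp
  have wR: "(cmod w)^2 = R" using w4 R(2,1) by (rule cmod_root_minus_2) simp
  \<comment> \<open>\<open>2 * Re W\<close> is the cross term in the squared modulus of
    \<open>b + c * u\<close>. As \<open>W ^ 4\<close> is real, the argument of \<open>W\<close> is a
    multiple of pi / 4.\<close>
  define W where "W = b * cnj (c * u)"
  have "W ^ 4 = (b * cnj c) ^ 4 * cnj (u ^ 4)" by (simp add: W_def power_mult_distrib)
  also have "\<dots> = (cnj b * c) ^ 4 * u ^ 4" using abc(4) u4 by simp
  also have "\<dots> = cnj (W ^ 4)" by (simp add: W_def power_mult_distrib)
  finally have "Im (W ^ 4) = Im (cnj (W ^ 4))" by (rule arg_cong)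
  then have "Im (W ^ 4) = 0" unfolding cnj.simps by simp
  moreover have "Im (W ^ 4) = 4 * Re W * Im W * ((Re W)^2 - (Im W)^2)"
  proof -
    have "Im (W^2) = 2 * Re W * Im W" "Re (W^2) = (Re W)^2 - (Im W)^2"
      by (simp_all add: power2_eq_square)
    moreover have "Im (W ^ 4) = 2 * Re (W^2) * Im (W^2)"
      by (simp add: power4_eq_xxxx power2_eq_square algebra_simps)
    ultimately show ?thesis by (simp add: mult_ac)
  qed
  ultimately have "Re W = 0 \<or> Im W = 0 \<or> (Re W)^2 = (Im W)^2" by auto
  moreover have W_sq: "(cmod W)^2 = (Re W)^2 + (Im W)^2" by (rule cmod_power2)
  \<comment> \<open>\<open>h\<close> is four times the squared cosine of this argument.\<close>
  ultimately obtain h where h: "h = 0 \<or> h = 2 \<or> h = 4" "(2 * Re W)^2 = h * (cmod W)^2"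
  proof (elim disjE)
    assume "Re W = 0"
    then show thesis by (intro that[of 0]) auto
  next
    assume "Im W = 0"
    then show thesis using W_sq by (intro that[of 4]) (auto simp: power_mult_distrib)
  next
    assume "(Re W)^2 = (Im W)^2"
    then show thesis using W_sq by (intro that[of 2]) (auto simp: power_mult_distrib)
  qed
  have W2: "(cmod W)^2 = k^2 * R * Nb * Nc"
  proof -
    have "(cmod W)^2 = (cmod b)^2 * (cmod c)^2"
      by (simp add: W_def norm_mult u1 power_mult_distrib)
    then show ?thesis unfolding abc by algebra
  qed
  have aw: "a * w = - (b + c * u)"
  proof -
    have "a * w + (b + c * u) = (a * x + b * y + c * z) / y"
      using p(1) by (simp add: u_def w_def add_divide_distrib)
    then show ?thesis by (simp add: p(2) add_eq_0_iff)
  qed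
  have "(cmod (b + c * u))^2 = (cmod b)^2 + (cmod (c * u))^2 + 2 * Re W"
    unfolding W_def cmod_power2 by (simp add: power2_eq_square algebra_simps)
  moreover have "(cmod (b + c * u))^2 = (cmod a)^2 * R"
  proof -
    have "cmod (b + c * u) = cmod (a * w)" unfolding aw norm_minus_cancel ..
    then show ?thesis by (simp add: norm_mult power_mult_distrib wR)
  qed
  ultimately have "2 * Re W = k * R * Na * R - k * R * Nb - k * Nc"
    by (simp add: abc norm_mult u1)
  also have "\<dots> = k * (R^2 * Na - R * Nb - Nc)" by (simp add: algebra_simps power2_eq_square)
  finally have ReW: "2 * Re W = k * (2 * Na - R * Nb - Nc)" unfolding R2 .
  have "k^2 * ((2 * Na - R * Nb - Nc)^2 - h * (R * Nb * Nc)) = 0"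
  proof -
    have "k^2 * ((2 * Na - R * Nb - Nc)^2 - h * (R * Nb * Nc))
        = (k * (2 * Na - R * Nb - Nc))^2 - h * (k^2 * R * Nb * Nc)"
      by algebra
    then show ?thesis using h(2) unfolding ReW W2 by simp
  qed
  then have "(2 * Na - R * Nb - Nc)^2 = h * (R * Nb * Nc)" using k by simp
  moreover have "(2 * Na - R * Nb - Nc)^2 = (2 * Na - Nc)^2 + R^2 * Nb^2 - R * (Nb * (4 * Na - 2 * Nc))"
    by algebra
  ultimately have *: "R * (Nb * (4 * Na - 2 * Nc + h * Nc)) = (2 * Na - Nc)^2 + 2 * Nb^2"
    unfolding R2 by (simp add: algebra_simps)
  \<comment> \<open>Squaring removes \<open>R\<close>. All norms are 2 or 4, so twice the square of
    an integer would be a nonzero integer square.\<close>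
  have "2 * (Nb * (4 * Na - 2 * Nc + h * Nc))^2 = ((2 * Na - Nc)^2 + 2 * Nb^2)^2"
    unfolding *[symmetric] power_mult_distrib[of R] R2 ..
  then show False
    using N[THEN unit_norms_4] h(1) by (elim disjE) simp_all
qed

section \<open>Types of sextactic points and their distribution on a line\<close>

lemma sextactic_point_coordinates:
  assumes d: "d > 3" and p: "sextactic_point (fermat d) p"
  shows "eval_at (fermat d) p = 0" "rep_p2 p $ a \<noteq> 0"
proof -
  show F: "eval_at (fermat d) p = 0" using p by (auto simp: sextactic_point_def zero_locus_def)
  show "rep_p2 p $ a \<noteq> 0"
    using p fermat_inflection_point[OF _ F, of a] d by (auto simp: sextactic_point_def)
qed

text \<open>
  A point of type \<open>k\<close>: its \<open>d\<close>-th powers are proportional to \<open>(1, 1, -2)\<close>, with \<open>-2\<close> in position \<open>k\<close>.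
\<close>

definition point_type :: "nat \<Rightarrow> 3 \<Rightarrow> p2 \<Rightarrow> bool" where
  "point_type d k p \<longleftrightarrow> (\<forall>i j. i \<noteq> k \<longrightarrow> j \<noteq> k \<longrightarrow> i \<noteq> j \<longrightarrow>
     rep_p2 p $ j ^ d = rep_p2 p $ i ^ d \<and> rep_p2 p $ k ^ d = - 2 * rep_p2 p $ i ^ d)"

lemma point_typeI:
  assumes ijk: "i \<noteq> j" "i \<noteq> k" "j \<noteq> k" and F: "eval_at (fermat d) p = 0"
    and eq: "rep_p2 p $ i ^ d = rep_p2 p $ j ^ d"
  shows "point_type d k p"
proof -
  have k: "rep_p2 p $ k ^ d = - 2 * rep_p2 p $ i ^ d"
  proof -
    have "rep_p2 p $ i ^ d + rep_p2 p $ j ^ d + rep_p2 p $ k ^ d = 0"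
      using F by (simp add: eval_at_fermat sum_3_distinct[OF ijk])
    then have "rep_p2 p $ k ^ d + (rep_p2 p $ i ^ d + rep_p2 p $ j ^ d) = 0" by (simp only: add_ac)
    then have "rep_p2 p $ k ^ d = - (rep_p2 p $ i ^ d + rep_p2 p $ j ^ d)" by (simp only: eq_neg_iff_add_eq_0)
    then show ?thesis unfolding eq by simp
  qed
  have cases: "x = i \<or> x = j" if "x \<noteq> k" for x
    using UNIV_3_distinct[OF ijk] that by blast
  show ?thesis
    unfolding point_type_def
  proof (intro allI impI conjI)
    fix x y :: 3 assume "x \<noteq> k" "y \<noteq> k" "x \<noteq> y"
    then have xy: "x = i \<and> y = j \<or> x = j \<and> y = i" using cases by blast
    then show "rep_p2 p $ y ^ d = rep_p2 p $ x ^ d" using eq by auto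
    show "rep_p2 p $ k ^ d = - 2 * rep_p2 p $ x ^ d" using xy k eq by auto
  qed
qed

lemma third_index: "\<exists>j. j \<noteq> i \<and> j \<noteq> (k::3)"
proof (rule ccontr)
  assume "\<nexists>j. j \<noteq> i \<and> j \<noteq> k"
  then have "UNIV = {i, k}" by blast
  then have "card (UNIV :: 3 set) = card {i, k}" by (rule arg_cong)
  also have "card {i, k} \<le> 2" by (simp add: card_insert_if)
  finally show False by simp
qed

text \<open>
  A line that misses the vertices of the coordinate triangle contains at most two points of each type, which
  leaves \<open>d \<le> 6\<close>. For \<open>d = 5, 6\<close> it contains two points each of two types, and comparing the moduli of the
  coefficients of the line contradicts \<open>unit_norms_ratio\<close>.
\<close>

lemma sextactic_line_vertex:
  assumes d: "d > 3" and s: "inj_on s {1..d}"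
    and sext: "\<And>n. n \<in> {1..d} \<Longrightarrow> sextactic_point (fermat d) (s n)"
    and Q: "\<And>n. n \<in> {1..d} \<Longrightarrow> hyperosculating_conic (fermat d) (s n) (Q n)"
    and l: "\<And>n. n \<in> {1..d} \<Longrightarrow> (\<Sum>a\<in>UNIV. l a * rep_p2 (s n) $ a) = 0"
  shows "\<exists>k. l k = 0"
proof (rule ccontr)
  assume "\<nexists>k. l k = 0"
  then have l0: "l k \<noteq> 0" for k by blast
  define I where "I = {1..d}"
  define v where "v n = rep_p2 (s n)" for n
  have F: "eval_at (fermat d) (s n) = 0" and v0: "v n $ a \<noteq> 0" if "n \<in> I" for n a
    using sextactic_point_coordinates[OF d sext[of n]] that by (auto simp: I_def v_def)
  have "\<exists>k. point_type d k (s n)" if "n \<in> I" for n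
  proof -
    note pt = point_typeI[OF _ _ _ F[OF that]]
    have "v n $ 2 ^ d = v n $ 3 ^ d \<or> v n $ 1 ^ d = v n $ 2 ^ d \<or> v n $ 1 ^ d = v n $ 3 ^ d"
      using that by (intro hyperosculating_conic_cases(1)[OF d F[OF that] v0[OF that] v_def Q]) (auto simp: I_def)
    then show ?thesis
      using pt[of 2 3 1] pt[of 1 2 3] pt[of 1 3 2] by (auto simp: v_def)
  qed
  then obtain t where t: "\<And>n. n \<in> I \<Longrightarrow> point_type d (t n) (s n)" by metis
  define A where "A k = {n \<in> I. t n = k}" for k
  have finA: "finite (A k)" for k by (simp add: A_def I_def)
  have "d = card (\<Union>k. A k)"
  proof -
    have "(\<Union>k. A k) = I" by (auto simp: A_def)
    then show ?thesis by (simp add: I_def)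
  qed
  also have "\<dots> = (\<Sum>k\<in>UNIV. card (A k))"
    by (rule card_UN_disjoint) (use finA in \<open>auto simp: A_def\<close>)
  finally have sum: "(\<Sum>k\<in>UNIV. card (A k)) = d" ..
  have eq: "l i * v n $ i + l j * v n $ j + l k * v n $ k = 0"
    if "n \<in> I" "i \<noteq> j" "i \<noteq> k" "j \<noteq> k" for n i j k
    using l[of n] that by (simp add: I_def v_def sum_3_distinct[OF that(2-4)])
  have type: "v n $ j ^ d = v n $ i ^ d" "v n $ k ^ d = - 2 * v n $ i ^ d"
    if "n \<in> A k" "i \<noteq> j" "i \<noteq> k" "j \<noteq> k" for n i j k
  proof -
    have "point_type d k (s n)" using t[of n] that(1) by (auto simp: A_def)
    then show "v n $ j ^ d = v n $ i ^ d" "v n $ k ^ d = - 2 * v n $ i ^ d"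
      using that(2-4) unfolding point_type_def v_def by blast+
  qed
  have distinct: "\<not> (v n $ i = c * v m $ i \<and> v n $ j = c * v m $ j \<and> v n $ k = c * v m $ k)"
    if "m \<in> I" "n \<in> I" "m \<noteq> n" and ijk: "i \<noteq> j" "i \<noteq> k" "j \<noteq> k" for m n c i j k
  proof
    assume *: "v n $ i = c * v m $ i \<and> v n $ j = c * v m $ j \<and> v n $ k = c * v m $ k"
    have "v n = c *s v m"
      using * by (intro vec_eq_distinctI[OF ijk]) auto
    moreover from this have "c \<noteq> 0" using v0[OF that(2), of i] by auto
    ultimately have "s m = s n" unfolding v_def by (metis p2_eqI)
    then show False using s that by (auto simp: I_def dest: inj_onD)
  qed
  have AI: "n \<in> I" if "n \<in> A k" for n k using that by (simp add: A_def)
  have le2: "card (A k) \<le> 2" for k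
  proof (rule ccontr)
    assume "\<not> card (A k) \<le> 2"
    then obtain B where "B \<subseteq> A k" "card B = 3"
      using obtain_subset_with_card_n[of 3 "A k"] by auto
    then obtain m n h where mnh: "{m, n, h} \<subseteq> A k" "m \<noteq> n" "m \<noteq> h" "n \<noteq> h"
      unfolding card_3_iff by blast
    obtain i where i: "i \<noteq> k" using third_index[of k k] by blast
    obtain j where j: "j \<noteq> i" "j \<noteq> k" using third_index[of i k] by blast
    have ijk: "i \<noteq> j" "i \<noteq> k" "j \<noteq> k" using i j by auto
    show False
    proof (rule not_three_points[where A = "A k" and x = "\<lambda>n. v n $ i" and y = "\<lambda>n. v n $ j" and z = "\<lambda>n. v n $ k"])
      show "0 < d" using d by simp
      show "l i \<noteq> 0" "l j \<noteq> 0" "l k \<noteq> 0" by (rule l0)+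
      show "v n $ i \<noteq> 0" if "n \<in> A k" for n using v0 AI that by blast
      show "l i * v n $ i + l j * v n $ j + l k * v n $ k = 0" if "n \<in> A k" for n
        using eq AI that ijk by blast
      show "v n $ j ^ d = v n $ i ^ d" "v n $ k ^ d = - 2 * v n $ i ^ d" if "n \<in> A k" for n
        using type[OF that ijk] by auto
      show "\<not> (v n $ i = c * v m $ i \<and> v n $ j = c * v m $ j \<and> v n $ k = c * v m $ k)"
        if "m \<in> A k" "n \<in> A k" "m \<noteq> n" for c m n
        using distinct[OF AI[OF that(1)] AI[OF that(2)] that(3) ijk] .
    qed (rule mnh)+
  qed
  define R :: real where "R = root d 4"
  have R: "R > 0" "R ^ d = 4" using d by (simp_all add: R_def)
  have pair: "\<exists>K Na Nb Nc. K > 0 \<and> Na \<in> unit_norms d \<and> Nb \<in> unit_norms d \<and> Nc \<in> unit_norms d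
      \<and> (cmod (l i))^2 = K * R * Na \<and> (cmod (l j))^2 = K * R * Nb \<and> (cmod (l k))^2 = K * Nc
      \<and> (l j * cnj (l k)) ^ d = (cnj (l j) * l k) ^ d"
    if card: "card (A k) \<ge> 2" and ijk: "i \<noteq> j" "i \<noteq> k" "j \<noteq> k" for i j k
  proof -
    obtain m n where mn: "m \<in> A k" "n \<in> A k" "m \<noteq> n"
      using card finA by (metis card_le_Suc0_iff_eq not_less_eq_eq numeral_2_eq_2)
    have d0: "d > 0" using d by simp
    show ?thesis
    proof (rule line_through_pair[OF d0 R l0[of i] l0[of j] l0[of k] v0[OF AI[OF mn(1)], of i] v0[OF AI[OF mn(2)], of i]
        eq[OF AI[OF mn(1)] ijk] type[OF mn(1) ijk] eq[OF AI[OF mn(2)] ijk] type[OF mn(2) ijk]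
        distinct[OF AI[OF mn(1)] AI[OF mn(2)] mn(3) ijk]])
      fix K Na Nb Nc
      assume "K > 0" "Na \<in> unit_norms d" "Nb \<in> unit_norms d" "Nc \<in> unit_norms d"
        "(cmod (l i))^2 = K * R * Na" "(cmod (l j))^2 = K * R * Nb" "(cmod (l k))^2 = K * Nc"
        "(l j * cnj (l k)) ^ d = (cnj (l j) * l k) ^ d"
      then show ?thesis by (intro exI conjI)
    qed
  qed
  have two_pairs: False
    if d56: "d = 5 \<or> d = 6" and card: "card (A i) \<ge> 2" "card (A k) \<ge> 2" and "i \<noteq> k" for i k
  proof -
    obtain j where "j \<noteq> i" "j \<noteq> k" using third_index[of i k] by blast
    with \<open>i \<noteq> k\<close> have ijk: "i \<noteq> j" "i \<noteq> k" "j \<noteq> k" by auto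
    obtain K Nb Nc where 1: "K > 0" "Nb \<in> unit_norms d" "Nc \<in> unit_norms d"
      "(cmod (l j))^2 = K * R * Nb" "(cmod (l k))^2 = K * Nc"
      using pair[OF card(2) ijk] by blast
    obtain K' N N' where 2: "K' > 0" "N \<in> unit_norms d" "N' \<in> unit_norms d"
      "(cmod (l j))^2 = K' * R * N" "(cmod (l k))^2 = K' * R * N'"
      using pair[OF card(1), of j k] ijk by metis
    \<comment> \<open>Both pairs determine the ratio of the moduli of \<open>l j\<close> and
      \<open>l k\<close>. The factor \<open>R\<close> is absent from the coefficient at the type of
      the pair, so it cancels for type \<open>i\<close> but not for type \<open>k\<close>.\<close>
    have "(cmod (l j))^2 * (cmod (l k))^2 = (cmod (l j))^2 * (cmod (l k))^2" ..
    then have "(K * R * Nb) * (K' * R * N') = (K' * R * N) * (K * Nc)"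
      using 1(4,5) 2(4,5) by metis
    then have "(K * K' * R) * (R * Nb * N') = (K * K' * R) * (N * Nc)"
      by (simp add: mult_ac)
    then have "R * Nb * N' = N * Nc" using 1 2 R by simp
    then show False using unit_norms_ratio[OF d56 R 1(2) 2(3,2) 1(3)] by simp
  qed
  \<comment> \<open>Four points may be distributed as 2 + 1 + 1, so a pair of type \<open>k\<close>
    has to be compared with a single point of another type.\<close>
  have four: False if d4: "d = 4" and card: "card (A k) \<ge> 2" and m: "m \<in> A i" "i \<noteq> k" for i k m
  proof -
    obtain j where "j \<noteq> i" "j \<noteq> k" using third_index[of i k] by blast
    with m have ijk: "i \<noteq> j" "i \<noteq> k" "j \<noteq> k" by auto
    obtain K Na Nb Nc where N: "K > 0" "Na \<in> unit_norms d" "Nb \<in> unit_norms d" "Nc \<in> unit_norms d"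
      "(cmod (l i))^2 = K * R * Na" "(cmod (l j))^2 = K * R * Nb" "(cmod (l k))^2 = K * Nc"
      "(l j * cnj (l k)) ^ d = (cnj (l j) * l k) ^ d"
      using pair[OF card ijk] by blast
    show False
      using quartic_pair_and_point[OF R(1) R(2)[unfolded d4] N(1) N(2-8)[unfolded d4] v0[OF AI[OF m(1)], of j]
          eq[OF AI[OF m(1)] ijk]] type[OF m(1), of j k] ijk d4 by auto
  qed
  have bound: "d \<le> 6"
    using sum le2[of 1] le2[of 2] le2[of 3] by (simp add: sum_3)
  show False
  proof (cases "d = 4")
    case True
    have "\<exists>k. card (A k) \<ge> 2"
    proof (rule ccontr)
      assume "\<nexists>k. card (A k) \<ge> 2"
      then have "card (A 1) < 2" "card (A 2) < 2" "card (A 3) < 2" by (auto simp: not_le)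
      then show False using sum True by (simp add: sum_3)
    qed
    then obtain k where k: "card (A k) \<ge> 2" by blast
    have "\<not> I \<subseteq> A k"
    proof
      assume "I \<subseteq> A k"
      then have "card I \<le> card (A k)" using finA by (rule card_mono[rotated])
      then show False using le2[of k] True by (simp add: I_def)
    qed
    then obtain m where "m \<in> I" "m \<notin> A k" by blast
    then show False using four[OF True k, of m "t m"] by (simp add: A_def)
  next
    case False
    with bound d have d56: "d = 5 \<or> d = 6" by auto
    note tp = two_pairs[OF d56]
    have "card (A 1) \<ge> 2 \<and> card (A 2) \<ge> 2 \<or> card (A 1) \<ge> 2 \<and> card (A 3) \<ge> 2 \<or> card (A 2) \<ge> 2 \<and> card (A 3) \<ge> 2"
      using sum le2[of 1] le2[of 2] le2[of 3] d56 by (auto simp: sum_3)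
    then show False using tp[of 1 2] tp[of 1 3] tp[of 2 3] by auto
  qed
qed

section \<open>Points that differ in a single coordinate, and their conics\<close>

lemma osc_form_scale: "osc_form d (c * X) (c * Y) (c * Z) = c^2 * osc_form d X Y Z"
proof -
  have "A * ((c * X)^2 + (c * Y)^2) - B * (c * X) * (c * Y) + C * (c * X + c * Y) * (c * Z) - E * (c * Z)^2
      = c^2 * (A * (X^2 + Y^2) - B * X * Y + C * (X + Y) * Z - E * Z^2)" for A B C E :: complex
    by algebra
  then show ?thesis unfolding osc_form_def .
qed

text \<open>The nondegeneracy required by \<open>conics_two_points\<close>. The last two are the
  discriminants of \<open>osc_form\<close> after deleting \<open>Z\<close>, respectively
  \<open>X\<close> or \<open>Y\<close>.\<close>

lemma osc_form_conditions:
  fixes d :: nat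
  assumes "d > 3"
  shows "of_nat (d * (d + 1)) \<noteq> (0::complex)" "of_nat (2 * (d - 2) * (5 * d - 3)) \<noteq> (0::complex)"
    "of_nat (8 * d * (d - 2)) \<noteq> (0::complex)" "of_nat (4 * (d + 1) * (2 * d - 3)) \<noteq> (0::complex)"
    "of_nat (2 * (d - 2) * (5 * d - 3)) ^ 2 \<noteq> (4 * of_nat (d * (d + 1)) * of_nat (d * (d + 1)) :: complex)"
    "of_nat (8 * d * (d - 2)) ^ 2 \<noteq> (- 4 * of_nat (d * (d + 1)) * of_nat (4 * (d + 1) * (2 * d - 3)) :: complex)"
proof -
  show "of_nat (d * (d + 1)) \<noteq> (0::complex)" "of_nat (2 * (d - 2) * (5 * d - 3)) \<noteq> (0::complex)"
    "of_nat (8 * d * (d - 2)) \<noteq> (0::complex)" "of_nat (4 * (d + 1) * (2 * d - 3)) \<noteq> (0::complex)"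
    unfolding of_nat_eq_0_iff using assms by auto
  have lt: "of_nat B ^ 2 \<noteq> (4 * of_nat A * of_nat A :: complex)" if "2 * A < B" for A B :: nat
  proof
    assume "of_nat B ^ 2 = (4 * of_nat A * of_nat A :: complex)"
    then have "complex_of_nat (B ^ 2) = of_nat ((2 * A) ^ 2)"
      by (simp add: power_mult_distrib power2_eq_square)
    moreover have "(2 * A) ^ 2 < B ^ 2" using that by (rule power_strict_mono) auto
    ultimately show False unfolding of_nat_eq_iff by simp
  qed
  have pos: "of_nat C ^ 2 \<noteq> (- 4 * of_nat A * of_nat E :: complex)" if "C > 0" for A C E :: nat
  proof
    assume "of_nat C ^ 2 = (- 4 * of_nat A * of_nat E :: complex)"
    then have "complex_of_nat (C ^ 2 + 4 * A * E) = 0" by simp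
    then show False unfolding of_nat_eq_0_iff using that by simp
  qed
  \<comment> \<open>Replaces the truncated differences in \<open>d\<close> by sums.\<close>
  obtain e where e: "d = e + 4" using assms le_Suc_ex[of 4 d] by (auto simp: add.commute)
  have "2 * (d * (d + 1)) < 2 * (d - 2) * (5 * d - 3)" by (simp add: e algebra_simps)
  then show "of_nat (2 * (d - 2) * (5 * d - 3)) ^ 2 \<noteq> (4 * of_nat (d * (d + 1)) * of_nat (d * (d + 1)) :: complex)"
    by (rule lt)
  show "of_nat (8 * d * (d - 2)) ^ 2 \<noteq> (- 4 * of_nat (d * (d + 1)) * of_nat (4 * (d + 1) * (2 * d - 3)) :: complex)"
    by (rule pos) (use assms in simp)
qed

lemma homogeneous_tangent_line: "homogeneous 1 (tangent_line F p)"
  unfolding tangent_line_altdef sum_3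
  by (intro homogeneous_add homogeneous_tconst_mult homogeneous_var)

theorem theorem1p1:
  fixes d :: nat and s :: "nat \<Rightarrow> p2" and Q :: "nat \<Rightarrow> tpoly"
  assumes "d > 3"
    and "inj_on s {1..d}"
    and "\<And>i. i \<in> {1..d} \<Longrightarrow> sextactic_point (fermat d) (s i)"
    and "\<exists>L. is_line L \<and> (\<forall>i\<in>{1..d}. s i \<in> zero_locus L)"
    and "\<And>i. i \<in> {1..d} \<Longrightarrow> hyperosculating_conic (fermat d) (s i) (Q i)"
  shows "(\<exists>q. (\<Inter>i\<in>{1..d}. zero_locus (tangent_line (fermat d) (s i))) = {q} \<and>
            fold_point_of_union d {1..d} (\<lambda>i. tangent_line (fermat d) (s i)) q)
       \<and> (\<exists>q1 q2. q1 \<noteq> q2 \<and> (\<Inter>i\<in>{1..d}. zero_locus (Q i)) = {q1, q2} \<and>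
            fold_point_of_union d {1..d} Q q1 \<and> fold_point_of_union d {1..d} Q q2)"
proof -
  note d = assms(1)
  define I where "I = {1..d}"
  have I: "finite I" "card I = d" "1 \<in> I" using d by (auto simp: I_def)
  define v where "v n = rep_p2 (s n)" for n
  have F: "eval_at (fermat d) (s n) = 0" and v0: "v n $ a \<noteq> 0" if "n \<in> I" for n a
    using sextactic_point_coordinates[OF d assms(3)[of n]] that by (auto simp: I_def v_def)
  obtain L where L: "is_line L" "\<And>n. n \<in> I \<Longrightarrow> s n \<in> zero_locus L"
    using assms(4) by (auto simp: I_def)
  then obtain l where l: "L = (\<Sum>a\<in>UNIV. tconst (l a) * var a)"
    using linear_form unfolding is_line_def by blast
  have on_line: "(\<Sum>a\<in>UNIV. l a * v n $ a) = 0" if "n \<in> I" for n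
    using L(2)[OF that]
    by (simp add: zero_locus_def eval_at_def v_def l is_hom_sum[OF is_hom_eval3] eval3_simps)
  obtain k where lk: "l k = 0"
    using sextactic_line_vertex[OF d assms(2,3,5)] on_line unfolding I_def v_def by blast
  obtain i where i: "i \<noteq> k" using third_index[of k k] by blast
  obtain j where j: "j \<noteq> i" "j \<noteq> k" using third_index[of i k] by blast
  have ijk: "i \<noteq> j" "i \<noteq> k" "j \<noteq> k" using i j by auto
  have lij: "l i * v n $ i + l j * v n $ j = 0" if "n \<in> I" for n
    using on_line[OF that] by (simp add: sum_3_distinct[OF ijk] lk)
  have l0: "l i \<noteq> 0" "l j \<noteq> 0"
  proof -
    have "\<not> (l i = 0 \<and> l j = 0)"
    proof
      assume "l i = 0 \<and> l j = 0"
      then have "L = 0" by (simp add: l sum_3_distinct[OF ijk] lk tconst_hom)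
      then show False using L(1) by (simp add: is_line_def)
    qed
    then show "l i \<noteq> 0" "l j \<noteq> 0"
      using lij[OF I(3)] v0[OF I(3)] by (auto simp: add_eq_0_iff)
  qed
  \<comment> \<open>The line passes through the vertex \<open>k\<close>, hence the other two
    coordinates have the same ratio at all points.\<close>
  define r where "r = - l i / l j"
  have r: "r \<noteq> 0" using l0 by (simp add: r_def)
  have vj: "v n $ j = r * v n $ i" if "n \<in> I" for n
    using lij[OF that] l0 by (simp add: r_def field_simps add_eq_0_iff)
  \<comment> \<open>In positions \<open>i\<close>, \<open>j\<close>, \<open>k\<close> the points are
    now (1, \<open>r\<close>, \<open>m n\<close>) up to a scalar, and the curve makes
    \<open>m n ^ d\<close> constant.\<close>
  define m where "m n = v n $ k / v n $ i" for n
  have vk: "v n $ k = m n * v n $ i" and m0: "m n \<noteq> 0" if "n \<in> I" for n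
    using v0[OF that] by (simp_all add: m_def)
  have md: "m n ^ d = - (1 + r ^ d)" if "n \<in> I" for n
  proof -
    have "v n $ i ^ d + v n $ j ^ d + v n $ k ^ d = 0"
      using F[OF that] by (simp add: eval_at_fermat sum_3_distinct[OF ijk] v_def)
    then have "v n $ i ^ d * (m n ^ d + (1 + r ^ d)) = 0"
      unfolding vj[OF that] vk[OF that] by (simp add: power_mult_distrib algebra_simps)
    then have "m n ^ d + (1 + r ^ d) = 0" using v0[OF that, of i] by simp
    then show ?thesis by (simp only: eq_neg_iff_add_eq_0)
  qed
  have m_inj: "inj_on m I"
  proof (rule inj_onI)
    fix x y assume xy: "x \<in> I" "y \<in> I" "m x = m y"
    define c where "c = v y $ i / v x $ i"
    have "c \<noteq> 0" "v y $ i = c * v x $ i" using v0 xy by (simp_all add: c_def)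
    then have "v y = c *s v x"
      using xy vj vk by (intro vec_eq_distinctI[OF ijk]) simp_all
    then have "s x = s y" using p2_eqI[OF \<open>c \<noteq> 0\<close>] by (simp add: v_def)
    then show "x = y" using assms(2) xy by (auto simp: I_def dest: inj_onD)
  qed
  have "\<exists>q. (\<Inter>n\<in>I. zero_locus (tangent_line (fermat d) (s n))) = {q} \<and>
      fold_point_of_union (card I) I (\<lambda>n. tangent_line (fermat d) (s n)) q"
  proof (rule concurrent_lines[OF ijk I(1), where c = "\<lambda>n. of_nat d * v n $ i ^ (d - 1)"
      and r = "r ^ (d - 1)" and m = "\<lambda>n. m n ^ (d - 1)"])
    show "2 \<le> card I" using d I by simp
    show "homogeneous 1 (tangent_line (fermat d) (s n))" for n by (rule homogeneous_tangent_line)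
    show "of_nat d * v n $ i ^ (d - 1) \<noteq> 0" if "n \<in> I" for n
      using v0[OF that] d by simp
    show "eval3 (tangent_line (fermat d) (s n)) w
        = of_nat d * v n $ i ^ (d - 1) * (w $ i + r ^ (d - 1) * w $ j + m n ^ (d - 1) * w $ k)"
      if "n \<in> I" for n w
    proof -
      have "eval3 (tangent_line (fermat d) (s n)) w = (\<Sum>a\<in>UNIV. of_nat d * v n $ a ^ (d - 1) * w $ a)"
        by (simp add: tangent_line_altdef is_hom_sum[OF is_hom_eval3] eval3_simps eval_at_partial_fermat v_def)
      then show ?thesis
        unfolding sum_3_distinct[OF ijk] vj[OF that] vk[OF that]
        by (simp add: power_mult_distrib algebra_simps)
    qed
    show "inj_on (\<lambda>n. m n ^ (d - 1)) I"
    proof (rule inj_onI)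
      fix x y assume xy: "x \<in> I" "y \<in> I" "m x ^ (d - 1) = m y ^ (d - 1)"
      \<comment> \<open>The d-th powers agree, so equal powers with exponent \<open>d - 1\<close>
        force equal \<open>m\<close>.\<close>
      have "m n * m n ^ (d - 1) = m n ^ d" for n using d by (cases d) auto
      then have "m x * m x ^ (d - 1) = m y * m x ^ (d - 1)"
        using md xy by metis
      then have "m x = m y" using m0[OF xy(1)] by simp
      then show "x = y" using m_inj xy by (auto dest: inj_onD)
    qed
  qed
  moreover have "\<exists>p1 p2. p1 \<noteq> p2 \<and> (\<Inter>n\<in>I. zero_locus (Q n)) = {p1, p2} \<and>
    fold_point_of_union (card I) I Q p1 \<and> fold_point_of_union (card I) I Q p2"
  proof -
    define A B C E where const_defs: "A = complex_of_nat (d * (d + 1))"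
      "B = complex_of_nat (2 * (d - 2) * (5 * d - 3))"
      "C = complex_of_nat (8 * d * (d - 2))" "E = complex_of_nat (4 * (d + 1) * (2 * d - 3))"
    note osc = osc_form_def[of d, folded const_defs]
    have nz: "A \<noteq> 0" "B \<noteq> 0" "C \<noteq> 0" "E \<noteq> 0" "B^2 \<noteq> 4 * A * A" "C^2 \<noteq> - 4 * A * E"
      unfolding const_defs by (rule osc_form_conditions[OF d])+
    have card3: "3 \<le> card I" using d I by simp
    have hQ: "homogeneous 2 (Q n)" if "n \<in> I" for n
      using assms(5)[of n] that
      by (auto simp: I_def hyperosculating_conic_def osculating_conic_def is_conic_def)
    have Qn: "hyperosculating_conic (fermat d) (s n) (Q n)" if "n \<in> I" for n
      using assms(5)[of n] that by (auto simp: I_def)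
    note cases = hyperosculating_conic_cases[OF d F v0 v_def Qn]
    have quot: "w $ i / v n $ i = 1 / v n $ i * w $ i" "w $ j / v n $ j = 1 / v n $ i * (w $ j / r)"
      "w $ k / v n $ k = 1 / v n $ i * (w $ k / m n)" if "n \<in> I" for n w
      using vj[OF that] vk[OF that] by simp_all
    have pd: "v n $ j ^ d = r ^ d * v n $ i ^ d" "v n $ k ^ d = - (1 + r ^ d) * v n $ i ^ d" if "n \<in> I" for n
      using vj[OF that] vk[OF that] md[OF that] by (simp_all add: power_mult_distrib)
    have "v 1 $ j ^ d = v 1 $ k ^ d \<or> v 1 $ i ^ d = v 1 $ j ^ d \<or> v 1 $ i ^ d = v 1 $ k ^ d"
      using cases(1)[OF I(3) I(3) I(3) ijk] .
    \<comment> \<open>For every \<open>n\<close> the d-th powers are proportional to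
      \<open>1\<close>, \<open>r ^ d\<close>, \<open>- (1 + r ^ d)\<close>, so all points share the
      type of the first. In cases 1 and 3 the varying coordinate \<open>k\<close> belongs to the
      equal pair, in case 2 it is the remaining one.\<close>
    then consider "r ^ d = - (1 + r ^ d)" | "r ^ d = 1" | "- (1 + r ^ d) = 1"
      unfolding pd[OF I(3)] using v0[OF I(3), of i] by auto
    then show ?thesis
    proof cases
      case 1
      have "\<exists>e. e \<noteq> 0 \<and> (\<forall>w. eval3 (Q n) w = e * osc_form d (w $ j / r) (w $ k / m n) (w $ i))" if n: "n \<in> I" for n
      proof -
        have "v n $ j ^ d = v n $ k ^ d" using pd[OF n] 1 by simp
        then obtain e where e: "e \<noteq> 0" "\<And>w. eval3 (Q n) w = e * osc_form d (w $ j / v n $ j) (w $ k / v n $ k) (w $ i / v n $ i)"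
          using cases(2)[OF n n n ijk] by blast
        have "eval3 (Q n) w = e * (1 / v n $ i)^2 * osc_form d (w $ j / r) (w $ k / m n) (w $ i)" for w
          using e(2)[of w] unfolding quot[OF n] osc_form_scale by (simp only: mult.assoc)
        moreover have "e * (1 / v n $ i)^2 \<noteq> 0" using e(1) v0[OF n, of i] by simp
        ultimately show ?thesis by blast
      qed
      then obtain e where e: "\<And>n. n \<in> I \<Longrightarrow> e n \<noteq> 0"
        "\<And>n w. n \<in> I \<Longrightarrow> eval3 (Q n) w = e n * osc_form d (w $ j / r) (w $ k / m n) (w $ i)" by metis
      show ?thesis
      proof (rule conics_two_points[OF ijk I(1) card3 hQ _ e(2) e(1) m_inj m0 r])
        \<comment> \<open>The scaled coordinate must be the third argument \<open>Z\<close> of the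
          form in \<open>conics_two_points\<close>, so the arguments of \<open>osc_form\<close> are
          permuted according to the case.\<close>
        show "osc_form d Y Z X = A * Z^2 + (C * X + (- B) * Y) * Z + ((- E) * X^2 + C * X * Y + A * Y^2)" for X Y Z
          unfolding osc by algebra
      qed (use nz in auto)
    next
      case 2
      have "\<exists>e. e \<noteq> 0 \<and> (\<forall>w. eval3 (Q n) w = e * osc_form d (w $ i) (w $ j / r) (w $ k / m n))" if n: "n \<in> I" for n
      proof -
        have "v n $ i ^ d = v n $ j ^ d" using pd[OF n] 2 by simp
        then obtain e where e: "e \<noteq> 0" "\<And>w. eval3 (Q n) w = e * osc_form d (w $ i / v n $ i) (w $ j / v n $ j) (w $ k / v n $ k)"
          using cases(2)[OF n n n, of k i j] ijk by metis
        have "eval3 (Q n) w = e * (1 / v n $ i)^2 * osc_form d (w $ i) (w $ j / r) (w $ k / m n)" for w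
          using e(2)[of w] unfolding quot[OF n] osc_form_scale by (simp only: mult.assoc)
        moreover have "e * (1 / v n $ i)^2 \<noteq> 0" using e(1) v0[OF n, of i] by simp
        ultimately show ?thesis by blast
      qed
      then obtain e where e: "\<And>n. n \<in> I \<Longrightarrow> e n \<noteq> 0"
        "\<And>n w. n \<in> I \<Longrightarrow> eval3 (Q n) w = e n * osc_form d (w $ i) (w $ j / r) (w $ k / m n)" by metis
      show ?thesis
      proof (rule conics_two_points[OF ijk I(1) card3 hQ _ e(2) e(1) m_inj m0 r])
        show "osc_form d X Y Z = (- E) * Z^2 + (C * X + C * Y) * Z + (A * X^2 + (- B) * X * Y + A * Y^2)" for X Y Z
          unfolding osc by algebra
      qed (use nz in auto)
    next
      case 3
      have "\<exists>e. e \<noteq> 0 \<and> (\<forall>w. eval3 (Q n) w = e * osc_form d (w $ i) (w $ k / m n) (w $ j / r))" if n: "n \<in> I" for n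
      proof -
        have "v n $ i ^ d = v n $ k ^ d" using pd[OF n] 3 by simp
        then obtain e where e: "e \<noteq> 0" "\<And>w. eval3 (Q n) w = e * osc_form d (w $ i / v n $ i) (w $ k / v n $ k) (w $ j / v n $ j)"
          using cases(2)[OF n n n, of j i k] ijk by metis
        have "eval3 (Q n) w = e * (1 / v n $ i)^2 * osc_form d (w $ i) (w $ k / m n) (w $ j / r)" for w
          using e(2)[of w] unfolding quot[OF n] osc_form_scale by (simp only: mult.assoc)
        moreover have "e * (1 / v n $ i)^2 \<noteq> 0" using e(1) v0[OF n, of i] by simp
        ultimately show ?thesis by blast
      qed
      then obtain e where e: "\<And>n. n \<in> I \<Longrightarrow> e n \<noteq> 0"
        "\<And>n w. n \<in> I \<Longrightarrow> eval3 (Q n) w = e n * osc_form d (w $ i) (w $ k / m n) (w $ j / r)" by metis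
      show ?thesis
      proof (rule conics_two_points[OF ijk I(1) card3 hQ _ e(2) e(1) m_inj m0 r])
        show "osc_form d X Z Y = A * Z^2 + ((- B) * X + C * Y) * Z + (A * X^2 + C * X * Y + (- E) * Y^2)" for X Y Z
          unfolding osc by algebra
      qed (use nz in auto)
    qed
  qed
  ultimately show ?thesis unfolding I(2) by (simp only: I_def)
qed

end
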